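(* Let $F$ be a regularly varying function such that \[ \frac{F(x)}{\log x}\xrightarrow{x\to\infty}\infty \quad\text{and}\quad F(x)\le (1+o(1))\,\frac{1}{(h-1)!}\,\frac{x^{h-1}}{b_1\cdots b_h}. \] Then there exists $A\subseteq\mathbb{Z}_{\ge 0}$ such that $r_{A,h}(n)\sim F(n)$ as $n\to\infty$.
   Context: Fix an integer $h\ge 2$ and positive integers $b_1,\dots,b_h$, not necessarily distinct, with $\gcd(b_1,\dots,b_h)=1$. For $A\subseteq\mathbb{Z}_{\ge 0}$, $1\le\ell\le h$ and an integer $n\ge 0$, let $r_{A,\ell}(n)$ be the number of $\ell$-tuples $(k_1,\dots,k_\ell)\in A^\ell$ with $b_1k_1+\cdots+b_\ell k_\ell=n$. A function $F$ is regularly varying if it is a positive measurable function on $[1,\infty)$ such that for every real $\lambda>0$ the limit $\lim_{x\to\infty}F(\lambda x)/F(x)$ exists and is finite and positive. $X\sim Y$ means $X/Y\to1$. *)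

theory Defs
  imports "HOL-Analysis.Analysis" "HOL-Library.Landau_Symbols"
begin

text \<open>Coefficients b_1..b_h are given as a function b :: nat => nat, used on indices 1..l.
  r_{A,l}(n): number of l-tuples (k_1,..,k_l) in A^l with b_1 k_1 + ... + b_l k_l = n.
  Tuples are represented as functions nat => nat that vanish outside {1..l}.\<close>
definition rep :: "(nat \<Rightarrow> nat) \<Rightarrow> nat set \<Rightarrow> nat \<Rightarrow> nat \<Rightarrow> nat" where
  "rep b A l n = card {k :: nat \<Rightarrow> nat. (\<forall>i\<in>{1..l}. k i \<in> A) \<and> (\<forall>i. i \<notin> {1..l} \<longrightarrow> k i = 0)
                        \<and> (\<Sum>i=1..l. b i * k i) = n}"

definition regularly_varying :: "(real \<Rightarrow> real) \<Rightarrow> bool" where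
  "regularly_varying F \<longleftrightarrow>
     (\<forall>x\<ge>1. F x > 0) \<and>
     F \<in> borel_measurable (restrict_space borel {1..}) \<and>
     (\<forall>c>0. \<exists>L>0. ((\<lambda>x. F (c * x) / F x) \<longlongrightarrow> L) at_top)"

end

theory Submission
  imports Defs "HOL-Real_Asymp.Real_Asymp" "HOL-Number_Theory.Cong"
begin

text \<open>
  Put each \<open>n\<close> into a random set \<open>A\<close> independently with probability
  \<open>p(n) = min(1, (F(n) / (K n\<^sup>h\<^sup>-\<^sup>1))\<^sup>1\<^sup>/\<^sup>h)\<close>. If \<open>F\<close> has index \<open>\<kappa>\<close>, then \<open>p\<close> is regularly varying with index
  \<open>\<sigma> - 1\<close>, \<open>\<sigma> = (\<kappa> + 1) / h\<close>, and iterated convolution (a Beta integral at each step, restricted to a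
  residue class governed by the gcd of the coefficients used so far) shows that the expected number
  of representations is asymptotic to \<open>F(n)\<close> for \<open>K = \<Prod>b\<^sub>i\<^sup>-\<^sup>\<sigma> \<Gamma>(\<sigma>)\<^sup>h / \<Gamma>(h\<sigma>)\<close>. When \<open>\<kappa> = h - 1\<close> this \<open>K\<close> is the constant of
  the upper bound on \<open>F\<close>, so that truncating \<open>p\<close> at 1 is harmless.

  Equations with fewer than \<open>h\<close> variables have, with high probability, \<open>O(n\<^sup>g)\<close> solutions in \<open>A\<close> for some
  \<open>g \<ge> 0\<close> with \<open>F(n) / (n\<^sup>g log n) \<rightarrow> \<infinity>\<close> (induction on the number of variables); hence every
  representation meets few others. Counting ordered tuples of pairwise disjoint representations then
  bounds the upper tail, and Janson's inequality bounds the lower tail, both summably in \<open>n\<close>. Finitely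
  many \<open>n\<close> at a time can therefore be satisfied by a finite set, and compactness gives \<open>A\<close>.
\<close>

subsection \<open>Uniform convergence for regularly varying functions\<close>

text \<open>Since \<open>F\<close> may exceed \<open>log n\<close> by an arbitrarily slowly growing
  factor, tails of order \<open>exp (- const * F n / n^g)\<close> reach \<open>n^-2\<close> only
  because \<open>F n / (n^g * log n)\<close> is unbounded, and for index near 0 this forces
  \<open>g = 0\<close>. That is affordable: fixing one variable costs a factor of about
  \<open>n^\<sigma>\<close> in the expected count, so equations in \<open>h - 1\<close> variables
  have exponent about \<open>\<kappa> - \<sigma>\<close>, which leaves a polynomial gap below
  \<open>g\<close>. The gap lets moments of a fixed order control the shorter equations; the full
  equation has no such gap and needs an order proportional to \<open>F n / n^g\<close>. The exponent
  \<open>1 / h\<close> in \<open>p\<close> inverts the heuristic count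
  \<open>K * n^(h-1) * p(n)^h\<close>. Coefficients used so far may share a factor although all of
  them together do not; the normalised count then has no limit, so asymptotics are stated as
  differences, with the main term switched off outside the multiples of the gcd. The failures are of
  two kinds: heavy and light counts are summable in \<open>n\<close>, while crowding of shorter
  equations is excluded for all targets at once, with a constant that does not depend on the finite
  range considered.\<close>

lemma measurable_translates_meet:
  fixes S T :: "real set"
  assumes "S \<in> sets borel" "T \<in> sets borel" "S \<subseteq> {0..2*K}" "T \<subseteq> {0..K}" "K > 0"
    and "measure lborel S > 3/2*K" "measure lborel T > K/2" "0 \<le> u" "u \<le> K"
  shows "\<exists>y\<in>T. u + y \<in> S"
proof (rule ccontr)
  assume contra: "\<not> ?thesis"
  define T' where "T' = (+) u ` T"
  have T'eq: "T' = (\<lambda>y. y - u) -` T \<inter> space lborel"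
    unfolding T'_def by (auto simp: image_iff) (metis add.commute diff_add_cancel)
  have T'm: "T' \<in> sets borel"
    unfolding T'eq using measurable_sets[of "\<lambda>y. y - u" borel borel T] assms by simp
  have mT': "measure lborel T' = measure lborel T"
    using measure_translation[of u T] measure_completion[of T lborel] measure_completion[of T' lborel] T'm assms
    by (simp add: T'_def)
  have fin: "emeasure lborel {0..2*K} < \<infinity>" using assms by simp
  have sub: "T' \<subseteq> {0..2*K}" using assms unfolding T'_def by fastforce
  have disj: "S \<inter> T' = {}" using contra unfolding T'_def by auto
  have fS: "emeasure lborel S \<noteq> \<infinity>" using emeasure_mono[OF assms(3), of lborel] fin by (auto simp: top_unique)
  have fT': "emeasure lborel T' \<noteq> \<infinity>" using emeasure_mono[OF sub, of lborel] fin by (auto simp: top_unique)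
  \<comment> \<open>\<open>S\<close> and the translate \<open>T'\<close> both lie in an interval of
    length \<open>2 * K\<close>, while their measures add up to more than \<open>2 * K\<close>, so
    they cannot be disjoint.\<close>
  have "measure lborel (S \<union> T') = measure lborel S + measure lborel T'"
    by (rule measure_Union) (use fS fT' disj assms T'm in auto)
  moreover have "measure lborel (S \<union> T') \<le> measure lborel {0..2*K}"
    by (rule measure_mono_fmeasurable) (use assms sub T'm fin in \<open>auto simp: fmeasurable_def\<close>)
  ultimately show False using mT' assms by simp
qed

lemma measure_exhaust:
  fixes U :: "nat \<Rightarrow> real set"
  assumes "\<And>n. U n \<in> sets borel" "incseq U" "(\<Union>n. U n) = {0..K}" "c < K" "K > 0"
  shows "eventually (\<lambda>n. measure lborel (U n) > c) sequentially"
proof -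
  have "(\<lambda>n. measure lborel (U n)) \<longlonglongrightarrow> measure lborel (\<Union>n. U n)"
    by (rule Lim_measure_incseq) (use assms in auto)
  then have "(\<lambda>n. measure lborel (U n)) \<longlonglongrightarrow> K" using assms by simp
  then show ?thesis using order_tendstoD(1) assms(4) by blast
qed

text \<open>By measurability \<open>\<bar>k\<bar>\<close> is at most some \<open>n\<close> on nearly
  all of \<open>{0..2}\<close> and of \<open>{0..1}\<close>; a point \<open>y\<close> that is good
  together with \<open>u + y\<close> then bounds \<open>k u\<close> on the unit interval.
  Subtracting \<open>k 1 * x\<close> leaves an additive function that vanishes at the integers. It
  is 1-periodic, hence bounded on the whole line, and a bounded additive function is 0.\<close>

lemma additive_measurable_linear:
  fixes k :: "real \<Rightarrow> real"
  assumes [measurable]: "k \<in> borel_measurable borel" and add: "\<And>u v. k (u + v) = k u + k v"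
  shows "k u = k 1 * u"
proof -
  define S where "S n = {y\<in>{0..2}. \<bar>k y\<bar> \<le> real n}" for n :: nat
  define T where "T n = {y\<in>{0..1}. \<bar>k y\<bar> \<le> real n}" for n :: nat
  have "S n \<in> sets borel" for n unfolding S_def by measurable
  moreover have "incseq S" unfolding S_def by (auto simp: incseq_def)
  moreover have "(\<Union>n. S n) = {0..2}" unfolding S_def using real_arch_simple by auto
  ultimately have eS: "eventually (\<lambda>n. measure lborel (S n) > 3/2) sequentially"
    by (intro measure_exhaust) auto
  have "T n \<in> sets borel" for n unfolding T_def by measurable
  moreover have "incseq T" unfolding T_def by (auto simp: incseq_def)
  moreover have "(\<Union>n. T n) = {0..1}" unfolding T_def using real_arch_simple by auto
  ultimately have eT: "eventually (\<lambda>n. measure lborel (T n) > 1/2) sequentially"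
    by (intro measure_exhaust) auto
  obtain n where n: "measure lborel (S n) > 3/2" "measure lborel (T n) > 1/2"
    using eventually_conj[OF eS eT] by (auto simp: eventually_sequentially)
  have bd: "\<bar>k u\<bar> \<le> 2 * real n" if u: "0 \<le> u" "u \<le> 1" for u
  proof -
    have "\<exists>y\<in>T n. u + y \<in> S n"
      by (rule measurable_translates_meet[where K=1])
         (use n u \<open>\<And>n. S n \<in> sets borel\<close> \<open>\<And>n. T n \<in> sets borel\<close> in \<open>auto simp: S_def T_def\<close>)
    then obtain y where "\<bar>k y\<bar> \<le> real n" "\<bar>k (u + y)\<bar> \<le> real n" by (auto simp: S_def T_def)
    then show ?thesis using add[of u y] by linarith
  qed
  define j where "j x = k x - k 1 * x" for x
  have jadd: "j (x + y) = j x + j y" for x y by (simp add: j_def add algebra_simps)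
  have j0: "j 0 = 0" using jadd[of 0 0] by simp
  have jnat: "j (real m * x) = real m * j x" for m x
    by (induction m) (auto simp: j0 jadd algebra_simps)
  have jm: "j (- x) = - j x" for x using jadd[of x "-x"] j0 by simp
  have j1: "j 1 = 0" by (simp add: j_def)
  have jint: "j (of_int z) = 0" for z :: int
  proof (cases "z \<ge> 0")
    case True then show ?thesis using jnat[of "nat z" 1] j1 by simp
  next
    case False then show ?thesis using jnat[of "nat (-z)" 1] jm[of "of_int (-z)"] j1 by simp
  qed
  have jb: "\<bar>j x\<bar> \<le> 2 * real n + \<bar>k 1\<bar>" for x
  proof -
    have "j x = j (frac x)" using jadd[of "frac x" "of_int \<lfloor>x\<rfloor>"] jint by (simp add: frac_def)
    moreover have "\<bar>k (frac x)\<bar> \<le> 2 * real n" by (rule bd) (auto simp: frac_lt_1 less_imp_le)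
    moreover have "\<bar>k 1 * frac x\<bar> \<le> \<bar>k 1\<bar> * 1" unfolding abs_mult
      by (intro mult_left_mono) (auto simp: frac_lt_1 less_imp_le)
    ultimately show ?thesis unfolding j_def by linarith
  qed
  have "j u = 0"
  proof (rule ccontr)
    assume ne: "j u \<noteq> 0"
    obtain m :: nat where "real m > (2 * real n + \<bar>k 1\<bar>) / \<bar>j u\<bar>" using reals_Archimedean2 by blast
    then have "real m * \<bar>j u\<bar> > 2 * real n + \<bar>k 1\<bar>" using ne by (simp add: field_simps)
    then show False using jb[of "real m * u"] jnat[of m u] by (simp add: abs_mult)
  qed
  then show ?thesis by (simp add: j_def)
qed

text \<open>Csiszar and Erdos: the points where the increments are already small from both \<open>x n\<close> and
  \<open>x n + u n\<close> eventually fill most of an interval, so some point is good for both.\<close>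
lemma uniform_increment_nonneg:
  fixes g :: "real \<Rightarrow> real" and x u :: "nat \<Rightarrow> real"
  assumes [measurable]: "g \<in> borel_measurable borel"
    and lim: "\<And>y. ((\<lambda>x. g (x + y) - g x) \<longlongrightarrow> 0) at_top"
    and x: "filterlim x at_top sequentially" and u: "\<And>n. 0 \<le> u n" "\<And>n. u n \<le> K" and K: "K > 0"
  shows "(\<lambda>n. g (x n + u n) - g (x n)) \<longlonglongrightarrow> 0"
proof (rule LIMSEQ_I)
  fix e :: real assume "e > 0"
  define d where "d = e / 3"
  have d: "d > 0" using \<open>e > 0\<close> by (simp add: d_def)
  have x': "filterlim (\<lambda>n. x n + u n) at_top sequentially"
    by (rule filterlim_at_top_mono[OF x]) (use u in auto)
  define S where "S n = {y\<in>{0..2*K}. \<forall>m\<in>{n..}. \<bar>g (x m + y) - g (x m)\<bar> \<le> d}" for n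
  define T where "T n = {y\<in>{0..K}. \<forall>m\<in>{n..}. \<bar>g (x m + u m + y) - g (x m + u m)\<bar> \<le> d}" for n
  have tail: "\<exists>n. \<forall>m\<ge>n. \<bar>g (z m + y) - g (z m)\<bar> \<le> d" if "filterlim z at_top sequentially" for z y
  proof -
    have "(\<lambda>n. g (z n + y) - g (z n)) \<longlonglongrightarrow> 0" using filterlim_compose[OF lim that] .
    then show ?thesis using d unfolding LIMSEQ_iff by (auto simp: less_imp_le) (meson less_imp_le)
  qed
  have Sm: "S n \<in> sets borel" for n unfolding S_def by measurable
  moreover have "incseq S" unfolding S_def by (auto simp: incseq_def)
  moreover have "(\<Union>n. S n) = {0..2*K}" unfolding S_def using tail[OF x] by fastforce
  ultimately have eS: "eventually (\<lambda>n. measure lborel (S n) > 3/2*K) sequentially"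
    using K by (intro measure_exhaust[where K="2*K"]) auto
  have Tm: "T n \<in> sets borel" for n unfolding T_def by measurable
  moreover have "incseq T" unfolding T_def by (auto simp: incseq_def)
  moreover have "(\<Union>n. T n) = {0..K}" unfolding T_def using tail[OF x'] by fastforce
  ultimately have eT: "eventually (\<lambda>n. measure lborel (T n) > K/2) sequentially"
    using K by (intro measure_exhaust) auto
  obtain n where n: "measure lborel (S n) > 3/2*K" "measure lborel (T n) > K/2"
    using eventually_conj[OF eS eT] by (auto simp: eventually_sequentially)
  have "norm (g (x m + u m) - g (x m) - 0) < e" if "m \<ge> n" for m
  proof -
    have "\<exists>y\<in>T n. u m + y \<in> S n"
      by (rule measurable_translates_meet[OF Sm Tm _ _ K n u]) (auto simp: S_def T_def)
    then obtain y where y: "y \<in> T n" "u m + y \<in> S n" by blast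
    have "m \<in> {n..}" using that by simp
    then have "\<bar>g (x m + (u m + y)) - g (x m)\<bar> \<le> d" "\<bar>g (x m + u m + y) - g (x m + u m)\<bar> \<le> d"
      using y unfolding S_def T_def by blast+
    then have "\<bar>g (x m + u m) - g (x m)\<bar> \<le> 2 * d" by (simp add: add.assoc)
    then show ?thesis using \<open>e > 0\<close> unfolding d_def by simp
  qed
  then show "\<exists>no. \<forall>n\<ge>no. norm (g (x n + u n) - g (x n) - 0) < e" by blast
qed

text \<open>Offsets of either sign become nonnegative when the base point moves to
  \<open>x n - K\<close>; the increment from \<open>x n - K\<close> to \<open>x n\<close> tends to 0
  on its own and is subtracted again.\<close>

lemma uniform_increment:
  fixes g :: "real \<Rightarrow> real" and x u :: "nat \<Rightarrow> real"
  assumes g: "g \<in> borel_measurable borel"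
    and lim: "\<And>y. ((\<lambda>x. g (x + y) - g x) \<longlongrightarrow> 0) at_top"
    and x: "filterlim x at_top sequentially" and u: "\<And>n. \<bar>u n\<bar> \<le> K" and K: "K > 0"
  shows "(\<lambda>n. g (x n + u n) - g (x n)) \<longlonglongrightarrow> 0"
proof -
  have x': "filterlim (\<lambda>n. x n - K) at_top sequentially"
    using filterlim_tendsto_add_at_top[OF tendsto_const[of "-K"] x] by (simp add: algebra_simps)
  have ub: "0 \<le> u n + K" "u n + K \<le> 2 * K" for n using u[of n] by linarith+
  have "(\<lambda>n. g (x n - K + (u n + K)) - g (x n - K)) \<longlonglongrightarrow> 0"
    by (rule uniform_increment_nonneg[OF g lim x' ub]) (use K in auto)
  moreover have "(\<lambda>n. g (x n - K + K) - g (x n - K)) \<longlonglongrightarrow> 0" using filterlim_compose[OF lim x'] .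
  ultimately have "(\<lambda>n. (g (x n - K + (u n + K)) - g (x n - K)) - (g (x n - K + K) - g (x n - K))) \<longlonglongrightarrow> 0 - 0"
    by (rule tendsto_diff)
  then show ?thesis by (simp add: algebra_simps)
qed

subsection \<open>Regularly varying sequences\<close>

text \<open>Regular variation of a sequence with index \<open>\<rho>\<close>, in the locally uniform form that the uniform
  convergence theorem provides.\<close>
definition rv_seq :: "(nat \<Rightarrow> real) \<Rightarrow> real \<Rightarrow> bool" where
  "rv_seq u \<rho> \<longleftrightarrow> (\<forall>n. u n > 0) \<and>
     (\<forall>(x :: nat \<Rightarrow> nat) a b. 0 < a \<longrightarrow> (\<forall>\<^sub>F n in sequentially. a * real n \<le> real (x n) \<and> real (x n) \<le> b * real n) \<longrightarrow>
        (\<lambda>n. u (x n) / u n * (real (x n) / real n) powr (- \<rho>)) \<longlonglongrightarrow> 1)"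

lemma rv_seq_pos: "rv_seq u \<rho> \<Longrightarrow> u n > 0"
  by (simp add: rv_seq_def)

lemma rv_seqD:
  assumes "rv_seq u \<rho>" "0 < a" "\<forall>\<^sub>F n in sequentially. a * real n \<le> real (x n) \<and> real (x n) \<le> b * real n"
  shows "(\<lambda>n. u (x n) / u n * (real (x n) / real n) powr (- \<rho>)) \<longlonglongrightarrow> 1"
  using assms unfolding rv_seq_def by blast

lemma rv_seq_tendsto:
  assumes u: "rv_seq u \<rho>" and x: "(\<lambda>n. real (x n) / real n) \<longlonglongrightarrow> t" and t: "t > 0"
  shows "(\<lambda>n. u (x n) / u n) \<longlonglongrightarrow> t powr \<rho>"
proof -
  have e: "\<forall>\<^sub>F n in sequentially. t / 2 < real (x n) / real n \<and> real (x n) / real n < 2 * t"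
    by (intro eventually_conj order_tendstoD[OF x]) (use t in auto)
  have e1: "\<forall>\<^sub>F n in sequentially. t / 2 * real n \<le> real (x n) \<and> real (x n) \<le> 2 * t * real n"
    using e eventually_gt_at_top[of 0] by eventually_elim (auto simp: field_simps)
  have 1: "(\<lambda>n. u (x n) / u n * (real (x n) / real n) powr (- \<rho>)) \<longlonglongrightarrow> 1"
    by (rule rv_seqD[OF u _ e1]) (use t in auto)
  have 2: "(\<lambda>n. (real (x n) / real n) powr \<rho>) \<longlonglongrightarrow> t powr \<rho>"
    by (intro tendsto_powr x tendsto_const) (use t in auto)
  have "(\<lambda>n. u (x n) / u n * (real (x n) / real n) powr (- \<rho>) * (real (x n) / real n) powr \<rho>) \<longlonglongrightarrow> 1 * t powr \<rho>"
    by (rule tendsto_mult[OF 1 2])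
  moreover have "\<forall>\<^sub>F n in sequentially. u (x n) / u n * (real (x n) / real n) powr (- \<rho>) * (real (x n) / real n) powr \<rho> = u (x n) / u n"
    using e
  proof eventually_elim
    case (elim n)
    then have "real (x n) / real n > 0" using t by linarith
    moreover have "r powr (- \<rho>) * r powr \<rho> = 1" if "r > 0" for r :: real
      using that by (simp add: powr_minus)
    ultimately have "(real (x n) / real n) powr (- \<rho>) * (real (x n) / real n) powr \<rho> = 1" by blast
    then show ?case by (simp only: mult.assoc mult_1_right)
  qed
  ultimately show ?thesis using Lim_transform_eventually by fastforce
qed

lemma rv_seq_equiv:
  assumes u: "rv_seq u \<rho>" and v: "\<And>n. v n > 0" and lim: "(\<lambda>n. v n / u n) \<longlonglongrightarrow> c" and c: "c > 0"
  shows "rv_seq v \<rho>"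
  unfolding rv_seq_def
proof (intro conjI allI impI v)
  fix x :: "nat \<Rightarrow> nat" and a b :: real
  assume a: "0 < a" and ev: "\<forall>\<^sub>F n in sequentially. a * real n \<le> real (x n) \<and> real (x n) \<le> b * real n"
  \<comment> \<open>The lower bound \<open>a * n\<close> sends \<open>x n\<close> to infinity, so
    \<open>lim\<close> can be used along \<open>x\<close> as well.\<close>
  have "filterlim (\<lambda>n. a * real n) at_top sequentially"
    using filterlim_tendsto_pos_mult_at_top[OF tendsto_const a filterlim_real_sequentially] .
  then have "filterlim (\<lambda>n. real (x n)) at_top sequentially"
    by (rule filterlim_at_top_mono) (use ev in \<open>auto elim: eventually_mono\<close>)
  then have x: "filterlim x at_top sequentially"
    by (simp add: filterlim_sequentially_iff_filterlim_real)
  have "(\<lambda>n. (v (x n) / u (x n)) * (u (x n) / u n * (real (x n) / real n) powr (- \<rho>)) / (v n / u n)) \<longlonglongrightarrow> c * 1 / c"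
    by (intro tendsto_intros lim filterlim_compose[OF lim x] rv_seqD[OF u a ev]) (use c in auto)
  also have "(\<lambda>n. (v (x n) / u (x n)) * (u (x n) / u n * (real (x n) / real n) powr (- \<rho>)) / (v n / u n)
)
     = (\<lambda>n. v (x n) / v n * (real (x n) / real n) powr (- \<rho>))"
    using rv_seq_pos[OF u] v by (auto simp: field_simps less_imp_neq[symmetric])
  finally show "(\<lambda>n. v (x n) / v n * (real (x n) / real n) powr (- \<rho>)) \<longlonglongrightarrow> 1" using c by simp
qed

lemma rv_seq_mult:
  assumes u: "rv_seq u \<rho>" and v: "rv_seq v \<tau>"
  shows "rv_seq (\<lambda>n. u n * v n) (\<rho> + \<tau>)"
  unfolding rv_seq_def
proof (intro conjI allI impI)
  show "0 < u n * v n" for n using u v by (simp add: rv_seq_pos)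
  fix x :: "nat \<Rightarrow> nat" and a b :: real
  assume a: "0 < a" and ev: "\<forall>\<^sub>F n in sequentially. a * real n \<le> real (x n) \<and> real (x n) \<le> b * real n"
  show "(\<lambda>n. u (x n) * v (x n) / (u n * v n) * (real (x n) / real n) powr (- (\<rho> + \<tau>))) \<longlonglongrightarrow> 1"
    using tendsto_mult[OF rv_seqD[OF u a ev] rv_seqD[OF v a ev]] by (simp add: powr_add[symmetric] algebra_simps)
qed

lemma rv_seq_powr:
  assumes u: "rv_seq u \<rho>"
  shows "rv_seq (\<lambda>n. u n powr c) (\<rho> * c)"
  unfolding rv_seq_def
proof (intro conjI allI impI)
  show "0 < u n powr c" for n using u by (simp add: rv_seq_pos less_imp_neq[symmetric])
  fix x :: "nat \<Rightarrow> nat" and a b :: real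
  assume a: "0 < a" and ev: "\<forall>\<^sub>F n in sequentially. a * real n \<le> real (x n) \<and> real (x n) \<le> b * real n"
  have "(\<lambda>n. (u (x n) / u n * (real (x n) / real n) powr (- \<rho>)) powr c) \<longlonglongrightarrow> 1 powr c"
    by (intro tendsto_powr rv_seqD[OF u a ev] tendsto_const) auto
  moreover have "(u (x n) / u n * (real (x n) / real n) powr (- \<rho>)) powr c = u (x n) powr c / u n powr c * (real (x n) / real n) powr (- (\<rho> * c))" for n
    using rv_seq_pos[OF u, of n] rv_seq_pos[OF u, of "x n"] by (simp add: powr_mult powr_divide powr_powr)
  ultimately show "(\<lambda>n. u (x n) powr c / u n powr c * (real (x n) / real n) powr (- (\<rho> * c))) \<longlonglongrightarrow> 1" by simp
qed

text \<open>\<open>rv_seq\<close> demands positivity at 0 too, so powers of \<open>n + 1\<close>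
  stand in for powers of \<open>n\<close> in the normalisations.\<close>

lemma rv_seq_Suc_powr: "rv_seq (\<lambda>n. real (Suc n) powr \<rho>) \<rho>"
proof -
  have "rv_seq (\<lambda>n. if n = 0 then 1 else real n) 1"
    unfolding rv_seq_def
  proof (intro conjI allI impI)
    fix x :: "nat \<Rightarrow> nat" and a b :: real
    assume a: "0 < a" and ev: "\<forall>\<^sub>F n in sequentially. a * real n \<le> real (x n) \<and> real (x n) \<le> b * real n"
    have "\<forall>\<^sub>F n in sequentially. (if x n = 0 then 1 else real (x n)) / (if n = 0 then 1 else real n) * (real (x n) / real n) powr - 1 = 1"
      using ev eventually_gt_at_top[of 0]
    proof eventually_elim
      case (elim n)
      then have "real (x n) > 0" using mult_pos_pos[OF a, of "real n"] by linarith
      then show ?case using elim by (simp add: powr_minus field_simps)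
    qed
    then show "(\<lambda>n. (if x n = 0 then 1 else real (x n)) / (if n = 0 then 1 else real n) * (real (x n) / real n) powr - 1) \<longlonglongrightarrow> 1"
      by (rule tendsto_eventually)
  qed auto
  moreover have "(\<lambda>n. real (Suc n) / (if n = 0 then 1 else real n)) \<longlonglongrightarrow> 1"
  proof -
    have "\<forall>\<^sub>F n in sequentially. real (Suc n) / real n = real (Suc n) / (if n = 0 then 1 else real n)"
      using eventually_gt_at_top[of 0] by eventually_elim auto
    then show ?thesis using LIMSEQ_Suc_n_over_n tendsto_cong by fastforce
  qed
  ultimately have "rv_seq (\<lambda>n. real (Suc n)) 1" by (intro rv_seq_equiv[where v = "\<lambda>n. real (Suc n)"]) auto
  from rv_seq_powr[OF this, of \<rho>] show ?thesis by simp
qed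

section \<open>Potter's bounds\<close>

text \<open>Uniformity on the window from \<open>m div 2\<close> to \<open>m\<close> gives
  \<open>z x \<le> 2 * z m\<close> there for large \<open>m\<close>. A smaller \<open>x\<close> is
  reached by repeated halving, which costs nothing because \<open>z (m div 2) / z m\<close> tends to
  \<open>(1/2) powr \<delta> < 1\<close>. Small \<open>m\<close> are absorbed into
  \<open>C\<close>.\<close>

lemma rv_seq_almost_increasing:
  assumes z: "rv_seq z \<delta>" and \<delta>: "\<delta> > 0"
  shows "\<exists>C>0. \<forall>m. \<forall>x\<le>m. z x \<le> C * z m"
proof -
  note zp = rv_seq_pos[OF z]
  define c where "c = (2::real)"
  have c1: "c \<ge> 1" by (simp add: c_def)
  have ev1: "\<forall>\<^sub>F m in sequentially. \<forall>x\<in>{m div 2..m}. z x \<le> c * z m"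
  proof (rule ccontr)
    assume *: "\<not> ?thesis"
    \<comment> \<open>A violating point of the window is picked whenever one exists. Local
      uniformity is stated along sequences, so this one sequence of worst cases rules out violations
      for all large \<open>m\<close>.\<close>
    define x where "x m = (if \<exists>x\<in>{m div 2..m}. \<not> z x \<le> c * z m then SOME x. x \<in> {m div 2..m} \<and> \<not> z x \<le> c * z m else m)" for m
    have x1: "x m \<in> {m div 2..m}" for m
    proof (cases "\<exists>x\<in>{m div 2..m}. \<not> z x \<le> c * z m")
      case True
      then have "x m = (SOME x. x \<in> {m div 2..m} \<and> \<not> z x \<le> c * z m)" by (simp add: x_def)
      then show ?thesis using True by (metis (mono_tags, lifting) someI_ex)
    qed (simp add: x_def)
    have x2: "\<not> z (x m) \<le> c * z m" if "\<exists>x\<in>{m div 2..m}. \<not> z x \<le> c * z m" for m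
    proof -
      have "x m = (SOME x. x \<in> {m div 2..m} \<and> \<not> z x \<le> c * z m)" using that by (simp add: x_def)
      then show ?thesis using that by (metis (mono_tags, lifting) someI_ex)
    qed
    \<comment> \<open>The factor 1/3 in place of 1/2 absorbs the rounding in
      \<open>m div 2\<close>.\<close>
    have ev: "\<forall>\<^sub>F m in sequentially. 1/3 * real m \<le> real (x m) \<and> real (x m) \<le> 1 * real m"
      using eventually_ge_at_top[of 3]
    proof eventually_elim
      case (elim m)
      have "m \<le> 3 * (m div 2)" using elim by presburger
      then have "m \<le> 3 * x m" using x1[of m] by auto
      then show ?case using x1[of m] by auto
    qed
    have "(\<lambda>m. z (x m) / z m * (real (x m) / real m) powr (- \<delta>)) \<longlonglongrightarrow> 1"
      by (rule rv_seqD[OF z _ ev]) auto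
    then have "\<forall>\<^sub>F m in sequentially. z (x m) / z m * (real (x m) / real m) powr (- \<delta>) < 2"
      by (rule order_tendstoD) auto
    then have "\<forall>\<^sub>F m in sequentially. z (x m) \<le> c * z m"
      using ev eventually_gt_at_top[of 0]
    proof eventually_elim
      case (elim m)
      define r where "r = real (x m) / real m"
      have "r > 0" "r \<le> 1" using elim x1[of m] unfolding r_def by (auto simp: field_simps)
      then have "1 \<le> r powr (-\<delta>)" using \<delta> powr_mono2'[of "\<delta>" r 1] by (simp add: powr_minus field_simps powr_le1)
      then have "z (x m) / z m * 1 \<le> z (x m) / z m * r powr (-\<delta>)"
        by (intro mult_left_mono) (use zp in \<open>auto simp: less_imp_le\<close>)
      then have "z (x m) / z m < 2" using elim unfolding r_def by linarith
      moreover have "2 \<le> c" by (simp add: c_def)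
      ultimately have "z (x m) / z m \<le> c" by linarith
      then show ?case using zp[of m] by (simp add: field_simps)
    qed
    then have "\<forall>\<^sub>F m in sequentially. \<forall>x\<in>{m div 2..m}. z x \<le> c * z m"
      by (rule eventually_mono) (use x2 in blast)
    then show False using * by blast
  qed
  have "(\<lambda>m. real (m div 2) / real m) \<longlonglongrightarrow> 1/2"
    by real_asymp
  then have "(\<lambda>m. z (m div 2) / z m) \<longlonglongrightarrow> (1/2) powr \<delta>"
    by (rule rv_seq_tendsto[OF z]) auto
  moreover have "(1/2::real) powr \<delta> < 1" using \<delta> powr_less_mono2[of \<delta> "1/2" 1] by simp
  ultimately have "\<forall>\<^sub>F m in sequentially. z (m div 2) / z m < 1"
    by (rule order_tendstoD)
  from eventually_conj[OF this ev1] obtain M where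
    M0: "\<forall>m\<ge>M. z (m div 2) / z m < 1 \<and> (\<forall>x\<in>{m div 2..m}. z x \<le> c * z m)"
    unfolding eventually_sequentially by blast
  have M: "\<And>m. m \<ge> M \<Longrightarrow> z (m div 2) / z m < 1" "\<And>m x. m \<ge> M \<Longrightarrow> x \<in> {m div 2..m} \<Longrightarrow> z x \<le> c * z m"
    using M0 by auto
  have half: "z (m div 2) \<le> z m" if "m \<ge> M" for m using M(1)[OF that] zp[of m] by (simp add: field_simps)
  \<comment> \<open>The double sum dominates each ratio \<open>z x / z m\<close> with both indices
    at most \<open>M\<close>; this is where the induction by halving stops.\<close>
  define C where "C = c + (\<Sum>m\<le>M. \<Sum>x\<le>M. z x / z m)"
  have Cc: "C \<ge> c" unfolding C_def by (simp add: sum_nonneg less_imp_le zp)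
  have "z x \<le> C * z m" if "x \<le> m" for x m
    using that
  proof (induction m arbitrary: x rule: less_induct)
    case (less m)
    show ?case
    proof (cases "m \<le> M")
      case True
      have "z x / z m \<le> (\<Sum>x\<le>M. z x / z m)"
        by (rule member_le_sum) (use True less zp in \<open>auto simp: less_imp_le\<close>)
      also have "\<dots> \<le> (\<Sum>m\<le>M. \<Sum>x\<le>M. z x / z m)"
        by (rule member_le_sum) (use True less zp in \<open>auto simp: less_imp_le sum_nonneg\<close>)
      also have "\<dots> \<le> C" unfolding C_def using c1 by simp
      finally show ?thesis using zp[of m] by (simp add: field_simps)
    next
      case False
      show ?thesis
      proof (cases "x \<ge> m div 2")
        case True
        then have "z x \<le> c * z m" using M(2) False less by simp
        also have "\<dots> \<le> C * z m" using Cc zp[of m] by simp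
        finally show ?thesis .
      next
        case F2: False
        have "z x \<le> C * z (m div 2)" by (rule less.IH) (use False F2 in auto)
        also have "\<dots> \<le> C * z m" using half[of m] False Cc c1 by (intro mult_left_mono) auto
        finally show ?thesis .
      qed
    qed
  qed
  then show ?thesis using Cc c1 by (intro exI[of _ C]) auto
qed

text \<open>Multiplication by a power of \<open>n + 1\<close> turns the index into
  \<open>\<delta> > 0\<close>, where almost monotonicity is available; dividing the power out again
  gives the bound.\<close>

lemma potter_bound:
  assumes u: "rv_seq u \<rho>" and \<delta>: "\<delta> > 0"
  shows "\<exists>C>0. \<forall>m. \<forall>x\<le>m. u x \<le> C * u m * (real (Suc x) / real (Suc m)) powr (\<rho> - \<delta>)"
proof -
  have "rv_seq (\<lambda>n. u n * real (Suc n) powr (\<delta> - \<rho>)) \<delta>"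
    using rv_seq_mult[OF u rv_seq_Suc_powr[of "\<delta> - \<rho>"]] by simp
  from rv_seq_almost_increasing[OF this \<delta>] obtain C where
    C: "C > 0" "\<And>x m. x \<le> m \<Longrightarrow> u x * real (Suc x) powr (\<delta> - \<rho>) \<le> C * (u m * real (Suc m) powr (\<delta> - \<rho>))" by blast
  have "u x \<le> C * u m * (real (Suc x) / real (Suc m)) powr (\<rho> - \<delta>)" if "x \<le> m" for x m
  proof -
    have e: "real (Suc k) powr (\<delta> - \<rho>) = 1 / real (Suc k) powr (\<rho> - \<delta>)" for k
      by (metis minus_diff_eq powr_minus_divide)
    show ?thesis using C(2)[OF that] unfolding e
      by (simp add: powr_divide field_simps del: of_nat_Suc)
  qed
  then show ?thesis using C(1) by blast
qed

text \<open>This is Potter's bound read at \<open>x = 0\<close>, solved for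
  \<open>u m\<close>.\<close>

lemma rv_seq_lower:
  assumes u: "rv_seq u \<rho>" and \<delta>: "\<delta> > 0"
  shows "\<exists>c>0. \<forall>m. c * real (Suc m) powr (\<rho> - \<delta>) \<le> u m"
proof -
  obtain C where C: "C > 0" "\<And>m x. x \<le> m \<Longrightarrow> u x \<le> C * u m * (real (Suc x) / real (Suc m)) powr (\<rho> - \<delta>)"
    using potter_bound[OF assms] by blast
  have "u 0 / C * real (Suc m) powr (\<rho> - \<delta>) \<le> u m" for m
  proof -
    have "u 0 \<le> C * u m * (1 / real (Suc m) powr (\<rho> - \<delta>))" using C(2)[of 0 m] by (simp add: powr_divide)
    then show ?thesis using C(1) by (simp add: field_simps del: of_nat_Suc)
  qed
  then show ?thesis using C(1) rv_seq_pos[OF u, of 0] by (intro exI[of _ "u 0 / C"]) auto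
qed

text \<open>The reciprocal sequence has index \<open>-\<rho>\<close>, so its lower bound is the
  upper bound wanted here.\<close>

lemma rv_seq_upper:
  assumes u: "rv_seq u \<rho>" and \<delta>: "\<delta> > 0"
  shows "\<exists>C>0. \<forall>m. u m \<le> C * real (Suc m) powr (\<rho> + \<delta>)"
proof -
  have "rv_seq (\<lambda>n. u n powr (-1)) (-\<rho>)" using rv_seq_powr[OF u, of "-1"] by simp
  from rv_seq_lower[OF this \<delta>] obtain c where c: "c > 0" "\<And>m. c * real (Suc m) powr (-\<rho> - \<delta>) \<le> u m powr (-1)" by blast
  have "u m \<le> 1 / c * real (Suc m) powr (\<rho> + \<delta>)" for m
  proof -
    have "real (Suc m) powr (-\<rho> - \<delta>) = 1 / real (Suc m) powr (\<rho> + \<delta>)"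
      by (metis minus_add_distrib powr_minus_divide uminus_add_conv_diff add.commute)
    then have "c * (1 / real (Suc m) powr (\<rho> + \<delta>)) \<le> 1 / u m"
      using c(2)[of m] rv_seq_pos[OF u, of m] by (simp add: powr_minus_divide)
    then show ?thesis using c(1) rv_seq_pos[OF u, of m] by (simp add: field_simps del: of_nat_Suc)
  qed
  then show ?thesis using c(1) by (intro exI[of _ "1 / c"]) auto
qed

text \<open>In the additive form \<open>f y = ln (F (exp y))\<close> the limits \<open>k\<close> of
  the increments are additive and measurable, hence linear, and their slope is the index. After
  subtraction of \<open>\<kappa> * y\<close> all increments tend to 0, and the uniform convergence
  theorem applies with offsets \<open>ln (x n / n)\<close>.\<close>

lemma regularly_varying_imp_rv_seq:
  assumes F: "regularly_varying F"
  shows "\<exists>\<kappa>. rv_seq (\<lambda>n. if n = 0 then 1 else F (real n)) \<kappa>"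
proof -
  \<comment> \<open>Measurability of \<open>F\<close> is known only on \<open>{1..}\<close>; the
    constant 1 elsewhere gives a positive function that is measurable on the whole line.\<close>
  define F' where "F' x = (if x \<ge> 1 then F x else 1)" for x
  define f where "f y = ln (F' (exp y))" for y
  have Fpos: "F x > 0" if "x \<ge> 1" for x using F that by (auto simp: regularly_varying_def)
  have F'pos: "F' x > 0" for x using Fpos by (simp add: F'_def)
  have Fm: "F \<in> borel_measurable (restrict_space borel {1..})" using F by (simp add: regularly_varying_def)
  have "F' \<in> borel_measurable borel"
    unfolding F'_def using Fm
    by (intro measurable_If_restrict_space_iff[THEN iffD2]) (auto simp: atLeast_def)
  then have fm: "f \<in> borel_measurable borel" unfolding f_def by measurable
  have "\<exists>k. ((\<lambda>x. f (x + y) - f x) \<longlongrightarrow> k) at_top" for y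
  proof -
    obtain L where L: "L > 0" "((\<lambda>x. F (exp y * x) / F x) \<longlongrightarrow> L) at_top"
      using F exp_gt_zero unfolding regularly_varying_def by blast
    have "((\<lambda>x. F (exp y * exp x) / F (exp x)) \<longlongrightarrow> L) at_top"
      by (rule filterlim_compose[OF L(2) exp_at_top])
    then have "((\<lambda>x. ln (F (exp y * exp x) / F (exp x))) \<longlongrightarrow> ln L) at_top"
      by (rule tendsto_ln) (use L in auto)
    moreover have "\<forall>\<^sub>F x in at_top. ln (F (exp y * exp x) / F (exp x)) = f (x + y) - f x"
      using eventually_ge_at_top[of 0] eventually_ge_at_top[of "-y"]
    proof eventually_elim
      case (elim x)
      then have "exp x \<ge> 1" "exp (x + y) \<ge> 1" by auto
      then show ?case using Fpos[of "exp x"] Fpos[of "exp (x + y)"] unfolding f_def F'_def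
        by (simp add: ln_div exp_add mult.commute)
    qed
    ultimately have "((\<lambda>x. f (x + y) - f x) \<longlongrightarrow> ln L) at_top" by (rule Lim_transform_eventually)
    then show ?thesis by blast
  qed
  then obtain k where k: "\<And>y. ((\<lambda>x. f (x + y) - f x) \<longlongrightarrow> k y) at_top" by metis
  \<comment> \<open>The limit exists along all reals, so it may be taken along the naturals, where a
    countable limit of measurable functions is measurable.\<close>
  have km: "k \<in> borel_measurable borel"
  proof (rule borel_measurable_LIMSEQ_real)
    show "(\<lambda>n. f (real n + y) - f (real n)) \<longlonglongrightarrow> k y" for y
      by (rule filterlim_compose[OF k filterlim_real_sequentially])
    show "(\<lambda>y. f (real n + y) - f (real n)) \<in> borel_measurable borel" for n using fm by measurable
  qed
  have kadd: "k (u + v) = k u + k v" for u v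
  proof -
    have "((\<lambda>x. f (x + u + v) - f (x + u)) \<longlongrightarrow> k v) at_top"
    proof (rule filterlim_compose[OF k])
      show "filterlim (\<lambda>x. x + u) at_top at_top"
        using filterlim_tendsto_add_at_top[OF tendsto_const[of u] filterlim_ident] by (simp add: add.commute)
    qed
    from tendsto_add[OF k[of u] this] have "((\<lambda>x. f (x + (u + v)) - f x) \<longlongrightarrow> k u + k v) at_top"
      by (simp add: add.assoc)
    then show ?thesis using tendsto_unique[OF _ k] by (simp add: trivial_limit_at_top_linorder)
  qed
  define \<kappa> where "\<kappa> = k 1"
  have klin: "k y = \<kappa> * y" for y unfolding \<kappa>_def by (rule additive_measurable_linear[OF km kadd])
  define g where "g y = f y - \<kappa> * y" for y
  have gm: "g \<in> borel_measurable borel" unfolding g_def using fm by measurable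
  have glim: "((\<lambda>x. g (x + y) - g x) \<longlongrightarrow> 0) at_top" for y
    using tendsto_diff[OF k[of y] tendsto_const[of "\<kappa> * y"]] unfolding g_def klin by (simp add: algebra_simps)
  have "rv_seq (\<lambda>n. if n = 0 then 1 else F (real n)) \<kappa>"
    unfolding rv_seq_def
  proof (intro conjI allI impI)
    show "0 < (if n = 0 then 1 else F (real n))" for n :: nat using Fpos[of "real n"] by auto
    fix x :: "nat \<Rightarrow> nat" and a b :: real
    assume a: "0 < a" and ev: "\<forall>\<^sub>F n in sequentially. a * real n \<le> real (x n) \<and> real (x n) \<le> b * real n"
    \<comment> \<open>The default 0 covers the finitely many \<open>n\<close> outside the eventual
      bounds, since the uniform theorem asks for \<open>\<bar>u n\<bar> \<le> K\<close> at every
      \<open>n\<close>.\<close>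
    define u where "u n = (if n > 0 \<and> a * real n \<le> real (x n) \<and> real (x n) \<le> b * real n then ln (real (x n) / real n) else 0)" for n
    define K where "K = 1 + \<bar>ln a\<bar> + \<bar>ln b\<bar>"
    have uK: "\<bar>u n\<bar> \<le> K" for n
    proof (cases "n > 0 \<and> a * real n \<le> real (x n) \<and> real (x n) \<le> b * real n")
      case True
      then have "a \<le> real (x n) / real n" "real (x n) / real n \<le> b" by (auto simp: field_simps)
      then have "ln a \<le> ln (real (x n) / real n)" "ln (real (x n) / real n) \<le> ln b" using a by auto
      then show ?thesis using True unfolding u_def K_def by auto
    qed (auto simp: u_def K_def)
    have "(\<lambda>n. g (ln (real n) + u n) - g (ln (real n))) \<longlonglongrightarrow> 0"
      by (rule uniform_increment[OF gm glim _ uK])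
         (auto simp: K_def intro: filterlim_compose[OF ln_at_top filterlim_real_sequentially])
    then have "(\<lambda>n. exp (g (ln (real n) + u n) - g (ln (real n)))) \<longlonglongrightarrow> exp 0" by (rule tendsto_exp)
    moreover have "\<forall>\<^sub>F n in sequentially. exp (g (ln (real n) + u n) - g (ln (real n))) =
       (if x n = 0 then 1 else F (real (x n))) / (if n = 0 then 1 else F (real n)) * (real (x n) / real n) powr - \<kappa>"
      using ev eventually_gt_at_top[of 0]
    proof eventually_elim
      case (elim n)
      then have xp: "real (x n) > 0" using mult_pos_pos[OF a, of "real n"] by linarith
      then have lnx: "ln (real n) + u n = ln (real (x n))" using elim by (simp add: u_def ln_div)
      have ff: "f (ln (real (x n))) = ln (F (real (x n)))" "f (ln (real n)) = ln (F (real n))"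
        using xp elim by (auto simp: f_def F'_def)
      have Fp: "F (real (x n)) > 0" "F (real n) > 0" using Fpos xp elim by auto
      have "exp (g (ln (real n) + u n) - g (ln (real n))) = exp (ln (F (real (x n))) - ln (F (real n))) * exp (- \<kappa> * (ln (real (x n)) - ln (real n)))"
        unfolding lnx g_def ff exp_add[symmetric] by (simp add: algebra_simps)
      also have "exp (ln (F (real (x n))) - ln (F (real n))) = F (real (x n)) / F (real n)"
        using Fp by (simp add: exp_diff)
      also have "exp (- \<kappa> * (ln (real (x n)) - ln (real n))) = (real (x n) / real n) powr - \<kappa>"
        using xp elim by (simp add: powr_def ln_div)
      finally show ?case using xp elim by auto
    qed
    ultimately show "(\<lambda>n. (if x n = 0 then 1 else F (real (x n))) / (if n = 0 then 1 else F (real n)) * (real (x n) / real n) powr - \<kappa>) \<longlonglongrightarrow> 1"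
      using Lim_transform_eventually by fastforce
  qed
  then show ?thesis by blast
qed

subsection \<open>Weighted convolutions\<close>

text \<open>The admissible \<open>x\<close> solve a single congruence \<open>b * x = m\<close>
  modulo \<open>d\<close>, so any two of them differ by a multiple of \<open>d div gcd d b\<close>;
  a half-open window of that length has room for one only.\<close>

lemma residue_cell_unique:
  fixes b d m x x' :: nat
  assumes "d > 0" and x: "b * x \<le> m" "d dvd m - b * x" and x': "b * x' \<le> m" "d dvd m - b * x'"
    and s: "real x \<le> s" "s < real x + real (d div gcd d b)" "real x' \<le> s" "s < real x' + real (d div gcd d b)"
  shows "x = x'"
proof -
  define q where "q = d div gcd d b"
  have "int d dvd (int m - int b * int x) - (int m - int b * int x')"
  proof (rule dvd_diff)
    show "int d dvd int m - int b * int x" using x by (metis of_nat_dvd_iff of_nat_diff of_nat_mult)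
    show "int d dvd int m - int b * int x'" using x' by (metis of_nat_dvd_iff of_nat_diff of_nat_mult)
  qed
  then have "int d dvd int b * (int x' - int x)" by (simp add: algebra_simps)
  moreover have "gcd d b \<noteq> 0" using assms(1) by simp
  then obtain d1 b1 where db: "d = d1 * gcd d b" "b = b1 * gcd d b" "coprime d1 b1"
    using gcd_coprime_exists by blast
  ultimately have "int d1 * int (gcd d b) dvd int b1 * (int x' - int x) * int (gcd d b)"
    by (metis (no_types, lifting) mult.assoc mult.commute of_nat_mult)
  then have "int d1 dvd int b1 * (int x' - int x)" using assms(1) by auto
  then have "int d1 dvd int x' - int x" using db(3) by (simp add: coprime_dvd_mult_right_iff)
  moreover have "q = d1" using db(1) \<open>gcd d b \<noteq> 0\<close> unfolding q_def by (metis nonzero_mult_div_cancel_right)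
  ultimately have "int q dvd int x' - int x" by simp
  moreover have "\<bar>int x' - int x\<bar> < int q" using s unfolding q_def by linarith
  ultimately have "int x' - int x = 0" by (metis abs_of_nat dvd_imp_le_int linorder_not_le)
  then show ?thesis by simp
qed

text \<open>Divisibility of \<open>m\<close> by the gcd makes the congruence solvable, and a
  multiple of the period moves the solution into the window that ends at \<open>s\<close>. The bound
  of \<open>s\<close> by the period from below keeps it nonnegative, and
  \<open>b * s \<le> m\<close> keeps \<open>m - b * x\<close> a true difference.\<close>

lemma residue_cell_exists:
  fixes b d m :: nat and s :: real
  assumes "d > 0" "gcd d b dvd m" "real (d div gcd d b) \<le> s" "real b * s \<le> real m"
  shows "\<exists>x. b * x \<le> m \<and> d dvd m - b * x \<and> real x \<le> s \<and> s < real x + real (d div gcd d b)"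
proof -
  define q where "q = d div gcd d b"
  have qpos: "q > 0" unfolding q_def using assms(1) by (simp add: div_greater_zero_iff gcd_le1_nat)
  obtain x0 where x0: "[int b * x0 = int m] (mod int d)"
  proof -
    obtain k where k: "m = gcd d b * k" using assms(2) by blast
    obtain u where "[int b * u = gcd (int b) (int d)] (mod int d)" using cong_solve_int by blast
    then have "[int b * u * int k = gcd (int b) (int d) * int k] (mod int d)" by (rule cong_scalar_right)
    then have "[int b * (u * int k) = int m] (mod int d)" by (simp add: k mult.assoc gcd.commute)
    then show ?thesis using that by blast
  qed
  define j where "j = \<lfloor>(s - of_int x0) / real q\<rfloor>"
  define z where "z = x0 + int q * j"
  have j: "of_int j \<le> (s - of_int x0) / real q" "(s - of_int x0) / real q < of_int j + 1"
    unfolding j_def by linarith+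
  have z: "of_int z \<le> s" "s < of_int z + real q"
    using j qpos unfolding z_def by (auto simp: field_simps)
  have znn: "z \<ge> 0"
  proof -
    have "of_int z > s - real q" using z by linarith
    then have "real_of_int z > 0" using assms(3) unfolding q_def by linarith
    then show ?thesis by simp
  qed
  define x where "x = nat z"
  have xr: "real x = of_int z" using znn unfolding x_def by simp
  have "real b * real x \<le> real b * s" using z xr by (intro mult_left_mono) auto
  then have bx: "b * x \<le> m" using assms(4) by (metis of_nat_le_iff of_nat_mult order_trans)
  have "int d dvd int b * int q"
  proof -
    define G where "G = gcd d b"
    have "d = G * q" "b = G * (b div G)" unfolding G_def q_def by auto
    then have "b * q = d * (b div G)" by (metis mult.assoc mult.commute)
    then show ?thesis by (metis dvd_triv_left of_nat_mult)
  qed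
  then have "[int b * z = int b * x0] (mod int d)"
    unfolding z_def cong_iff_dvd_diff by (simp add: algebra_simps)
  then have "[int b * z = int m] (mod int d)" using x0 cong_trans by blast
  then have "int d dvd int m - int b * int x"
    using znn unfolding x_def by (simp add: cong_iff_dvd_diff dvd_diff_commute)
  then have "int d dvd int (m - b * x)" using bx by (simp add: of_nat_diff)
  then have "d dvd m - b * x" by simp
  then show ?thesis using bx z xr unfolding q_def by auto
qed

section \<open>Beta integrals and integrable majorants\<close>

lemma integrable_abs_powr:
  fixes s0 :: real
  assumes "s0 > -1" "A \<ge> 0" "B \<ge> 0"
  shows "(\<lambda>x. \<bar>x\<bar> powr s0) integrable_on {-A..B}"
proof (rule Henstock_Kurzweil_Integration.integrable_combine[where c = 0])
  have "(\<lambda>x. x powr s0) integrable_on {0..A}" by (rule integrable_on_powr_from_0) (use assms in auto)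
  then have "(\<lambda>x. \<bar>x\<bar> powr s0) integrable_on {0..A}" by (rule integrable_eq) auto
  then show "(\<lambda>x. \<bar>x\<bar> powr s0) integrable_on {-A..0}"
    using Henstock_Kurzweil_Integration.integrable_reflect_real[of "\<lambda>x. \<bar>x\<bar> powr s0" A 0] by simp
  have "(\<lambda>x. x powr s0) integrable_on {0..B}" by (rule integrable_on_powr_from_0) (use assms in auto)
  then show "(\<lambda>x. \<bar>x\<bar> powr s0) integrable_on {0..B}" by (rule integrable_eq) auto
qed (use assms in auto)

text \<open>The last cell of the step functions can reach beyond \<open>1 / b\<close> by up to
  \<open>q\<close>; the majorant therefore has to be integrable past its singularity, which explains
  the absolute value and the right end point.\<close>

lemma integrable_affine_abs_powr:
  fixes s0 b q :: real
  assumes "s0 > -1" "b > 0" "q \<ge> 0"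
  shows "(\<lambda>t. \<bar>1 - b * t\<bar> powr s0) integrable_on {0..1/b + q}"
proof -
  have "(\<lambda>x. \<bar>x\<bar> powr s0) integrable_on cbox (-(b*q)) 1"
    using integrable_abs_powr[of s0 "b*q" 1] assms by simp
  from integrable_on_affinity[OF _ this, of "-b" 1] assms
  have "(\<lambda>t. \<bar>1 - b * t\<bar> powr s0) integrable_on ((\<lambda>x. (1 / (-b)) * x - (1 / (-b))) ` {-(b*q)..1})"
    by (simp add: algebra_simps)
  also have "(\<lambda>x. (1 / (-b)) * x - (1 / (-b))) ` {-(b*q)..1} = {0..1/b + q}"
  proof (intro equalityI subsetI)
    fix t assume "t \<in> {0..1/b + q}"
    then have "1 - b * t \<in> {-(b*q)..1}" "t = (1 / (-b)) * (1 - b * t) - (1 / (-b))" using assms by (auto simp: field_simps)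
    then show "t \<in> (\<lambda>x. (1 / (-b)) * x - (1 / (-b))) ` {-(b*q)..1}" by blast
  next
    fix t assume "t \<in> (\<lambda>x. (1 / (-b)) * x - (1 / (-b))) ` {-(b*q)..1}"
    then obtain x where x: "- (b * q) \<le> x" "x \<le> 1" "t = (1 - x) / b" using assms by (auto simp: field_simps)
    have "t \<le> (1 + b * q) / b" unfolding x(3) by (rule divide_right_mono) (use x assms in auto)
    moreover have "(1 + b * q) / b = 1/b + q" using assms by (simp add: field_simps)
    moreover have "t \<ge> 0" unfolding x(3) using x assms by simp
    ultimately show "t \<in> {0..1/b + q}" by simp
  qed
  finally show ?thesis .
qed

text \<open>The substitution \<open>b * t\<close> is the origin of the factor
  \<open>b powr (-\<sigma>)\<close> that each coefficient contributes to the final constant.\<close>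

lemma has_integral_scaled_Beta:
  fixes b \<sigma> \<tau> :: real
  assumes "b > 0" "\<sigma> > 0" "\<tau> > 0"
  shows "((\<lambda>t. t powr (\<sigma> - 1) * (1 - b * t) powr (\<tau> - 1)) has_integral (b powr (-\<sigma>) * Beta \<sigma> \<tau>)) {0..1/b}"
proof -
  have "((\<lambda>t. t powr (\<sigma> - 1) * (1 - t) powr (\<tau> - 1)) has_integral Beta \<sigma> \<tau>) (cbox 0 1)"
    using has_integral_Beta_real[OF assms(2,3)] by simp
  from has_integral_affinity[OF this, of b 0] assms
  have "((\<lambda>t. (b * t) powr (\<sigma> - 1) * (1 - b * t) powr (\<tau> - 1)) has_integral (1 / b) * Beta \<sigma> \<tau>) ((\<lambda>x. x / b) ` {0..1})"
    by simp
  also have "(\<lambda>x. x / b) ` {0..1} = {0..1/b}"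
  proof (intro equalityI subsetI)
    fix t assume "t \<in> {0..1/b}"
    then have "b * t \<in> {0..1}" "t = b * t / b" using assms by (auto simp: field_simps)
    then show "t \<in> (\<lambda>x. x / b) ` {0..1}" by blast
  qed (use assms in \<open>auto simp: field_simps\<close>)
  finally have "((\<lambda>t. b powr (1 - \<sigma>) * ((b * t) powr (\<sigma> - 1) * (1 - b * t) powr (\<tau> - 1))) has_integral b powr (1 - \<sigma>) * ((1 / b) * Beta \<sigma> \<tau>)) {0..1/b}"
    by (rule has_integral_mult_right)
  moreover have "b powr (1 - \<sigma>) * ((1 / b) * Beta \<sigma> \<tau>) = b powr (-\<sigma>) * Beta \<sigma> \<tau>"
    using assms by (simp add: powr_diff powr_minus field_simps)
  ultimately have 1: "((\<lambda>t. b powr (1 - \<sigma>) * ((b * t) powr (\<sigma> - 1) * (1 - b * t) powr (\<tau> - 1))) has_integral b powr (-\<sigma>) * Beta \<sigma> \<tau>) {0..1/b}"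
    by simp
  have 2: "b powr (1 - \<sigma>) * ((b * t) powr (\<sigma> - 1) * (1 - b * t) powr (\<tau> - 1)) = t powr (\<sigma> - 1) * (1 - b * t) powr (\<tau> - 1)"
    if "t \<in> {0..1/b}" for t
  proof -
    have "b powr (1 - \<sigma>) * (b * t) powr (\<sigma> - 1) = (b powr (1 - \<sigma>) * b powr (\<sigma> - 1)) * t powr (\<sigma> - 1)"
      using that assms by (simp add: powr_mult)
    also have "b powr (1 - \<sigma>) * b powr (\<sigma> - 1) = 1" using assms by (simp add: powr_add[symmetric])
    finally show ?thesis by (simp add: mult.assoc[symmetric])
  qed
  show ?thesis by (rule has_integral_eq[OF 2 1])
qed

text \<open>The singularities at 0 and at \<open>1 / b\<close> are separated, so at every
  \<open>t\<close> one of the two factors is bounded by \<open>(1 / (2 * b)) powr s0\<close>. A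
  product of singular powers is thus dominated by their sum, which is easy to integrate.\<close>

lemma powr_pair_bound:
  fixes b s0 t :: real
  assumes "b \<ge> 1" "s0 \<le> 0" "t > 0" "t \<noteq> 1/b"
  shows "t powr s0 * \<bar>1 - b * t\<bar> powr s0 \<le> (1 / (2 * b)) powr s0 * (t powr s0 + \<bar>1 - b * t\<bar> powr s0)"
proof (cases "t \<ge> 1 / (2 * b)")
  case True
  then have "t powr s0 \<le> (1 / (2 * b)) powr s0" using assms by (intro powr_mono2') auto
  then have "t powr s0 * \<bar>1 - b * t\<bar> powr s0 \<le> (1 / (2 * b)) powr s0 * \<bar>1 - b * t\<bar> powr s0" by (intro mult_right_mono) auto
  also have "\<dots> \<le> (1 / (2 * b)) powr s0 * (t powr s0 + \<bar>1 - b * t\<bar> powr s0)" by (intro mult_left_mono) auto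
  finally show ?thesis .
next
  case False
  then have "1 / (2 * b) \<le> \<bar>1 - b * t\<bar>"
  proof -
    have "b * t < 1/2" using False assms by (simp add: field_simps)
    moreover have "1 / (2 * b) \<le> 1/2" using assms by (simp add: field_simps)
    ultimately show ?thesis by linarith
  qed
  then have "\<bar>1 - b * t\<bar> powr s0 \<le> (1 / (2 * b)) powr s0" using assms by (intro powr_mono2') auto
  then have "t powr s0 * \<bar>1 - b * t\<bar> powr s0 \<le> t powr s0 * (1 / (2 * b)) powr s0" by (intro mult_left_mono) auto
  also have "\<dots> \<le> (1 / (2 * b)) powr s0 * (t powr s0 + \<bar>1 - b * t\<bar> powr s0)" by (simp add: algebra_simps)
  finally show ?thesis .
qed

lemma finite_mult_le:
  fixes b m :: nat
  assumes "b > 0"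
  shows "finite {x. b * x \<le> m}"
proof (rule finite_subset[of _ "{..m}"])
  show "{x. b * x \<le> m} \<subseteq> {..m}"
  proof
    fix x assume "x \<in> {x. b * x \<le> m}"
    then have "b * x \<le> m" by simp
    moreover have "x \<le> b * x" using assms by simp
    ultimately have "x \<le> m" by (rule order_trans[rotated])
    then show "x \<in> {..m}" by simp
  qed
qed simp

text \<open>The sum is written as the integral of a step function with cells of length \<open>q / (m + 1)\<close> over the
  residue class on which \<open>v\<close> is supported; Potter's bound dominates the step functions by an
  integrable function, so the sum converges to a Beta integral.\<close>
lemma weighted_convolution_asymptotics:
  fixes p v :: "nat \<Rightarrow> real" and \<sigma> c :: real and l d b :: nat
  assumes p: "rv_seq p (\<sigma> - 1)" and \<sigma>: "0 < \<sigma>" "\<sigma> \<le> 1" and l: "l \<ge> 1" and d: "d > 0" and b: "b > 0"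
    and vnn: "\<And>m. v m \<ge> 0" and vz: "\<And>m. \<not> d dvd m \<Longrightarrow> v m = 0"
    and lim: "(\<lambda>m. v m / (real (Suc m) ^ (l - 1) * p m ^ l) - (if d dvd m then real d * c else 0)) \<longlonglongrightarrow> 0"
  shows "(\<lambda>m. (\<Sum>x | b * x \<le> m. p x * v (m - b * x)) / (real (Suc m) ^ l * p m ^ (Suc l))
           - (if gcd d b dvd m then real (gcd d b) * (c * real b powr (-\<sigma>) * Beta \<sigma> (real l * \<sigma>)) else 0)) \<longlonglongrightarrow> 0"
proof -
  \<comment> \<open>The period of the admissible \<open>x\<close>, and hence the natural cell length
    before rescaling by \<open>m + 1\<close>.\<close>
  define q where "q = d div gcd d b"
  define P where "P m = real (Suc m) ^ (l - 1) * p m ^ l" for m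
  define X where "X m = {x. b * x \<le> m \<and> d dvd m - b * x}" for m
  define g where "g m x = p x * v (m - b * x) / (p m * P m)" for m x
  define \<tau> where "\<tau> = real l * \<sigma>"
  define f0 where "f0 t = (if 0 < t \<and> t < 1 / real b then real d * c * (t powr (\<sigma> - 1) * (1 - real b * t) powr (\<tau> - 1)) else 0)" for t
  define cell where "cell m x = {real x / real (Suc m)..<(real x + real q) / real (Suc m)}" for m x
  \<comment> \<open>For \<open>m\<close> that are not multiples of the gcd the sum is empty and
    carries no information; assigning the limit \<open>f0\<close> there makes \<open>f m\<close>
    converge along all \<open>m\<close> and not just along a subsequence. The two singular points
    form a null set and are set to 0.\<close>
  define f where "f m t = (if t = 0 \<or> t = 1 / real b then 0 else if gcd d b dvd m
      then \<Sum>x\<in>X m. (if t \<in> cell m x then g m x else 0) else f0 t)" for m t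
  define S where "S = {0..1 / real b + real q}"
  \<comment> \<open>Half of the margin of \<open>\<sigma> - 1\<close> above -1 is left for Potter's
    loss; the remainder keeps the majorant integrable.\<close>
  define s0 where "s0 = \<sigma> / 2 - 1"
  have s0: "s0 > -1" "s0 < 0" "s0 \<le> \<sigma> - 1" using \<sigma> by (auto simp: s0_def)
  have s0\<tau>: "s0 \<le> \<tau> - 1"
  proof -
    have "1 * \<sigma> \<le> \<tau>" unfolding \<tau>_def using l \<sigma> by (intro mult_right_mono) auto
    then show ?thesis using \<sigma> by (simp add: s0_def)
  qed
  have \<tau>: "\<tau> > 0" using l \<sigma> by (simp add: \<tau>_def)
  have b1: "real b \<ge> 1" using b by simp
  have qpos: "q > 0" unfolding q_def using d by (simp add: div_greater_zero_iff gcd_le1_nat)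
  have ppos: "p m > 0" for m by (rule rv_seq_pos[OF p])
  have Ppos: "P m > 0" for m unfolding P_def using ppos by simp
  have finX: "finite (X m)" for m
    by (rule finite_subset[OF _ finite_mult_le[OF b, of m]]) (auto simp: X_def)
  have gnn: "g m x \<ge> 0" for m x unfolding g_def using ppos Ppos vnn by (simp add: less_imp_le)
  have dq: "real d = real (gcd d b) * real q" unfolding q_def by (metis dvd_mult_div_cancel gcd_dvd1 of_nat_mult)
  have in_cell: "t \<in> cell m x \<longleftrightarrow> real x \<le> t * real (Suc m) \<and> t * real (Suc m) < real x + real q" for t m x
    unfolding cell_def by (auto simp: field_simps)
  have uniq: "x = x'" if "x \<in> X m" "x' \<in> X m" "t \<in> cell m x" "t \<in> cell m x'" for m x x' t
    using residue_cell_unique[OF d, of b x m x' "t * real (Suc m)"] that unfolding X_def in_cell q_def by auto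
  have sum1: "(\<Sum>x\<in>X m. (if t \<in> cell m x then g m x else 0)) = g m x" if "x \<in> X m" "t \<in> cell m x" for m x t
  proof -
    have "(\<Sum>x\<in>X m. (if t \<in> cell m x then g m x else 0)) = (\<Sum>y\<in>X m. (if y = x then g m x else 0))"
      by (rule sum.cong) (use uniq that in auto)
    then show ?thesis using that finX by simp
  qed
  \<comment> \<open>A loss of \<open>\<sigma> / (2 * l)\<close> for each factor \<open>p\<close>
    adds up to only \<open>\<sigma> / 2\<close> in \<open>p ^ l\<close>.\<close>
  obtain Cp where Cp: "Cp > 0" "\<And>m x. x \<le> m \<Longrightarrow> p x \<le> Cp * p m * (real (Suc x) / real (Suc m)) powr (\<sigma> - 1 - \<sigma> / (2 * real l))"
    using potter_bound[OF p, of "\<sigma> / (2 * real l)"] \<sigma> l by auto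
  have frac: "0 < real (Suc x) / real (Suc m)" "real (Suc x) / real (Suc m) \<le> 1" if "x \<le> m" for x m
    using that by (auto simp: field_simps)
  have pb: "p x \<le> Cp * p m * (real (Suc x) / real (Suc m)) powr s0" if "x \<le> m" for m x
  proof -
    have "\<sigma> / (2 * real l) \<le> \<sigma> / 2" using l \<sigma> by (intro divide_left_mono) auto
    then have "(real (Suc x) / real (Suc m)) powr (\<sigma> - 1 - \<sigma> / (2 * real l)) \<le> (real (Suc x) / real (Suc m)) powr s0"
      using frac[OF that] by (intro powr_mono') (auto simp: s0_def)
    then have "Cp * p m * (real (Suc x) / real (Suc m)) powr (\<sigma> - 1 - \<sigma> / (2 * real l)) \<le> Cp * p m * (real (Suc x) / real (Suc m)) powr s0"
      using Cp(1) ppos[of m] by (intro mult_left_mono) auto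
    then show ?thesis using Cp(2)[OF that] by linarith
  qed
  have Pb: "P y \<le> Cp ^ l * P m * (real (Suc y) / real (Suc m)) powr s0" if "y \<le> m" for m y
  proof -
    define r where "r = real (Suc y) / real (Suc m)"
    have r: "0 < r" "r \<le> 1" using frac[OF that] by (auto simp: r_def)
    have "p y ^ l \<le> (Cp * p m * r powr (\<sigma> - 1 - \<sigma> / (2 * real l))) ^ l"
      using Cp(2)[OF that] ppos[of y] unfolding r_def by (intro power_mono) (auto simp: less_imp_le)
    also have "\<dots> = Cp ^ l * p m ^ l * r powr (real l * (\<sigma> - 1) - \<sigma> / 2)"
    proof -
      have e: "(\<sigma> - 1 - \<sigma> / (2 * real l)) * real l = real l * (\<sigma> - 1) - \<sigma> / 2" using l by (simp add: field_simps)
      have "(r powr (\<sigma> - 1 - \<sigma> / (2 * real l))) ^ l = r powr (real l * (\<sigma> - 1) - \<sigma> / 2)"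
        unfolding e[symmetric] using r by (simp add: powr_realpow[symmetric] powr_powr)
      then show ?thesis by (simp add: power_mult_distrib)
    qed
    finally have "P y \<le> real (Suc y) ^ (l - 1) * (Cp ^ l * p m ^ l * r powr (real l * (\<sigma> - 1) - \<sigma> / 2))"
      unfolding P_def by (intro mult_left_mono) auto
    also have "real (Suc y) ^ (l - 1) = real (Suc m) ^ (l - 1) * r powr (real l - 1)"
    proof -
      have "r powr (real l - 1) = r ^ (l - 1)" using r l by (simp add: powr_realpow[symmetric] of_nat_diff)
      then show ?thesis by (simp add: r_def power_divide)
    qed
    finally have "P y \<le> Cp ^ l * P m * (r powr (real l - 1) * r powr (real l * (\<sigma> - 1) - \<sigma> / 2))"
      unfolding P_def by (simp add: algebra_simps)
    also have "r powr (real l - 1) * r powr (real l * (\<sigma> - 1) - \<sigma> / 2) = r powr (\<tau> - 1 - \<sigma> / 2)"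
      by (simp add: powr_add[symmetric] \<tau>_def algebra_simps)
    also have "r powr (\<tau> - 1 - \<sigma> / 2) \<le> r powr s0"
    proof (rule powr_mono')
      have "1 * \<sigma> \<le> \<tau>" unfolding \<tau>_def using l \<sigma> by (intro mult_right_mono) auto
      then show "s0 \<le> \<tau> - 1 - \<sigma> / 2" by (simp add: s0_def)
    qed (use r in auto)
    finally show ?thesis using Cp(1) Ppos[of m] unfolding r_def by simp
  qed
  obtain Cv where Cv: "Cv > 0" "\<And>m. v m \<le> Cv * P m"
  proof -
    have "Bseq (\<lambda>m. v m / P m - (if d dvd m then real d * c else 0))"
      using lim unfolding P_def by (intro convergent_imp_Bseq) (auto simp: convergent_def)
    then obtain K where K: "\<And>m. \<bar>v m / P m - (if d dvd m then real d * c else 0)\<bar> \<le> K" "K > 0"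
      by (auto simp: Bseq_def)
    have "v m \<le> (K + \<bar>real d * c\<bar>) * P m" for m
    proof -
      have "(if d dvd m then real d * c else 0) \<le> \<bar>real d * c\<bar>" by (simp only: abs_ge_self abs_ge_zero split: if_split) simp
      then have "v m / P m \<le> K + \<bar>real d * c\<bar>" using abs_le_D1[OF K(1)[of m]] by linarith
      then show ?thesis using Ppos[of m] by (simp add: field_simps)
    qed
    then show ?thesis using that[of "K + \<bar>real d * c\<bar>"] K(2) by auto
  qed
  \<comment> \<open>The two powers with exponent \<open>s0\<close> are the price of replacing the
    lattice points \<open>x + 1\<close> and \<open>y + 1\<close> by the continuous quantities
    \<open>t * (m + 1)\<close> and \<open>\<bar>1 - b * t\<bar> * (m + 1)\<close>, which may be
    larger by factors \<open>q\<close> and \<open>b * q\<close>.\<close>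
  define C1 where "C1 = Cp * Cv * Cp ^ l * (1 / real q) powr s0 * (1 / (real b * real q)) powr s0"
  have C1: "C1 > 0" unfolding C1_def using Cp(1) Cv(1) qpos b by simp
  have gb: "g m x \<le> C1 * (t powr s0 * \<bar>1 - real b * t\<bar> powr s0)"
    if x: "x \<in> X m" "t \<in> cell m x" and t: "t > 0" "t \<noteq> 1 / real b" for m x t
  proof -
    define y where "y = m - b * x"
    have bx: "b * x \<le> m" using x by (simp add: X_def)
    have xm: "x \<le> m" using bx b by (metis le_trans mult_le_cancel2 mult.commute nat_mult_1 Suc_leI One_nat_def mult_le_mono1)
    have ym: "y \<le> m" by (simp add: y_def)
    have yr: "real y = real m - real b * real x" using bx unfolding y_def by (simp add: of_nat_diff)
    have c: "real x \<le> t * real (Suc m)" "t * real (Suc m) < real x + real q" using x(2) in_cell by auto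
    \<comment> \<open>A lower bound on \<open>x + 1\<close> is what matters, because the exponent
      \<open>s0\<close> is negative; the \<open>+ 1\<close> keeps the estimate alive at
      \<open>x = 0\<close>.\<close>
    have "real x + real q \<le> real q * real (Suc x)" using qpos by (simp add: algebra_simps) (metis Suc_leI mult.commute mult_le_mono1 nat_mult_1 of_nat_le_iff of_nat_mult One_nat_def)
    then have "t / real q \<le> real (Suc x) / real (Suc m)" using c(2) qpos by (simp add: field_simps del: of_nat_Suc)
    then have "(real (Suc x) / real (Suc m)) powr s0 \<le> (t / real q) powr s0"
      using t qpos s0 by (intro powr_mono2') auto
    then have "p x \<le> Cp * p m * (t / real q) powr s0"
      using pb[OF xm] Cp(1) ppos[of m] by (smt (verit, best) mult_left_mono mult_pos_pos)
    also have "(t / real q) powr s0 = t powr s0 * (1 / real q) powr s0"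
      using t qpos by (simp add: powr_mult[symmetric])
    finally have p1: "p x \<le> Cp * p m * (t powr s0 * (1 / real q) powr s0)" .
    have "\<bar>1 - real b * t\<bar> * real (Suc m) = \<bar>(1 - real b * t) * real (Suc m)\<bar>"
      by (simp only: abs_mult abs_of_nat)
    also have "(1 - real b * t) * real (Suc m) = real (Suc m) - real b * (t * real (Suc m))"
      by (simp only: left_diff_distrib mult_1_left mult.assoc)
    also have "\<bar>real (Suc m) - real b * (t * real (Suc m))\<bar> \<le> real b * real q * real (Suc y)"
    proof -
      have 1: "real b * real x \<le> real b * (t * real (Suc m))" "real b * (t * real (Suc m)) \<le> real b * (real x + real q)"
        using c by (auto intro!: mult_left_mono)
      have 2: "1 \<le> real b * real q" using b qpos by (metis Suc_leI nat_0_less_mult_iff of_nat_1 of_nat_le_iff of_nat_mult One_nat_def)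
      have 3: "real (Suc y) \<le> real b * real q * real (Suc y)" using 2 by (simp add: mult_right_mono[of 1])
      have 4: "real b * real q \<le> real b * real q * real (Suc y)" by (simp add: algebra_simps)
      have 5: "real b * (real x + real q) = real b * real x + real b * real q" by (simp add: algebra_simps)
      have 6: "real (Suc y) = real (Suc m) - real b * real x" using yr by simp
      show ?thesis
        by (rule abs_leI) (use 1 3 4 5 6 in linarith)+
    qed
    finally have "\<bar>1 - real b * t\<bar> / (real b * real q) \<le> real (Suc y) / real (Suc m)"
      using b qpos by (simp add: field_simps del: of_nat_Suc)
    moreover have "real b * t \<noteq> 1" using t(2) b by (auto simp: field_simps)
    ultimately have "(real (Suc y) / real (Suc m)) powr s0 \<le> (\<bar>1 - real b * t\<bar> / (real b * real q)) powr s0"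
      using b qpos s0 by (intro powr_mono2') auto
    then have "P y \<le> Cp ^ l * P m * (\<bar>1 - real b * t\<bar> / (real b * real q)) powr s0"
      using Pb[OF ym] Cp(1) Ppos[of m] by (smt (verit, best) mult_left_mono mult_pos_pos zero_less_power)
    also have "(\<bar>1 - real b * t\<bar> / (real b * real q)) powr s0 = \<bar>1 - real b * t\<bar> powr s0 * (1 / (real b * real q)) powr s0"
      using b qpos by (simp add: powr_mult[symmetric])
    finally have "v y \<le> Cv * (Cp ^ l * P m * (\<bar>1 - real b * t\<bar> powr s0 * (1 / (real b * real q)) powr s0))"
      using Cv(2)[of y] Cv(1) by (smt (verit, best) mult_left_mono)
    then have "p x * v y \<le> (Cp * p m * (t powr s0 * (1 / real q) powr s0)) * (Cv * (Cp ^ l * P m * (\<bar>1 - real b * t\<bar> powr s0 * (1 / (real b * real q)) powr s0)))"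
      using p1 ppos[of x] vnn[of y] Cp(1) ppos[of m] by (intro mult_mono) (auto simp: less_imp_le)
    also have "\<dots> = C1 * (t powr s0 * \<bar>1 - real b * t\<bar> powr s0) * (p m * P m)"
      unfolding C1_def by (simp only: mult_ac)
    finally show ?thesis unfolding g_def y_def[symmetric] using ppos[of m] Ppos[of m] by (simp add: divide_le_eq)
  qed
  \<comment> \<open>Adding \<open>\<bar>d * c\<bar>\<close> lets the same function \<open>H\<close>
    dominate both the step functions and the limit \<open>f0\<close>.\<close>
  define Cc where "Cc = (C1 + \<bar>real d * c\<bar>) * (1 / (2 * real b)) powr s0"
  define H where "H t = Cc * (t powr s0 + \<bar>1 - real b * t\<bar> powr s0)" for t
  have Hb: "C * (t powr s0 * \<bar>1 - real b * t\<bar> powr s0) \<le> H t" if "t > 0" "t \<noteq> 1 / real b" "0 \<le> C" "C \<le> C1 + \<bar>real d * c\<bar>" for t C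
  proof -
    have "C * (t powr s0 * \<bar>1 - real b * t\<bar> powr s0) \<le> (C1 + \<bar>real d * c\<bar>) * ((1 / (2 * real b)) powr s0 * (t powr s0 + \<bar>1 - real b * t\<bar> powr s0))"
      by (rule mult_mono) (use powr_pair_bound[of "real b" s0 t] that b1 s0 C1 in auto)
    then show ?thesis unfolding H_def Cc_def by (simp add: mult.assoc)
  qed
  have Hnn: "H t \<ge> 0" for t unfolding H_def Cc_def using C1 by simp
  have f0b: "\<bar>f0 t\<bar> \<le> H t" for t
  proof (cases "0 < t \<and> t < 1 / real b")
    case True
    then have bt: "0 < 1 - real b * t" "1 - real b * t \<le> 1" using b by (auto simp: field_simps)
    have t1: "t \<le> 1" using True b1 by (smt (verit) divide_le_eq_1)
    have "\<bar>f0 t\<bar> = \<bar>real d * c\<bar> * (t powr (\<sigma> - 1) * (1 - real b * t) powr (\<tau> - 1))" using True by (simp add: f0_def abs_mult)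
    also have "\<dots> \<le> \<bar>real d * c\<bar> * (t powr s0 * \<bar>1 - real b * t\<bar> powr s0)"
    proof (intro mult_left_mono mult_mono)
      show "t powr (\<sigma> - 1) \<le> t powr s0" using True t1 s0 by (intro powr_mono') auto
      show "(1 - real b * t) powr (\<tau> - 1) \<le> \<bar>1 - real b * t\<bar> powr s0" using bt s0\<tau> by (simp add: powr_mono')
    qed auto
    also have "\<dots> \<le> H t" by (rule Hb) (use True C1 in auto)
    finally show ?thesis .
  qed (auto simp: f0_def Hnn)
  have fb: "norm (f m t) \<le> H t" if "t \<in> S" for m t
  proof (cases "t = 0 \<or> t = 1 / real b")
    case False
    then have t: "t > 0" "t \<noteq> 1 / real b" using that by (auto simp: S_def)
    show ?thesis
    proof (cases "gcd d b dvd m")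
      case True
      then have ft: "f m t = (\<Sum>x\<in>X m. (if t \<in> cell m x then g m x else 0))" using False by (simp add: f_def)
      show ?thesis
      proof (cases "\<exists>x\<in>X m. t \<in> cell m x")
        case True
        then obtain x where x: "x \<in> X m" "t \<in> cell m x" by blast
        have "f m t = g m x" using ft sum1[OF x] by simp
        then have "norm (f m t) \<le> C1 * (t powr s0 * \<bar>1 - real b * t\<bar> powr s0)" using gb[OF x t] gnn by simp
        also have "\<dots> \<le> H t" by (rule Hb[OF t]) (use C1 in auto)
        finally show ?thesis .
      next
        case False
        then have "f m t = 0" unfolding ft by (intro sum.neutral) auto
        then show ?thesis using Hnn by simp
      qed
    qed (use False f0b in \<open>auto simp: f_def\<close>)
  qed (auto simp: f_def Hnn)
  have Hint: "H integrable_on S"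
    unfolding H_def S_def
    by (intro integrable_on_mult_right integrable_add integrable_affine_abs_powr integrable_on_powr_from_0)
       (use s0 b in auto)
  have f0I: "(f0 has_integral (real d * c * (real b powr (-\<sigma>) * Beta \<sigma> \<tau>))) S"
  proof -
    have "((\<lambda>t. real d * c * (t powr (\<sigma> - 1) * (1 - real b * t) powr (\<tau> - 1))) has_integral (real d * c * (real b powr (-\<sigma>) * Beta \<sigma> \<tau>))) {0..1 / real b}"
      by (intro has_integral_mult_right has_integral_scaled_Beta) (use b \<sigma> \<tau> in auto)
    then have "((\<lambda>t. if t \<in> {0..1 / real b} then real d * c * (t powr (\<sigma> - 1) * (1 - real b * t) powr (\<tau> - 1)) else 0) has_integral (real d * c * (real b powr (-\<sigma>) * Beta \<sigma> \<tau>))) S"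
      by (subst has_integral_restrict) (auto simp: S_def)
    then show ?thesis
      by (rule has_integral_spike_finite[where S = "{0, 1 / real b}", rotated 2]) (auto simp: f0_def S_def)
  qed
  have fI: "(f m has_integral (real q / real (Suc m) * (\<Sum>x\<in>X m. g m x))) S" if "gcd d b dvd m" for m
  proof -
    have "((\<lambda>t. \<Sum>x\<in>X m. (if t \<in> cell m x then g m x else 0)) has_integral (\<Sum>x\<in>X m. g m x * (real q / real (Suc m)))) S"
    proof (intro has_integral_sum finX)
      fix x assume x: "x \<in> X m"
      have sub: "cell m x \<subseteq> S"
      proof
        fix t assume t: "t \<in> cell m x"
        then have c: "real x \<le> t * real (Suc m)" "t * real (Suc m) < real x + real q" using in_cell by auto
        have "real b * real x \<le> real m" using x unfolding X_def by (metis (mono_tags, lifting) mem_Collect_eq of_nat_le_iff of_nat_mult)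
        then have "real x \<le> real m / real b" using b by (simp add: field_simps)
        moreover have "real m / real b \<le> real (Suc m) / real b" by (simp add: divide_right_mono)
        moreover have "real q * 1 \<le> real q * real (Suc m)" by (intro mult_left_mono) auto
        moreover have "(1 / real b + real q) * real (Suc m) = real (Suc m) / real b + real q * real (Suc m)" by (simp add: algebra_simps)
        ultimately have "t * real (Suc m) \<le> (1 / real b + real q) * real (Suc m)" using c by linarith
        then have "t \<le> 1 / real b + real q" by (rule mult_right_le_imp_le) auto
        moreover have "t \<ge> 0" using c by (smt (verit) mult_neg_pos of_nat_0_le_iff of_nat_0_less_iff zero_less_Suc)
        ultimately show "t \<in> S" by (simp add: S_def)
      qed
      have "((\<lambda>x. 1) has_integral measure lborel (cell m x)) (cell m x)"
        by (rule has_integral_measure_lborel) (auto simp: cell_def divide_right_mono)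
      moreover have "measure lborel (cell m x) = real q / real (Suc m)"
        unfolding cell_def by (simp add: divide_right_mono diff_divide_distrib[symmetric] del: of_nat_Suc)
      ultimately have "((\<lambda>t. g m x * 1) has_integral g m x * (real q / real (Suc m))) (cell m x)"
        by (intro has_integral_mult_right) simp
      then show "((\<lambda>t. if t \<in> cell m x then g m x else 0) has_integral g m x * (real q / real (Suc m))) S"
        using has_integral_restrict[OF sub, of "\<lambda>t. g m x"] by simp
    qed
    then have "(f m has_integral (\<Sum>x\<in>X m. g m x * (real q / real (Suc m)))) S"
      by (rule has_integral_spike_finite[where S = "{0, 1 / real b}", rotated 2]) (use that in \<open>auto simp: f_def\<close>)
    then show ?thesis by (simp only: sum_distrib_right[symmetric] mult.commute[of "sum (g m) (X m)"])
  qed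
  have fint: "f m integrable_on S" for m
  proof (cases "gcd d b dvd m")
    case True then show ?thesis using fI by blast
  next
    case False
    have "(f m has_integral (real d * c * (real b powr (-\<sigma>) * Beta \<sigma> \<tau>))) S"
      by (rule has_integral_spike_finite[where S = "{0, 1 / real b}", OF _ _ f0I]) (use False in \<open>auto simp: f_def\<close>)
    then show ?thesis by blast
  qed
  have pw: "(\<lambda>m. f m t) \<longlonglongrightarrow> f0 t" if tS: "t \<in> S" for t
  proof -
    consider "t = 0 \<or> t = 1 / real b" | "t > 1 / real b" | "0 < t" "t < 1 / real b" using tS by (fastforce simp: S_def)
    then show ?thesis
    proof cases
      case 1
      then show ?thesis using b by (auto simp: f_def f0_def)
    next
      case 2
      then have t0: "t \<noteq> 0" using b by auto
      have "filterlim (\<lambda>m. (t - 1 / real b) * real m) at_top sequentially"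
        by (rule filterlim_tendsto_pos_mult_at_top[OF tendsto_const _ filterlim_real_sequentially]) (use 2 in auto)
      then have "\<forall>\<^sub>F m in sequentially. real q \<le> (t - 1 / real b) * real m" by (simp add: filterlim_at_top)
      then have "\<forall>\<^sub>F m in sequentially. f m t = f0 t"
      proof eventually_elim
        case (elim m)
        have "t \<notin> cell m x" if "x \<in> X m" for x
        proof
          assume "t \<in> cell m x"
          then have "t * real (Suc m) < real x + real q" using in_cell by auto
          moreover have "real b * real x \<le> real m" using that unfolding X_def by (metis (mono_tags, lifting) mem_Collect_eq of_nat_le_iff of_nat_mult)
          then have "real x \<le> real m / real b" using b by (simp add: field_simps)
          moreover have "t > 0" using 2 b by (smt (verit) divide_nonneg_nonneg of_nat_0_le_iff)
          ultimately show False using elim by (simp add: algebra_simps)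
        qed
        then have "(\<Sum>x\<in>X m. (if t \<in> cell m x then g m x else 0)) = 0" by (intro sum.neutral) auto
        then show ?case using 2 t0 by (simp add: f_def f0_def)
      qed
      then show ?thesis by (rule tendsto_eventually)
    next
      case 3
      have bt: "real b * t < 1" using 3 b by (simp add: field_simps)
      \<comment> \<open>An index near \<open>t * (m + 1)\<close> is supplied for every
        \<open>m\<close>: the admissible one when there is one, the integer part otherwise. The
        limits of \<open>x m / m\<close> and \<open>y m / m\<close> then need no restriction on
        \<open>m\<close>.\<close>
      have "\<exists>x. real x \<le> t * real (Suc m) \<and> t * real (Suc m) < real x + real q \<and>
              (gcd d b dvd m \<and> real q \<le> t * real (Suc m) \<and> real b * (t * real (Suc m)) \<le> real m \<longrightarrow> x \<in> X m)" for m
      proof (cases "gcd d b dvd m \<and> real q \<le> t * real (Suc m) \<and> real b * (t * real (Suc m)) \<le> real m")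
        case True
        then show ?thesis using residue_cell_exists[OF d, of b m "t * real (Suc m)"] unfolding q_def X_def by auto
      next
        case False
        have "t * real (Suc m) \<ge> 0" using 3 by simp
        then have "real (nat \<lfloor>t * real (Suc m)\<rfloor>) \<le> t * real (Suc m)" "t * real (Suc m) < real (nat \<lfloor>t * real (Suc m)\<rfloor>) + 1" by linarith+
        moreover have "real q \<ge> 1" using qpos by simp
        ultimately show ?thesis using False by (intro exI[of _ "nat \<lfloor>t * real (Suc m)\<rfloor>"]) linarith
      qed
      then obtain x where x: "\<And>m. real (x m) \<le> t * real (Suc m)" "\<And>m. t * real (Suc m) < real (x m) + real q"
        "\<And>m. gcd d b dvd m \<Longrightarrow> real q \<le> t * real (Suc m) \<Longrightarrow> real b * (t * real (Suc m)) \<le> real m \<Longrightarrow> x m \<in> X m"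
        by metis
      define y where "y m = m - b * x m" for m
      have xlim: "(\<lambda>m. real (x m) / real m) \<longlonglongrightarrow> t"
      proof (rule tendsto_sandwich)
        show "(\<lambda>m. (t * real (Suc m) - real q) / real m) \<longlonglongrightarrow> t" by real_asymp
        show "(\<lambda>m. t * real (Suc m) / real m) \<longlonglongrightarrow> t" by real_asymp
        show "\<forall>\<^sub>F m in sequentially. (t * real (Suc m) - real q) / real m \<le> real (x m) / real m"
          using x(2) by (intro always_eventually allI divide_right_mono) (auto simp: less_imp_le diff_le_eq)
        show "\<forall>\<^sub>F m in sequentially. real (x m) / real m \<le> t * real (Suc m) / real m"
          using x(1) by (intro always_eventually allI divide_right_mono) auto
      qed
      have evb: "\<forall>\<^sub>F m in sequentially. real b * (t * real (Suc m)) \<le> real m"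
      proof -
        have "filterlim (\<lambda>m. (1 - real b * t) * real m) at_top sequentially"
          by (rule filterlim_tendsto_pos_mult_at_top[OF tendsto_const _ filterlim_real_sequentially]) (use bt in auto)
        then have "\<forall>\<^sub>F m in sequentially. real b * t \<le> (1 - real b * t) * real m" by (simp add: filterlim_at_top)
        then show ?thesis by eventually_elim (simp add: algebra_simps)
      qed
      have evq: "\<forall>\<^sub>F m in sequentially. real q \<le> t * real (Suc m)"
      proof -
        have "filterlim (\<lambda>m. t * real m) at_top sequentially"
          by (rule filterlim_tendsto_pos_mult_at_top[OF tendsto_const _ filterlim_real_sequentially]) (use 3 in auto)
        then have "\<forall>\<^sub>F m in sequentially. real q \<le> t * real m" by (simp add: filterlim_at_top)
        then show ?thesis by eventually_elim (use 3 in \<open>simp add: algebra_simps\<close>)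
      qed
      have evy: "\<forall>\<^sub>F m in sequentially. real (y m) = real m - real b * real (x m)"
        using evb
      proof eventually_elim
        case (elim m)
        have "real b * real (x m) \<le> real b * (t * real (Suc m))" using x(1) by (intro mult_left_mono) auto
        then have "real (b * x m) \<le> real m" using elim by simp
        then have "b * x m \<le> m" by (simp only: of_nat_le_iff)
        then show ?case unfolding y_def by (simp add: of_nat_diff)
      qed
      have ylim: "(\<lambda>m. real (y m) / real m) \<longlonglongrightarrow> 1 - real b * t"
      proof (rule Lim_transform_eventually)
        show "(\<lambda>m. 1 - real b * (real (x m) / real m)) \<longlonglongrightarrow> 1 - real b * t" by (intro tendsto_intros xlim)
        show "\<forall>\<^sub>F m in sequentially. 1 - real b * (real (x m) / real m) = real (y m) / real m"
          using evy eventually_gt_at_top[of 0] by eventually_elim (simp add: field_simps)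
      qed
      have ytop: "filterlim y at_top sequentially"
      proof -
        have "filterlim (\<lambda>m. (real (y m) / real m) * real m) at_top sequentially"
          by (rule filterlim_tendsto_pos_mult_at_top[OF ylim _ filterlim_real_sequentially]) (use bt in auto)
        moreover have "\<forall>\<^sub>F m in sequentially. (real (y m) / real m) * real m = real (y m)"
          using eventually_gt_at_top[of 0] by eventually_elim simp
        ultimately have "filterlim (\<lambda>m. real (y m)) at_top sequentially"
          using filterlim_cong by fastforce
        then show ?thesis by (simp add: filterlim_sequentially_iff_filterlim_real)
      qed
      define e where "e m = v (y m) / P (y m) - (if d dvd y m then real d * c else 0)" for m
      have elim0: "e \<longlonglongrightarrow> 0" unfolding e_def P_def by (rule filterlim_compose[OF lim ytop])
      have Plim: "(\<lambda>m. P (y m) / P m) \<longlonglongrightarrow> (1 - real b * t) powr (\<tau> - 1)"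
      proof -
        have "(\<lambda>m. real (Suc (y m)) powr 1 / real (Suc m) powr 1) \<longlonglongrightarrow> (1 - real b * t) powr 1"
          by (rule rv_seq_tendsto[OF rv_seq_Suc_powr ylim]) (use bt in auto)
        then have 1: "(\<lambda>m. real (Suc (y m)) / real (Suc m)) \<longlonglongrightarrow> 1 - real b * t" using bt by simp
        have 2: "(\<lambda>m. p (y m) / p m) \<longlonglongrightarrow> (1 - real b * t) powr (\<sigma> - 1)"
          by (rule rv_seq_tendsto[OF p ylim]) (use bt in auto)
        have "(\<lambda>m. (real (Suc (y m)) / real (Suc m)) ^ (l - 1) * (p (y m) / p m) ^ l) \<longlonglongrightarrow> (1 - real b * t) ^ (l - 1) * ((1 - real b * t) powr (\<sigma> - 1)) ^ l"
          by (intro tendsto_intros 1 2)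
        moreover have "(1 - real b * t) ^ (l - 1) * ((1 - real b * t) powr (\<sigma> - 1)) ^ l = (1 - real b * t) powr (\<tau> - 1)"
        proof -
          have "(1 - real b * t) ^ (l - 1) = (1 - real b * t) powr (real l - 1)"
            using bt l by (simp add: powr_realpow[symmetric] of_nat_diff)
          moreover have "((1 - real b * t) powr (\<sigma> - 1)) ^ l = (1 - real b * t) powr ((\<sigma> - 1) * real l)"
            using bt by (simp add: powr_realpow[symmetric] powr_powr)
          ultimately show ?thesis by (simp add: powr_add[symmetric] \<tau>_def algebra_simps)
        qed
        moreover have "(real (Suc (y m)) / real (Suc m)) ^ (l - 1) * (p (y m) / p m) ^ l = P (y m) / P m" for m
          unfolding P_def by (simp add: power_divide)
        ultimately show ?thesis by simp
      qed
      \<comment> \<open>\<open>G\<close> has the residue indicator stripped off, so it converges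
        along all \<open>m\<close>; it agrees with \<open>f m t\<close> on multiples of the gcd for
        large \<open>m\<close>, and elsewhere \<open>f m t\<close> already equals its limit.\<close>
      define G where "G m = (p (x m) / p m) * (real d * c + e m) * (P (y m) / P m)" for m
      have "G \<longlonglongrightarrow> t powr (\<sigma> - 1) * (real d * c + 0) * (1 - real b * t) powr (\<tau> - 1)"
        unfolding G_def by (intro tendsto_intros elim0 Plim rv_seq_tendsto[OF p xlim]) (use 3 in auto)
      moreover have "t powr (\<sigma> - 1) * (real d * c + 0) * (1 - real b * t) powr (\<tau> - 1) = f0 t"
        using 3 by (simp add: f0_def)
      ultimately have G: "(\<lambda>m. G m - f0 t) \<longlonglongrightarrow> 0" using LIM_zero by metis
      have "\<forall>\<^sub>F m in sequentially. norm (f m t - f0 t) \<le> norm (G m - f0 t)"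
        using evb evq
      proof eventually_elim
        case (elim m)
        show ?case
        proof (cases "gcd d b dvd m")
          case True
          have xX: "x m \<in> X m" by (rule x(3)[OF True elim(2,1)])
          have "f m t = g m (x m)" using 3 True sum1[OF xX, of t] x(1,2) in_cell by (simp add: f_def)
          also have "\<dots> = (p (x m) / p m) * (v (y m) / P (y m)) * (P (y m) / P m)"
            using Ppos[of "y m"] unfolding g_def y_def by simp
          also have "v (y m) / P (y m) = real d * c + e m" using xX unfolding e_def y_def X_def by simp
          finally show ?thesis unfolding G_def by simp
        qed (use 3 in \<open>simp add: f_def\<close>)
      qed
      then have "(\<lambda>m. f m t - f0 t) \<longlonglongrightarrow> 0" by (rule Lim_null_comparison[OF _ tendsto_norm_zero[OF G]])
      then show ?thesis by (rule LIM_zero_cancel)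
    qed
  qed
  have "(\<lambda>m. integral S (f m)) \<longlonglongrightarrow> integral S f0"
    by (rule dominated_convergence(2)[OF fint Hint fb pw])
  then have "(\<lambda>m. (integral S (f m) - integral S f0) / real q) \<longlonglongrightarrow> (integral S f0 - integral S f0) / real q"
    by (intro tendsto_intros) (use qpos in auto)
  then have lim0: "(\<lambda>m. (integral S (f m) - integral S f0) / real q) \<longlonglongrightarrow> 0" by simp
  \<comment> \<open>A cell has length \<open>q / (m + 1)\<close>, so the integral is
    \<open>q\<close> times the normalised sum. Dividing by \<open>q\<close> also turns the factor
    \<open>d\<close> of the limit into \<open>gcd d b\<close>.\<close>
  define W where "W m = (\<Sum>x | b * x \<le> m. p x * v (m - b * x)) / (real (Suc m) ^ l * p m ^ (Suc l))
           - (if gcd d b dvd m then real (gcd d b) * (c * real b powr (-\<sigma>) * Beta \<sigma> (real l * \<sigma>)) else 0)" for m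
  have WX: "(\<Sum>x | b * x \<le> m. p x * v (m - b * x)) = (\<Sum>x\<in>X m. p x * v (m - b * x))" for m
  proof (rule sum.mono_neutral_right)
    show "finite {x. b * x \<le> m}" by (rule finite_mult_le[OF b])
  qed (use vz in \<open>auto simp: X_def\<close>)
  have "norm (W m) \<le> norm ((integral S (f m) - integral S f0) / real q)" for m
  proof (cases "gcd d b dvd m")
    case True
    have PS: "real (Suc m) ^ l * p m ^ (Suc l) = real (Suc m) * (p m * P m)"
      unfolding P_def using l by (cases l) (auto simp: algebra_simps)
    have "(\<Sum>x | b * x \<le> m. p x * v (m - b * x)) / (real (Suc m) ^ l * p m ^ (Suc l)) = (\<Sum>x\<in>X m. g m x) / real (Suc m)"
      unfolding WX PS g_def sum_divide_distrib by (simp add: mult.commute del: of_nat_Suc)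
    also have "\<dots> = integral S (f m) / real q" using integral_unique[OF fI[OF True]] qpos by simp
    finally have "W m = (integral S (f m) - integral S f0) / real q"
    proof -
      assume a: "(\<Sum>x | b * x \<le> m. p x * v (m - b * x)) / (real (Suc m) ^ l * p m ^ (Suc l)) = integral S (f m) / real q"
      have "integral S f0 / real q = real (gcd d b) * (c * real b powr (-\<sigma>) * Beta \<sigma> (real l * \<sigma>))"
        unfolding integral_unique[OF f0I] dq \<tau>_def using qpos by simp
      then show ?thesis unfolding W_def a diff_divide_distrib using True by simp
    qed
    then show ?thesis by simp
  next
    case False
    have "X m = {}"
    proof (rule ccontr)
      assume "X m \<noteq> {}"
      then obtain x where x: "b * x \<le> m" "d dvd m - b * x" by (auto simp: X_def)
      have "gcd d b dvd (m - b * x) + b * x"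
        by (rule dvd_add[OF dvd_trans[OF gcd_dvd1 x(2)] dvd_mult2[OF gcd_dvd2]])
      then show False using False x(1) by simp
    qed
    then show ?thesis using False WX[of m] by (simp add: W_def)
  qed
  then have "\<forall>\<^sub>F m in sequentially. norm (W m) \<le> norm ((integral S (f m) - integral S f0) / real q)" by simp
  then have "W \<longlonglongrightarrow> 0" by (rule Lim_null_comparison[OF _ tendsto_norm_zero[OF lim0]])
  then show ?thesis unfolding W_def .
qed

subsection \<open>Weighted counts of solutions of linear equations\<close>

text \<open>The index set is arbitrary, since coordinates will be deleted from it and pairs of equal
  coordinates merged by adding their coefficients; fixing the value 0 off \<open>I\<close> makes
  functions correspond to tuples.\<close>

definition sols :: "(nat \<Rightarrow> nat) \<Rightarrow> nat set \<Rightarrow> nat \<Rightarrow> (nat \<Rightarrow> nat) set" where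
  "sols c I n = {k. (\<forall>i. i \<notin> I \<longrightarrow> k i = 0) \<and> (\<Sum>i\<in>I. c i * k i) = n}"

definition wsum :: "(nat \<Rightarrow> real) \<Rightarrow> (nat \<Rightarrow> nat) \<Rightarrow> nat set \<Rightarrow> nat \<Rightarrow> real" where
  "wsum p c I n = (\<Sum>k\<in>sols c I n. \<Prod>i\<in>I. p (k i))"

lemma sols_coeff_le:
  assumes "finite I" "k \<in> sols c I n" "i \<in> I"
  shows "c i * k i \<le> n"
  using assms member_le_sum[of i I "\<lambda>i. c i * k i"] by (auto simp: sols_def)

lemma sols_le:
  assumes "finite I" "\<forall>i\<in>I. c i > 0" "k \<in> sols c I n" "i \<in> I"
  shows "k i \<le> n"
proof -
  have "k i \<le> c i * k i" using bspec[OF assms(2,4)] by simp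
  then show ?thesis using sols_coeff_le[OF assms(1,3,4)] by (rule order_trans)
qed

lemma finite_sols:
  assumes "finite I" "\<forall>i\<in>I. c i > 0"
  shows "finite (sols c I n)"
proof (rule finite_subset)
  show "sols c I n \<subseteq> {k. \<forall>i. (i \<in> I \<longrightarrow> k i \<in> {..n}) \<and> (i \<notin> I \<longrightarrow> k i = 0)}"
    using sols_le[OF assms] by (auto simp: sols_def)
  show "finite {k. \<forall>i. (i \<in> I \<longrightarrow> k i \<in> {..n}) \<and> (i \<notin> I \<longrightarrow> k i = (0::nat))}"
    by (rule finite_set_of_finite_funs) (use assms in auto)
qed

lemma sols_fiber_bij:
  assumes "finite I" "j \<in> I" "c j * x \<le> n"
  shows "bij_betw (\<lambda>k. k(j := 0)) {k \<in> sols c I n. k j = x} (sols c (I - {j}) (n - c j * x))"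
proof (rule bij_betw_byWitness[where f' = "\<lambda>k. k(j := x)"])
  have upd: "(\<Sum>i\<in>I - {j}. c i * (k(j := y)) i) = (\<Sum>i\<in>I - {j}. c i * k i)" for k y by (rule sum.cong) auto
  have spl: "(\<Sum>i\<in>I. c i * k i) = c j * k j + (\<Sum>i\<in>I - {j}. c i * k i)" for k
    using assms by (simp add: sum.remove)
  show "(\<lambda>k. k(j := 0)) ` {k \<in> sols c I n. k j = x} \<subseteq> sols c (I - {j}) (n - c j * x)"
    using spl by (auto simp: sols_def upd simp del: fun_upd_apply) (auto simp: fun_upd_def)
  show "(\<lambda>k. k(j := x)) ` sols c (I - {j}) (n - c j * x) \<subseteq> {k \<in> sols c I n. k j = x}"
    using assms by (auto simp: sols_def spl upd simp del: fun_upd_apply) (auto simp: fun_upd_def)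
  show "\<forall>k\<in>{k \<in> sols c I n. k j = x}. (k(j := 0))(j := x) = k" by auto
  show "\<forall>k\<in>sols c (I - {j}) (n - c j * x). (k(j := x))(j := 0) = k" by (auto simp: sols_def)
qed

lemma sols_fiber_empty:
  assumes "finite I" "j \<in> I" "\<not> c j * x \<le> n"
  shows "{k \<in> sols c I n. k j = x} = {}"
  using sols_coeff_le[OF assms(1) _ assms(2)] assms(3) by fastforce

lemma sum_sols_fiber:
  assumes "finite I" "j \<in> I"
  shows "(\<Sum>k | k \<in> sols c I n \<and> k j = x. f (k(j := 0))) =
     (if c j * x \<le> n then (\<Sum>k\<in>sols c (I - {j}) (n - c j * x). f k) else 0)"
proof (cases "c j * x \<le> n")
  case True
  then show ?thesis using sum.reindex_bij_betw[OF sols_fiber_bij[OF assms, of c x n], of f] by simp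
next
  case False
  then have "{k. k \<in> sols c I n \<and> k j = x} = {}" using sols_fiber_empty[OF assms] by blast
  then show ?thesis using False by (simp only: sum.empty if_False)
qed

lemma sum_sols_insert:
  assumes "finite I" "j \<notin> I" "\<forall>i\<in>insert j I. c i > 0"
  shows "(\<Sum>k\<in>sols c (insert j I) n. g (k j) * f (k(j := 0))) =
     (\<Sum>x | c j * x \<le> n. g x * (\<Sum>k\<in>sols c I (n - c j * x). f k :: real))"
proof -
  have fin: "finite (sols c (insert j I) n)" using finite_sols assms by auto
  have finx: "finite {x. c j * x \<le> n}" using finite_mult_le assms by auto
  have "(\<Sum>k\<in>sols c (insert j I) n. g (k j) * f (k(j := 0))) =
     (\<Sum>x | c j * x \<le> n. \<Sum>k | k \<in> sols c (insert j I) n \<and> k j = x. g (k j) * f (k(j := 0)))"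
    by (rule sum.group[OF fin finx, symmetric]) (use sols_coeff_le[of "insert j I"] assms in auto)
  also have "\<dots> = (\<Sum>x | c j * x \<le> n. g x * (\<Sum>k\<in>sols c I (n - c j * x). f k))"
  proof (rule sum.cong)
    fix x assume "x \<in> {x. c j * x \<le> n}"
    have "(\<Sum>k | k \<in> sols c (insert j I) n \<and> k j = x. g (k j) * f (k(j := 0))) = g x * (\<Sum>k | k \<in> sols c (insert j I) n \<and> k j = x. f (k(j := 0)))"
      unfolding sum_distrib_left by (rule sum.cong) auto
    also have "\<dots> = g x * (\<Sum>k\<in>sols c I (n - c j * x). f k)"
      using sum_sols_fiber[where I = "insert j I" and j = j and c = c and n = n and x = x and f = f] assms \<open>x \<in> _\<close> by simp
    finally show "(\<Sum>k | k \<in> sols c (insert j I) n \<and> k j = x. g (k j) * f (k(j := 0))) = g x * (\<Sum>k\<in>sols c I (n - c j * x). f k)" .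
  qed simp
  finally show ?thesis .
qed

lemma wsum_insert:
  assumes "finite I" "j \<notin> I" "\<forall>i\<in>insert j I. c i > 0"
  shows "wsum p c (insert j I) n = (\<Sum>x | c j * x \<le> n. p x * wsum p c I (n - c j * x))"
proof -
  have "(\<Prod>i\<in>insert j I. p (k i)) = p (k j) * (\<Prod>i\<in>I. p ((k(j := 0)) i))" for k
  proof -
    have "(\<Prod>i\<in>I. p ((k(j := 0)) i)) = (\<Prod>i\<in>I. p (k i))" using assms by (intro prod.cong) auto
    then show ?thesis using assms by simp
  qed
  then show ?thesis unfolding wsum_def using sum_sols_insert[OF assms, where n = n and g = p and f = "\<lambda>k. \<Prod>i\<in>I. p (k i)"] by simp
qed

lemma wsum_empty: "wsum p c {} n = (if n = 0 then 1 else 0)"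
proof -
  have "sols c {} n = (if n = 0 then {\<lambda>_. 0} else {})" by (auto simp: sols_def)
  then show ?thesis by (simp add: wsum_def)
qed

lemma wsum_nonneg: "(\<And>n. p n \<ge> 0) \<Longrightarrow> wsum p c I n \<ge> 0"
  unfolding wsum_def by (intro sum_nonneg prod_nonneg) auto

lemma wsum_eq_0:
  assumes "\<not> Gcd (c ` I) dvd n"
  shows "wsum p c I n = 0"
proof -
  have "sols c I n = {}"
  proof (rule ccontr)
    assume "sols c I n \<noteq> {}"
    then obtain k where "(\<Sum>i\<in>I. c i * k i) = n" by (auto simp: sols_def)
    moreover have "Gcd (c ` I) dvd (\<Sum>i\<in>I. c i * k i)"
      by (intro dvd_sum dvd_mult2 Gcd_dvd) auto
    ultimately show False using assms by simp
  qed
  then show ?thesis by (simp add: wsum_def)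
qed

text \<open>This is a Dirichlet integral: the value at 1 of the convolution of the densities
  \<open>c i powr (-\<sigma>) * t powr (\<sigma> - 1)\<close>, each the image of
  \<open>t powr (\<sigma> - 1)\<close> under scaling by \<open>c i\<close>.\<close>

definition dirichlet_const :: "real \<Rightarrow> (nat \<Rightarrow> nat) \<Rightarrow> nat set \<Rightarrow> real" where
  "dirichlet_const \<sigma> c I = (\<Prod>i\<in>I. real (c i) powr (-\<sigma>)) * Gamma \<sigma> ^ card I / Gamma (real (card I) * \<sigma>)"

text \<open>Induction on the set of variables, each new one being a weighted convolution. A single
  variable contributes \<open>p (m div c j) / p m\<close>, whose limit
  \<open>c j powr (1 - \<sigma>)\<close> is the gcd \<open>c j\<close> times the constant
  \<open>c j powr (-\<sigma>)\<close>.\<close>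

lemma wsum_asymptotics:
  assumes p: "rv_seq p (\<sigma> - 1)" and \<sigma>: "0 < \<sigma>" "\<sigma> \<le> 1" and I: "finite I" "I \<noteq> {}" "\<forall>i\<in>I. c i > 0"
  shows "(\<lambda>m. wsum p c I m / (real (Suc m) ^ (card I - 1) * p m ^ card I)
           - (if Gcd (c ` I) dvd m then real (Gcd (c ` I)) * dirichlet_const \<sigma> c I else 0)) \<longlonglongrightarrow> 0"
  using I
proof (induction rule: finite_ne_induct)
  case (singleton j)
  have cj: "c j > 0" using singleton by simp
  have w: "wsum p c {j} m = (if c j dvd m then p (m div c j) else 0)" for m
  proof -
    have "wsum p c {j} m = (\<Sum>x | c j * x \<le> m. p x * (if m - c j * x = 0 then 1 else 0))"
      using wsum_insert[of "{}" j c p m] singleton by (simp add: wsum_empty)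
    also have "\<dots> = (\<Sum>x | c j * x \<le> m. if c j * x = m then p x else 0)"
      by (rule sum.cong) auto
    also have "\<dots> = (\<Sum>x \<in> {x. c j * x \<le> m} \<inter> {x. c j * x = m}. p x)"
      by (rule sum.inter_restrict[OF finite_mult_le[OF cj], symmetric, where B = "{x. c j * x = m}", simplified])
    also have "{x. c j * x \<le> m} \<inter> {x. c j * x = m} = (if c j dvd m then {m div c j} else {})"
      using cj by (auto simp: dvd_def)
    finally show ?thesis by simp
  qed
  have "(\<lambda>m. real (m div c j) / real m) \<longlonglongrightarrow> 1 / real (c j)"
  proof (rule tendsto_sandwich)
    have "(\<lambda>m. (real m * r - 1) / real m) \<longlonglongrightarrow> r" for r by real_asymp
    from this[of "1 / real (c j)"] show "(\<lambda>m. (real m / real (c j) - 1) / real m) \<longlonglongrightarrow> 1 / real (c j)" by simp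
    have le: "real (m div c j) \<le> real m / real (c j)" "real m / real (c j) - 1 \<le> real (m div c j)" for m
    proof -
      have "real (m div c j) = of_int \<lfloor>real m / real (c j)\<rfloor>" by (simp add: floor_divide_of_nat_eq)
      then show "real (m div c j) \<le> real m / real (c j)" "real m / real (c j) - 1 \<le> real (m div c j)" by linarith+
    qed
    show "\<forall>\<^sub>F m in sequentially. (real m / real (c j) - 1) / real m \<le> real (m div c j) / real m"
      by (intro always_eventually allI divide_right_mono le) auto
    show "\<forall>\<^sub>F m in sequentially. real (m div c j) / real m \<le> 1 / real (c j)"
    proof (intro always_eventually allI)
      show "real (m div c j) / real m \<le> 1 / real (c j)" for m
        using divide_right_mono[OF le(1)[of m], of "real m"] by (cases "m = 0") auto
    qed
  qed auto
  then have "(\<lambda>m. p (m div c j) / p m) \<longlonglongrightarrow> (1 / real (c j)) powr (\<sigma> - 1)"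
    by (rule rv_seq_tendsto[OF p]) (use cj in auto)
  moreover have "(1 / real (c j)) powr (\<sigma> - 1) = real (c j) * real (c j) powr (-\<sigma>)"
    using cj by (simp add: powr_divide powr_diff powr_minus field_simps)
  ultimately have 0: "(\<lambda>m. p (m div c j) / p m - real (c j) * real (c j) powr (-\<sigma>)) \<longlonglongrightarrow> 0"
    using LIM_zero by metis
  have D: "dirichlet_const \<sigma> c {j} = real (c j) powr (-\<sigma>)"
    using \<sigma> by (simp add: dirichlet_const_def Gamma_real_pos less_imp_neq[symmetric])
  show ?case
  proof (rule Lim_null_comparison[OF _ tendsto_norm_zero[OF 0]], rule always_eventually, rule allI)
    fix m
    show "norm (wsum p c {j} m / (real (Suc m) ^ (card {j} - 1) * p m ^ card {j}) - (if Gcd (c ` {j}) dvd m then real (Gcd (c ` {j})) * dirichlet_const \<sigma> c {j} else 0)) \<le> norm (p (m div c j) / p m - real (c j) * real (c j) powr (-\<sigma>))"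
      by (simp add: w D)
  qed
next
  case (insert j I)
  note ppos = rv_seq_pos[OF p]
  define d where "d = Gcd (c ` I)"
  define l where "l = card I"
  have cj: "c j > 0" using insert by simp
  have d: "d > 0"
  proof -
    obtain i where "i \<in> I" using insert by blast
    then have "d dvd c i" "c i > 0" unfolding d_def using insert by auto
    then show ?thesis by (metis dvd_0_left_iff gr0I)
  qed
  have l: "l \<ge> 1" unfolding l_def using insert by (simp add: Suc_leI card_gt_0_iff)
  have IH: "(\<lambda>m. wsum p c I m / (real (Suc m) ^ (l - 1) * p m ^ l) - (if d dvd m then real d * dirichlet_const \<sigma> c I else 0)) \<longlonglongrightarrow> 0"
    unfolding d_def l_def using insert by auto
  have A: "(\<lambda>m. (\<Sum>x | c j * x \<le> m. p x * wsum p c I (m - c j * x)) / (real (Suc m) ^ l * p m ^ (Suc l))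
           - (if gcd d (c j) dvd m then real (gcd d (c j)) * (dirichlet_const \<sigma> c I * real (c j) powr (-\<sigma>) * Beta \<sigma> (real l * \<sigma>)) else 0)) \<longlonglongrightarrow> 0"
    by (rule weighted_convolution_asymptotics[OF p \<sigma> l d cj _ _ IH])
       (auto simp: d_def intro!: wsum_nonneg wsum_eq_0 less_imp_le[OF ppos])
  have E1: "(\<Sum>x | c j * x \<le> m. p x * wsum p c I (m - c j * x)) = wsum p c (insert j I) m" for m
    using wsum_insert[of I j c p m] insert by simp
  have E2: "Gcd (c ` insert j I) = gcd d (c j)" unfolding d_def by (simp add: gcd.commute)
  \<comment> \<open>The Gamma factors telescope: \<open>Beta \<sigma> (l * \<sigma>)\<close> cancels
    \<open>Gamma (l * \<sigma>)\<close> and supplies the next denominator.\<close>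
  have E3: "dirichlet_const \<sigma> c I * real (c j) powr (-\<sigma>) * Beta \<sigma> (real l * \<sigma>) = dirichlet_const \<sigma> c (insert j I)"
  proof -
    have "Gamma (real l * \<sigma>) > 0" using l \<sigma> by (intro Gamma_real_pos) auto
    moreover have "real (Suc l) * \<sigma> = \<sigma> + real l * \<sigma>" by (simp add: algebra_simps)
    ultimately show ?thesis using insert
      by (simp add: dirichlet_const_def Beta_def l_def[symmetric] algebra_simps)
  qed
  have E4: "card (insert j I) = Suc l" unfolding l_def using insert by simp
  show ?case using A by (simp only: E1 E2 E3 E4 diff_Suc_1)
qed

text \<open>The convergent difference is bounded at every \<open>m\<close>, small ones included,
  which is the uniformity that union bounds over all targets require.\<close>

lemma wsum_upper:
  assumes p: "rv_seq p (\<sigma> - 1)" and \<sigma>: "0 < \<sigma>" "\<sigma> \<le> 1" and I: "finite I" "I \<noteq> {}" "\<forall>i\<in>I. c i > 0"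
  shows "\<exists>C>0. \<forall>m. wsum p c I m \<le> C * (real (Suc m) ^ (card I - 1) * p m ^ card I)"
proof -
  define D where "D = real (Gcd (c ` I)) * dirichlet_const \<sigma> c I"
  define P where "P m = real (Suc m) ^ (card I - 1) * p m ^ card I" for m
  have Ppos: "P m > 0" for m unfolding P_def using rv_seq_pos[OF p] by simp
  have "Bseq (\<lambda>m. wsum p c I m / P m - (if Gcd (c ` I) dvd m then D else 0))"
    using wsum_asymptotics[OF assms] unfolding P_def D_def by (intro convergent_imp_Bseq) (auto simp: convergent_def)
  then obtain K where K: "\<And>m. \<bar>wsum p c I m / P m - (if Gcd (c ` I) dvd m then D else 0)\<bar> \<le> K" "K > 0"
    by (auto simp: Bseq_def)
  have "wsum p c I m \<le> (K + \<bar>D\<bar>) * P m" for m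
  proof -
    have "(if Gcd (c ` I) dvd m then D else 0) \<le> \<bar>D\<bar>" by (auto simp: abs_ge_self)
    then have "wsum p c I m / P m \<le> K + \<bar>D\<bar>" using abs_le_D1[OF K(1)[of m]] by linarith
    then show ?thesis using Ppos[of m] by (simp add: field_simps)
  qed
  then show ?thesis using K(2) unfolding P_def by (intro exI[of _ "K + \<bar>D\<bar>"]) auto
qed

subsection \<open>Tail bounds for monomials in a random set\<close>

text \<open>A random subset of the finite set \<open>U\<close> contains each \<open>i\<close> independently with probability \<open>p i\<close>.\<close>
definition bern_wt :: "(nat \<Rightarrow> real) \<Rightarrow> nat set \<Rightarrow> nat set \<Rightarrow> real" where
  "bern_wt p U A = (\<Prod>i\<in>A. p i) * (\<Prod>i\<in>U - A. 1 - p i)"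

definition expect :: "(nat \<Rightarrow> real) \<Rightarrow> nat set \<Rightarrow> (nat set \<Rightarrow> real) \<Rightarrow> real" where
  "expect p U f = (\<Sum>A\<in>Pow U. bern_wt p U A * f A)"

definition Pr :: "(nat \<Rightarrow> real) \<Rightarrow> nat set \<Rightarrow> (nat set \<Rightarrow> bool) \<Rightarrow> real" where
  "Pr p U E = expect p U (\<lambda>A. of_bool (E A))"

lemma expect_insert:
  assumes "finite U" "i \<notin> U"
  shows "expect p (insert i U) f = p i * expect p U (\<lambda>A. f (insert i A)) + (1 - p i) * expect p U f"
proof -
  have inj: "inj_on (insert i) (Pow U)" using assms by (auto simp: inj_on_def)
  have w1: "bern_wt p (insert i U) (insert i A) = p i * bern_wt p U A" if "A \<in> Pow U" for A
  proof -
    have "insert i U - insert i A = U - A" "i \<notin> A" "finite A" using assms that by (auto intro: finite_subset)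
    then show ?thesis by (simp add: bern_wt_def)
  qed
  have w2: "bern_wt p (insert i U) A = (1 - p i) * bern_wt p U A" if "A \<in> Pow U" for A
  proof -
    have "insert i U - A = insert i (U - A)" "i \<notin> U - A" "finite (U - A)" using assms that by auto
    then show ?thesis by (simp add: bern_wt_def)
  qed
  have "expect p (insert i U) f = (\<Sum>A\<in>Pow U. bern_wt p (insert i U) A * f A) + (\<Sum>A\<in>insert i ` Pow U. bern_wt p (insert i U) A * f A)"
    unfolding expect_def Pow_insert by (rule sum.union_disjoint) (use assms in auto)
  also have "(\<Sum>A\<in>insert i ` Pow U. bern_wt p (insert i U) A * f A) = p i * expect p U (\<lambda>A. f (insert i A))"
    unfolding expect_def sum_distrib_left sum.reindex[OF inj] by (rule sum.cong) (auto simp: w1)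
  also have "(\<Sum>A\<in>Pow U. bern_wt p (insert i U) A * f A) = (1 - p i) * expect p U f"
    unfolding expect_def sum_distrib_left by (rule sum.cong) (auto simp: w2)
  finally show ?thesis by simp
qed

lemma expect_const: "finite U \<Longrightarrow> expect p U (\<lambda>_. c) = c"
proof (induction U rule: finite_induct)
  case empty
  then show ?case by (simp add: expect_def bern_wt_def)
next
  case (insert i U)
  then show ?case by (simp add: expect_insert algebra_simps)
qed

lemma expect_sum: "expect p U (\<lambda>A. \<Sum>x\<in>X. f x A) = (\<Sum>x\<in>X. expect p U (f x))"
  unfolding expect_def sum_distrib_left by (rule sum.swap)

lemma expect_cmult: "expect p U (\<lambda>A. c * f A) = c * expect p U f"
  unfolding expect_def sum_distrib_left by (simp add: mult_ac)

lemma expect_diff: "expect p U (\<lambda>A. f A - g A) = expect p U f - expect p U g"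
  unfolding expect_def by (simp add: right_diff_distrib sum_subtractf)

lemma bern_wt_nonneg:
  assumes "\<And>i. 0 \<le> p i" "\<And>i. p i \<le> 1"
  shows "bern_wt p U A \<ge> 0"
  unfolding bern_wt_def using assms by (intro mult_nonneg_nonneg prod_nonneg) auto

lemma expect_mono:
  assumes "\<And>i. 0 \<le> p i" "\<And>i. p i \<le> 1" "\<And>A. A \<subseteq> U \<Longrightarrow> f A \<le> g A"
  shows "expect p U f \<le> expect p U g"
  unfolding expect_def by (intro sum_mono mult_left_mono bern_wt_nonneg assms) auto

lemma expect_cong: "(\<And>A. A \<subseteq> U \<Longrightarrow> f A = g A) \<Longrightarrow> expect p U f = expect p U g"
  unfolding expect_def by (intro sum.cong) auto

lemma expect_single:
  assumes "finite U" "i \<in> U"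
  shows "expect p U (\<lambda>A. if i \<in> A then g A else 0) = p i * expect p U (\<lambda>A. g (insert i A))"
proof -
  define V where "V = U - {i}"
  have U: "U = insert i V" "i \<notin> V" "finite V" using assms by (auto simp: V_def)
  have "expect p V (\<lambda>A. if i \<in> A then g A else 0) = expect p V (\<lambda>A. 0)"
    by (rule expect_cong) (use U in auto)
  then show ?thesis unfolding U(1) expect_insert[OF U(3,2)]
    using expect_const[OF U(3)] by (simp add: algebra_simps)
qed

text \<open>By independence, conditioning on \<open>S \<subseteq> A\<close> means forcing
  \<open>S\<close> into an otherwise unchanged random set. Both tail bounds rest on this
  identity.\<close>

lemma expect_superset:
  assumes "finite U" "S \<subseteq> U"
  shows "expect p U (\<lambda>A. if S \<subseteq> A then g A else 0) = (\<Prod>i\<in>S. p i) * expect p U (\<lambda>A. g (A \<union> S))"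
proof -
  have "finite S" using assms finite_subset by blast
  then show ?thesis using assms(2)
  proof (induction S arbitrary: g rule: finite_induct)
    case (insert i S)
    have "expect p U (\<lambda>A. if insert i S \<subseteq> A then g A else 0) = expect p U (\<lambda>A. if S \<subseteq> A then (if i \<in> A then g A else 0) else 0)"
      by (rule expect_cong) auto
    also have "\<dots> = (\<Prod>i\<in>S. p i) * expect p U (\<lambda>A. if i \<in> A \<union> S then g (A \<union> S) else 0)"
      using insert by simp
    also have "expect p U (\<lambda>A. if i \<in> A \<union> S then g (A \<union> S) else 0) = expect p U (\<lambda>A. if i \<in> A then g (A \<union> S) else 0)"
      by (rule expect_cong) (use insert in auto)
    also have "\<dots> = p i * expect p U (\<lambda>A. g (insert i A \<union> S))"
      by (rule expect_single) (use insert assms in auto)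
    finally show ?case using insert by (simp add: mult_ac)
  qed simp
qed

lemma Pr_mono:
  assumes "\<And>i. 0 \<le> p i" "\<And>i. p i \<le> 1" "\<And>A. A \<subseteq> U \<Longrightarrow> E A \<Longrightarrow> E' A"
  shows "Pr p U E \<le> Pr p U E'"
  unfolding Pr_def by (rule expect_mono[OF assms(1,2)]) (use assms(3) in auto)

lemma Pr_disj:
  assumes "\<And>i. 0 \<le> p i" "\<And>i. p i \<le> 1"
  shows "Pr p U (\<lambda>A. E A \<or> E' A) \<le> Pr p U E + Pr p U E'"
proof -
  have "Pr p U (\<lambda>A. E A \<or> E' A) \<le> expect p U (\<lambda>A. \<Sum>b\<in>UNIV. of_bool (if b then E A else E' A))"
    unfolding Pr_def by (rule expect_mono[OF assms]) (auto simp: UNIV_bool)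
  also have "\<dots> = Pr p U E + Pr p U E'"
    unfolding expect_sum Pr_def by (simp add: UNIV_bool)
  finally show ?thesis .
qed

lemma Pr_UN:
  assumes "\<And>i. 0 \<le> p i" "\<And>i. p i \<le> 1" "finite X"
  shows "Pr p U (\<lambda>A. \<exists>x\<in>X. E x A) \<le> (\<Sum>x\<in>X. Pr p U (E x))"
proof -
  have "Pr p U (\<lambda>A. \<exists>x\<in>X. E x A) \<le> expect p U (\<lambda>A. \<Sum>x\<in>X. of_bool (E x A))"
    unfolding Pr_def
  proof (rule expect_mono[OF assms(1,2)])
    fix A
    show "of_bool (\<exists>x\<in>X. E x A) \<le> (\<Sum>x\<in>X. of_bool (E x A) :: real)"
    proof (cases "\<exists>x\<in>X. E x A")
      case True
      then obtain x where "x \<in> X" "E x A" by blast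
      then have "of_bool (E x A) \<le> (\<Sum>x\<in>X. of_bool (E x A) :: real)" by (intro member_le_sum assms) auto
      then show ?thesis using \<open>E x A\<close> True by simp
    qed (simp add: sum_nonneg)
  qed
  then show ?thesis unfolding expect_sum Pr_def .
qed

lemma Pr_less_1_ex:
  assumes "\<And>i. 0 \<le> p i" "\<And>i. p i \<le> 1" "finite U" "Pr p U E < 1"
  shows "\<exists>A\<subseteq>U. \<not> E A"
proof (rule ccontr)
  assume "\<not> ?thesis"
  then have "Pr p U E = expect p U (\<lambda>_. 1)" unfolding Pr_def by (intro expect_cong) auto
  then show False using expect_const[OF assms(3)] assms(4) by simp
qed

section \<open>Upper and lower tails for families of monomials\<close>

text \<open>Supports are given by a map on an index type, not as a set of sets: distinct solutions,
  such as permuted tuples, can have the same support and have to be counted separately.\<close>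

locale bernoulli_family =
  fixes p :: "nat \<Rightarrow> real" and U :: "nat set" and S :: "'a set" and supp :: "'a \<Rightarrow> nat set"
  assumes p0: "0 \<le> p i" and p1: "p i \<le> 1" and finU: "finite U" and finS: "finite S"
    and supp: "\<alpha> \<in> S \<Longrightarrow> supp \<alpha> \<subseteq> U"
begin

definition occ :: "nat set \<Rightarrow> 'a set" where "occ A = {\<alpha> \<in> S. supp \<alpha> \<subseteq> A}"

definition wt :: "'a \<Rightarrow> real" where "wt \<alpha> = (\<Prod>i\<in>supp \<alpha>. p i)"

definition \<mu> :: real where "\<mu> = (\<Sum>\<alpha>\<in>S. wt \<alpha>)"

lemma finite_occ: "finite (occ A)"
  using finS by (simp add: occ_def)

lemma wt_nonneg: "wt \<alpha> \<ge> 0"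
  unfolding wt_def using p0 by (intro prod_nonneg) auto

lemma \<mu>_nonneg: "\<mu> \<ge> 0"
  unfolding \<mu>_def by (intro sum_nonneg wt_nonneg)

text \<open>The number of ordered \<open>m\<close>-tuples of occurring members whose supports are pairwise disjoint and
  disjoint from \<open>V\<close>.\<close>
primrec chains :: "nat \<Rightarrow> nat set \<Rightarrow> nat set \<Rightarrow> real" where
  "chains 0 = (\<lambda>V A. 1)"
| "chains (Suc m) = (\<lambda>V A. \<Sum>\<alpha>\<in>S. if supp \<alpha> \<inter> V = {} \<and> supp \<alpha> \<subseteq> A then chains m (V \<union> supp \<alpha>) A else 0)"

text \<open>Members that avoid \<open>W\<close> do not notice points added inside \<open>W\<close>;
  this removes the conditioning on members already chosen.\<close>

lemma chains_Un: "T \<subseteq> W \<Longrightarrow> chains m W (A \<union> T) = chains m W A"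
proof (induction m arbitrary: W)
  case (Suc m)
  have a: "chains m (W \<union> supp \<alpha>) (A \<union> T) = chains m (W \<union> supp \<alpha>) A" for \<alpha> using Suc by blast
  have b: "(supp \<alpha> \<inter> W = {} \<and> supp \<alpha> \<subseteq> A \<union> T) = (supp \<alpha> \<inter> W = {} \<and> supp \<alpha> \<subseteq> A)" for \<alpha> using Suc.prems by blast
  show ?case by (simp only: chains.simps a b cong: if_cong)
qed simp

lemma chains_nonneg: "chains m V A \<ge> 0"
  by (induction m arbitrary: V) (auto intro!: sum_nonneg)

text \<open>Disjoint supports make the chosen members independent. Pulling out one member yields its
  weight times the expected number of shorter chains that avoid its support.\<close>

lemma expect_chains: "expect p U (chains m V) \<le> \<mu> ^ m"
proof (induction m arbitrary: V)
  case 0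
  then show ?case using expect_const[OF finU] by simp
next
  case (Suc m)
  have "expect p U (chains (Suc m) V) = (\<Sum>\<alpha>\<in>S. expect p U (\<lambda>A. if supp \<alpha> \<inter> V = {} \<and> supp \<alpha> \<subseteq> A then chains m (V \<union> supp \<alpha>) A else 0))"
    by (simp add: expect_sum)
  also have "\<dots> \<le> (\<Sum>\<alpha>\<in>S. wt \<alpha> * \<mu> ^ m)"
  proof (rule sum_mono)
    fix \<alpha> assume \<alpha>: "\<alpha> \<in> S"
    show "expect p U (\<lambda>A. if supp \<alpha> \<inter> V = {} \<and> supp \<alpha> \<subseteq> A then chains m (V \<union> supp \<alpha>) A else 0) \<le> wt \<alpha> * \<mu> ^ m"
    proof (cases "supp \<alpha> \<inter> V = {}")
      case True
      have "expect p U (\<lambda>A. if supp \<alpha> \<inter> V = {} \<and> supp \<alpha> \<subseteq> A then chains m (V \<union> supp \<alpha>) A else 0)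
          = expect p U (\<lambda>A. if supp \<alpha> \<subseteq> A then chains m (V \<union> supp \<alpha>) A else 0)"
        by (rule expect_cong) (use True in auto)
      also have "\<dots> = wt \<alpha> * expect p U (\<lambda>A. chains m (V \<union> supp \<alpha>) (A \<union> supp \<alpha>))"
        unfolding wt_def by (rule expect_superset[OF finU supp[OF \<alpha>]])
      also have "\<dots> = wt \<alpha> * expect p U (chains m (V \<union> supp \<alpha>))" by (simp add: chains_Un)
      also have "\<dots> \<le> wt \<alpha> * \<mu> ^ m" by (intro mult_left_mono Suc.IH wt_nonneg)
      finally show ?thesis .
    next
      case False
      have "expect p U (\<lambda>A. if supp \<alpha> \<inter> V = {} \<and> supp \<alpha> \<subseteq> A then chains m (V \<union> supp \<alpha>) A else 0) = expect p U (\<lambda>_. 0)"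
        by (rule expect_cong) (use False in auto)
      then show ?thesis using expect_const[OF finU] wt_nonneg \<mu>_nonneg by simp
    qed
  qed
  also have "\<dots> = \<mu> ^ Suc m" by (simp add: \<mu>_def sum_distrib_right)
  finally show ?case .
qed

definition sparse :: "real \<Rightarrow> nat set \<Rightarrow> bool" where
  "sparse D A \<longleftrightarrow> (\<forall>\<alpha>\<in>occ A. real (card {\<beta> \<in> occ A. supp \<beta> \<inter> supp \<alpha> \<noteq> {}}) \<le> D)"

text \<open>Greedy selection: \<open>j\<close> earlier choices block at most \<open>j * D\<close>
  occurring members, so at least \<open>y\<close> remain at each of the \<open>m\<close> stages. The
  set \<open>V\<close> and the number \<open>j\<close> vary in the induction to record what is
  blocked.\<close>

lemma chains_lower:
  assumes "sparse D A" "real (card (occ A)) \<ge> z" "D \<ge> 0" "y \<ge> 0"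
    and "real (card {\<beta> \<in> occ A. supp \<beta> \<inter> V \<noteq> {}}) \<le> real j * D" "z \<ge> real (j + m) * D + y"
  shows "chains m V A \<ge> y ^ m"
  using assms(5,6)
proof (induction m arbitrary: V j)
  case (Suc m)
  define G where "G = {\<alpha> \<in> occ A. supp \<alpha> \<inter> V = {}}"
  have "y ^ m \<le> chains m (V \<union> supp \<alpha>) A" if "\<alpha> \<in> G" for \<alpha>
  proof (rule Suc.IH[of _ "Suc j"])
    have \<alpha>: "\<alpha> \<in> occ A" using that by (simp add: G_def)
    have "{\<beta> \<in> occ A. supp \<beta> \<inter> (V \<union> supp \<alpha>) \<noteq> {}} \<subseteq> {\<beta> \<in> occ A. supp \<beta> \<inter> V \<noteq> {}} \<union> {\<beta> \<in> occ A. supp \<beta> \<inter> supp \<alpha> \<noteq> {}}" by blast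
    then have "card {\<beta> \<in> occ A. supp \<beta> \<inter> (V \<union> supp \<alpha>) \<noteq> {}} \<le> card {\<beta> \<in> occ A. supp \<beta> \<inter> V \<noteq> {}} + card {\<beta> \<in> occ A. supp \<beta> \<inter> supp \<alpha> \<noteq> {}}"
      using finite_occ by (intro order_trans[OF card_mono card_Un_le]) auto
    moreover have "real (card {\<beta> \<in> occ A. supp \<beta> \<inter> supp \<alpha> \<noteq> {}}) \<le> D" using assms(1) \<alpha> by (auto simp: sparse_def)
    ultimately show "real (card {\<beta> \<in> occ A. supp \<beta> \<inter> (V \<union> supp \<alpha>) \<noteq> {}}) \<le> real (Suc j) * D"
      using Suc.prems(1) by (simp add: algebra_simps)
    show "z \<ge> real (Suc j + m) * D + y" using Suc.prems(2) by simp
  qed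
  then have "real (card G) * y ^ m \<le> (\<Sum>\<alpha>\<in>G. chains m (V \<union> supp \<alpha>) A)"
    using sum_bounded_below[of G "y ^ m"] by simp
  also have "\<dots> = chains (Suc m) V A"
  proof -
    have "G = {\<alpha>\<in>S. supp \<alpha> \<inter> V = {} \<and> supp \<alpha> \<subseteq> A}" by (auto simp: G_def occ_def)
    then show ?thesis by (simp add: sum.inter_filter[OF finS])
  qed
  finally have 1: "real (card G) * y ^ m \<le> chains (Suc m) V A" .
  have "occ A = G \<union> {\<beta> \<in> occ A. supp \<beta> \<inter> V \<noteq> {}}" by (auto simp: G_def)
  then have "card (occ A) \<le> card G + card {\<beta> \<in> occ A. supp \<beta> \<inter> V \<noteq> {}}" by (metis card_Un_le)
  then have "z \<le> real (card G) + real j * D" using assms(2) Suc.prems(1) by linarith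
  moreover have "z \<ge> real j * D + y"
  proof -
    have "real (j + Suc m) * D = real j * D + real (Suc m) * D" by (simp add: algebra_simps)
    moreover have "real (Suc m) * D \<ge> 0" using assms(3) by simp
    ultimately show ?thesis using Suc.prems(2) by linarith
  qed
  ultimately have "y \<le> real (card G)" by linarith
  then have "y * y ^ m \<le> real (card G) * y ^ m" using assms(4) by (intro mult_right_mono) auto
  then show ?case using 1 by simp
qed simp

text \<open>Markov's inequality for disjoint ordered \<open>M\<close>-tuples: on the event there are
  at least \<open>y ^ M\<close> of them, and their mean is at most \<open>\<mu> ^ M\<close>.\<close>

lemma upper_tail:
  assumes "y > 0" "D \<ge> 0" "z \<ge> real M * D + y"
  shows "Pr p U (\<lambda>A. sparse D A \<and> z \<le> real (card (occ A))) \<le> (\<mu> / y) ^ M"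
proof -
  have "y ^ M * Pr p U (\<lambda>A. sparse D A \<and> z \<le> real (card (occ A))) = expect p U (\<lambda>A. y ^ M * of_bool (sparse D A \<and> z \<le> real (card (occ A))))"
    by (simp add: Pr_def expect_cmult)
  also have "\<dots> \<le> expect p U (chains M {})"
  proof (rule expect_mono[OF p0 p1])
    fix A
    show "y ^ M * of_bool (sparse D A \<and> z \<le> real (card (occ A))) \<le> chains M {} A"
      using chains_lower[of D A z y "{}" 0 M] assms chains_nonneg[of M "{}" A] by (auto simp: of_bool_def)
  qed
  also have "\<dots> \<le> \<mu> ^ M" by (rule expect_chains)
  finally show ?thesis using assms(1) by (simp add: power_divide field_simps)
qed

definition phi :: "real \<Rightarrow> real" where
  "phi t = expect p U (\<lambda>A. exp (- t * real (card (occ A))))"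

lemma phi_nonneg: "phi t \<ge> 0"
proof -
  have "expect p U (\<lambda>_. 0) \<le> phi t" unfolding phi_def by (rule expect_mono[OF p0 p1]) auto
  then show ?thesis by (simp add: expect_const[OF finU])
qed

text \<open>Janson's inequality for monomials needs no correlation inequality: conditioning on
  \<open>supp \<alpha> \<subseteq> A\<close> amounts to replacing \<open>A\<close> by \<open>A \<union> supp \<alpha>\<close>.\<close>
lemma tilted_expectation_lower:
  assumes t: "t \<ge> 0" and \<alpha>: "\<alpha> \<in> S"
  shows "expect p U (\<lambda>A. if supp \<alpha> \<subseteq> A then exp (- t * real (card (occ A))) else 0)
    \<ge> (wt \<alpha> - t * (\<Sum>\<beta> | \<beta> \<in> S \<and> supp \<beta> \<inter> supp \<alpha> \<noteq> {}. \<Prod>i\<in>supp \<alpha> \<union> supp \<beta>. p i)) * phi t"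
proof -
  define N where "N = {\<beta>\<in>S. supp \<beta> \<inter> supp \<alpha> \<noteq> {}}"
  \<comment> \<open>The part of the count that does not depend on whether
    \<open>supp \<alpha>\<close> lies in \<open>A\<close>; the overlapping members in
    \<open>N\<close> are what remains.\<close>
  define Y where "Y A = card {\<beta>\<in>occ A. supp \<beta> \<inter> supp \<alpha> = {}}" for A
  define \<Delta> where "\<Delta> = (\<Sum>\<beta>\<in>N. \<Prod>i\<in>supp \<alpha> \<union> supp \<beta>. p i)"
  define E where "E = expect p U (\<lambda>A. exp (- t * real (Y A)))"
  have finN: "finite N" using finS by (simp add: N_def)
  have Xsplit: "real (card (occ A)) = real (Y A) + (\<Sum>\<beta>\<in>N. of_bool (supp \<beta> \<subseteq> A))" for A
  proof -
    have "occ A = {\<beta>\<in>occ A. supp \<beta> \<inter> supp \<alpha> = {}} \<union> {\<beta>\<in>N. supp \<beta> \<subseteq> A}" by (auto simp: occ_def N_def)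
    moreover have "card ({\<beta>\<in>occ A. supp \<beta> \<inter> supp \<alpha> = {}} \<union> {\<beta>\<in>N. supp \<beta> \<subseteq> A}) = Y A + card {\<beta>\<in>N. supp \<beta> \<subseteq> A}"
      unfolding Y_def by (rule card_Un_disjoint) (use finite_occ finS in \<open>auto simp: N_def\<close>)
    moreover have "real (card {\<beta>\<in>N. supp \<beta> \<subseteq> A}) = (\<Sum>\<beta>\<in>N. of_bool (supp \<beta> \<subseteq> A))"
      using finN by (simp add: of_bool_def sum.If_cases Int_def)
    ultimately show ?thesis by simp
  qed
  have Ymono: "Y A \<le> Y B" if "A \<subseteq> B" for A B
    unfolding Y_def by (rule card_mono) (use finS that in \<open>auto simp: occ_def\<close>)
  have YUn: "Y (A \<union> supp \<alpha>) = Y A" for A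
    unfolding Y_def by (rule arg_cong[where f = card]) (auto simp: occ_def)
  have "wt \<alpha> * E - t * (\<Sum>\<beta>\<in>N. (\<Prod>i\<in>supp \<alpha> \<union> supp \<beta>. p i) * E) \<le> expect p U (\<lambda>A. if supp \<alpha> \<subseteq> A then exp (- t * real (Y A)) else 0)
      - t * (\<Sum>\<beta>\<in>N. expect p U (\<lambda>A. if supp \<alpha> \<union> supp \<beta> \<subseteq> A then exp (- t * real (Y A)) else 0))"
  proof (rule diff_mono)
    have "expect p U (\<lambda>A. if supp \<alpha> \<subseteq> A then exp (- t * real (Y A)) else 0) = wt \<alpha> * E"
      unfolding wt_def E_def using expect_superset[OF finU supp[OF \<alpha>], of p "\<lambda>A. exp (- t * real (Y A))"] by (simp add: YUn)
    then show "wt \<alpha> * E \<le> expect p U (\<lambda>A. if supp \<alpha> \<subseteq> A then exp (- t * real (Y A)) else 0)" by simp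
    show "t * (\<Sum>\<beta>\<in>N. expect p U (\<lambda>A. if supp \<alpha> \<union> supp \<beta> \<subseteq> A then exp (- t * real (Y A)) else 0))
       \<le> t * (\<Sum>\<beta>\<in>N. (\<Prod>i\<in>supp \<alpha> \<union> supp \<beta>. p i) * E)"
    proof (intro mult_left_mono sum_mono t)
      fix \<beta> assume "\<beta> \<in> N"
      then have sub: "supp \<alpha> \<union> supp \<beta> \<subseteq> U" using supp \<alpha> by (auto simp: N_def)
      have "expect p U (\<lambda>A. if supp \<alpha> \<union> supp \<beta> \<subseteq> A then exp (- t * real (Y A)) else 0)
          = (\<Prod>i\<in>supp \<alpha> \<union> supp \<beta>. p i) * expect p U (\<lambda>A. exp (- t * real (Y (A \<union> (supp \<alpha> \<union> supp \<beta>)))))"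
        by (rule expect_superset[OF finU sub])
      also have "\<dots> \<le> (\<Prod>i\<in>supp \<alpha> \<union> supp \<beta>. p i) * E"
        unfolding E_def
      proof (intro mult_left_mono expect_mono[OF p0 p1] prod_nonneg)
        fix A
        have "real (Y A) \<le> real (Y (A \<union> (supp \<alpha> \<union> supp \<beta>)))" using Ymono[of A "A \<union> (supp \<alpha> \<union> supp \<beta>)"] by simp
        then show "exp (- t * real (Y (A \<union> (supp \<alpha> \<union> supp \<beta>)))) \<le> exp (- t * real (Y A))"
          using t by (simp add: mult_left_mono)
      qed (use p0 in auto)
      finally show "expect p U (\<lambda>A. if supp \<alpha> \<union> supp \<beta> \<subseteq> A then exp (- t * real (Y A)) else 0) \<le> (\<Prod>i\<in>supp \<alpha> \<union> supp \<beta>. p i) * E" .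
    qed
  qed
  also have "\<dots> = expect p U (\<lambda>A. (if supp \<alpha> \<subseteq> A then exp (- t * real (Y A)) else 0) - t * (\<Sum>\<beta>\<in>N. if supp \<alpha> \<union> supp \<beta> \<subseteq> A then exp (- t * real (Y A)) else 0))"
    by (simp only: expect_diff expect_cmult expect_sum)
  also have "\<dots> \<le> expect p U (\<lambda>A. if supp \<alpha> \<subseteq> A then exp (- t * real (card (occ A))) else 0)"
  proof (rule expect_mono[OF p0 p1])
    fix A
    show "(if supp \<alpha> \<subseteq> A then exp (- t * real (Y A)) else 0) - t * (\<Sum>\<beta>\<in>N. if supp \<alpha> \<union> supp \<beta> \<subseteq> A then exp (- t * real (Y A)) else 0)
       \<le> (if supp \<alpha> \<subseteq> A then exp (- t * real (card (occ A))) else 0)"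
    proof (cases "supp \<alpha> \<subseteq> A")
      case True
      define Z where "Z = (\<Sum>\<beta>\<in>N. of_bool (supp \<beta> \<subseteq> A) :: real)"
      have "(\<Sum>\<beta>\<in>N. if supp \<alpha> \<union> supp \<beta> \<subseteq> A then exp (- t * real (Y A)) else 0) = Z * exp (- t * real (Y A))"
        unfolding Z_def sum_distrib_right by (rule sum.cong) (use True in auto)
      then have "exp (- t * real (Y A)) - t * (\<Sum>\<beta>\<in>N. if supp \<alpha> \<union> supp \<beta> \<subseteq> A then exp (- t * real (Y A)) else 0) = exp (- t * real (Y A)) * (1 + (- t * Z))"
        by (simp add: algebra_simps)
      \<comment> \<open>The bound \<open>1 + x \<le> exp x\<close> makes the overlap contribution
        linear, so its expectation splits into the pair weights that form
        \<open>\<Delta>\<close>.\<close>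
      also have "\<dots> \<le> exp (- t * real (Y A)) * exp (- t * Z)" by (intro mult_left_mono exp_ge_add_one_self) auto
      also have "\<dots> = exp (- t * real (card (occ A)))" unfolding exp_add[symmetric] Xsplit Z_def by (simp add: algebra_simps)
      finally show ?thesis using True by simp
    next
      case False
      then have "(\<Sum>\<beta>\<in>N. if supp \<alpha> \<union> supp \<beta> \<subseteq> A then exp (- t * real (Y A)) else 0) = 0" by (intro sum.neutral) auto
      then show ?thesis using False by simp
    qed
  qed
  finally have main: "(wt \<alpha> - t * \<Delta>) * E \<le> expect p U (\<lambda>A. if supp \<alpha> \<subseteq> A then exp (- t * real (card (occ A))) else 0)"
    unfolding \<Delta>_def by (simp add: algebra_simps sum_distrib_left sum_distrib_right)
  have Ephi: "phi t \<le> E" unfolding phi_def E_def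
  proof (rule expect_mono[OF p0 p1])
    fix A
    have "real (Y A) \<le> real (card (occ A))" unfolding Xsplit by (simp add: sum_nonneg)
    then show "exp (- t * real (card (occ A))) \<le> exp (- t * real (Y A))" using t by (simp add: mult_left_mono)
  qed
  show ?thesis
  \<comment> \<open>Replacing \<open>E\<close> by the smaller \<open>phi t\<close> is legitimate
    only for a nonnegative factor; for a negative factor the claim follows from nonnegativity of the
    expectation.\<close>
  proof (cases "wt \<alpha> - t * \<Delta> \<ge> 0")
    case True
    then have "(wt \<alpha> - t * \<Delta>) * phi t \<le> (wt \<alpha> - t * \<Delta>) * E" using Ephi by (intro mult_left_mono) auto
    then show ?thesis using main unfolding \<Delta>_def N_def by linarith
  next
    case False
    then have "(wt \<alpha> - t * \<Delta>) * phi t \<le> 0" using phi_nonneg by (intro mult_nonpos_nonneg) auto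
    also have "0 = expect p U (\<lambda>_. 0)" by (simp add: expect_const[OF finU])
    also have "\<dots> \<le> expect p U (\<lambda>A. if supp \<alpha> \<subseteq> A then exp (- t * real (card (occ A))) else 0)"
      by (rule expect_mono[OF p0 p1]) auto
    finally show ?thesis unfolding \<Delta>_def N_def .
  qed
qed

text \<open>Summed over \<open>\<alpha>\<close>, the tilted bound reads
  \<open>- phi' t \<ge> (\<mu> - t * \<Delta>) * phi t\<close>. Hence
  \<open>phi t * exp (\<mu> * t - t\<^sup>2 * \<Delta> / 2)\<close> does not increase from its value
  1 at 0, and exponential Markov finishes. The pair sum includes \<open>\<beta> = \<alpha>\<close>
  whenever the support is nonempty.\<close>

lemma lower_tail:
  assumes \<Delta>: "(\<Sum>\<alpha>\<in>S. \<Sum>\<beta> | \<beta> \<in> S \<and> supp \<beta> \<inter> supp \<alpha> \<noteq> {}. \<Prod>i\<in>supp \<alpha> \<union> supp \<beta>. p i) \<le> \<Delta>" and \<Delta>0: "\<Delta> > 0" and s: "s \<ge> 0"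
  shows "Pr p U (\<lambda>A. real (card (occ A)) \<le> \<mu> - s) \<le> exp (- s\<^sup>2 / (2 * \<Delta>))"
proof -
  have tilt: "(\<mu> - t * \<Delta>) * phi t \<le> expect p U (\<lambda>A. real (card (occ A)) * exp (- t * real (card (occ A))))" if t: "t \<ge> 0" for t
  proof -
    define D where "D = (\<Sum>\<alpha>\<in>S. \<Sum>\<beta> | \<beta> \<in> S \<and> supp \<beta> \<inter> supp \<alpha> \<noteq> {}. \<Prod>i\<in>supp \<alpha> \<union> supp \<beta>. p i)"
    have "(\<mu> - t * \<Delta>) * phi t \<le> (\<mu> - t * D) * phi t"
      using \<Delta> t phi_nonneg unfolding D_def by (intro mult_right_mono diff_left_mono mult_left_mono) auto
    also have "\<dots> = (\<Sum>\<alpha>\<in>S. (wt \<alpha> - t * (\<Sum>\<beta> | \<beta> \<in> S \<and> supp \<beta> \<inter> supp \<alpha> \<noteq> {}. \<Prod>i\<in>supp \<alpha> \<union> supp \<beta>. p i)) * phi t)"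
      unfolding \<mu>_def D_def by (simp only: sum_distrib_left sum_distrib_right[symmetric] sum_subtractf)
    also have "\<dots> \<le> (\<Sum>\<alpha>\<in>S. expect p U (\<lambda>A. if supp \<alpha> \<subseteq> A then exp (- t * real (card (occ A))) else 0))"
      by (intro sum_mono tilted_expectation_lower t)
    also have "\<dots> = expect p U (\<lambda>A. real (card (occ A)) * exp (- t * real (card (occ A))))"
      unfolding expect_sum[symmetric]
    proof (rule expect_cong)
      fix A
      have "(\<Sum>\<alpha>\<in>S. if supp \<alpha> \<subseteq> A then exp (- t * real (card (occ A))) else 0) = (\<Sum>\<alpha>\<in>occ A. exp (- t * real (card (occ A))))"
        unfolding occ_def by (rule sum.inter_filter[OF finS, symmetric])
      then show "(\<Sum>\<alpha>\<in>S. if supp \<alpha> \<subseteq> A then exp (- t * real (card (occ A))) else 0) = real (card (occ A)) * exp (- t * real (card (occ A)))" by simp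
    qed
    finally show ?thesis .
  qed
  define \<psi> where "\<psi> t = phi t * exp (\<mu> * t - t\<^sup>2 * \<Delta> / 2)" for t
  have dphi: "(phi has_real_derivative (- expect p U (\<lambda>A. real (card (occ A)) * exp (- t * real (card (occ A)))))) (at t)" for t
    unfolding phi_def expect_def sum_negf[symmetric]
    by (rule DERIV_sum) (auto intro!: derivative_eq_intros)
  have dpsi: "(\<psi> has_real_derivative ((- expect p U (\<lambda>A. real (card (occ A)) * exp (- t * real (card (occ A)))) + (\<mu> - t * \<Delta>) * phi t) * exp (\<mu> * t - t\<^sup>2 * \<Delta> / 2))) (at t)" for t
    unfolding \<psi>_def by (auto intro!: derivative_eq_intros dphi simp: algebra_simps)
  \<comment> \<open>The minimiser of the exponent
    \<open>- t * s + t^2 * \<Delta> / 2\<close>.\<close>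
  define t where "t = s / \<Delta>"
  have t: "t \<ge> 0" using s \<Delta>0 by (simp add: t_def)
  have "\<psi> t \<le> \<psi> 0"
  proof (rule DERIV_nonpos_imp_nonincreasing[OF t])
    fix x assume x: "0 \<le> x" "x \<le> t"
    have "(- expect p U (\<lambda>A. real (card (occ A)) * exp (- x * real (card (occ A)))) + (\<mu> - x * \<Delta>) * phi x) * exp (\<mu> * x - x\<^sup>2 * \<Delta> / 2) \<le> 0"
      using tilt[OF x(1)] by (intro mult_nonpos_nonneg) auto
    then show "\<exists>y. (\<psi> has_real_derivative y) (at x) \<and> y \<le> 0" using dpsi by blast
  qed
  also have "\<psi> 0 = 1" by (simp add: \<psi>_def phi_def expect_const[OF finU])
  finally have ph: "phi t \<le> exp (- (\<mu> * t - t\<^sup>2 * \<Delta> / 2))" unfolding \<psi>_def by (simp add: exp_minus field_simps)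
  have "Pr p U (\<lambda>A. real (card (occ A)) \<le> \<mu> - s) \<le> expect p U (\<lambda>A. exp (t * (\<mu> - s)) * exp (- t * real (card (occ A))))"
    unfolding Pr_def
  proof (rule expect_mono[OF p0 p1])
    fix A
    have "1 \<le> exp (t * (\<mu> - s) + (- t * real (card (occ A))))" if "real (card (occ A)) \<le> \<mu> - s"
      using mult_left_mono[OF that t] by simp
    then show "of_bool (real (card (occ A)) \<le> \<mu> - s) \<le> exp (t * (\<mu> - s)) * exp (- t * real (card (occ A)))"
      unfolding exp_add[symmetric] by (auto simp: of_bool_def)
  qed
  also have "\<dots> = exp (t * (\<mu> - s)) * phi t" by (simp add: expect_cmult phi_def)
  also have "\<dots> \<le> exp (t * (\<mu> - s)) * exp (- (\<mu> * t - t\<^sup>2 * \<Delta> / 2))" by (intro mult_left_mono ph) auto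
  also have "\<dots> = exp (- s\<^sup>2 / (2 * \<Delta>))"
    unfolding exp_add[symmetric] t_def using \<Delta>0 by (simp add: field_simps power2_eq_square)
  finally show ?thesis .
qed

end

subsection \<open>Random representation counts\<close>

definition reps :: "(nat \<Rightarrow> nat) \<Rightarrow> nat set \<Rightarrow> nat set \<Rightarrow> nat \<Rightarrow> (nat \<Rightarrow> nat) set" where
  "reps c I A n = {k \<in> sols c I n. k ` I \<subseteq> A}"

text \<open>The prefix \<open>i\<close> restricts to tuples with pairwise distinct entries: only for these is the
  probability of lying in the random set the product of the \<open>p (k i)\<close>.\<close>
definition isols :: "(nat \<Rightarrow> nat) \<Rightarrow> nat set \<Rightarrow> nat \<Rightarrow> (nat \<Rightarrow> nat) set" where
  "isols c I n = {k \<in> sols c I n. inj_on k I}"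

definition ireps :: "(nat \<Rightarrow> nat) \<Rightarrow> nat set \<Rightarrow> nat set \<Rightarrow> nat \<Rightarrow> (nat \<Rightarrow> nat) set" where
  "ireps c I A n = {k \<in> isols c I n. k ` I \<subseteq> A}"

definition iwsum :: "(nat \<Rightarrow> real) \<Rightarrow> (nat \<Rightarrow> nat) \<Rightarrow> nat set \<Rightarrow> nat \<Rightarrow> real" where
  "iwsum p c I n = (\<Sum>k\<in>isols c I n. \<Prod>i\<in>I. p (k i))"

lemma finite_isols: "finite I \<Longrightarrow> \<forall>i\<in>I. c i > 0 \<Longrightarrow> finite (isols c I n)"
  using finite_sols unfolding isols_def by simp

lemma finite_reps: "finite I \<Longrightarrow> \<forall>i\<in>I. c i > 0 \<Longrightarrow> finite (reps c I A n)"
  using finite_sols unfolding reps_def by simp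

lemma finite_ireps: "finite I \<Longrightarrow> \<forall>i\<in>I. c i > 0 \<Longrightarrow> finite (ireps c I A n)"
  using finite_isols unfolding ireps_def by simp

lemma iwsum_le_wsum:
  assumes "finite I" "\<forall>i\<in>I. c i > 0" "\<And>i. p i \<ge> 0"
  shows "iwsum p c I n \<le> wsum p c I n"
  unfolding iwsum_def wsum_def
  by (rule sum_mono2) (use finite_sols assms in \<open>auto simp: isols_def intro: prod_nonneg\<close>)

section \<open>Repeated entries and overlapping solutions\<close>

text \<open>Two equal entries act as one variable carrying the sum of their coefficients, so
  degenerate solutions belong to equations with one variable fewer and are covered by the bounds for
  those.\<close>

lemma merge_in_sols:
  assumes "finite I" "i \<in> I" "j \<in> I" "i \<noteq> j" "k \<in> sols c I n" "k i = k j"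
  shows "k(j := 0) \<in> sols (c(i := c i + c j)) (I - {j}) n"
proof -
  have "(\<Sum>l\<in>I - {j}. (c(i := c i + c j)) l * (k(j := 0)) l) = (c i + c j) * k i + (\<Sum>l\<in>I - {j} - {i}. (c(i := c i + c j)) l * (k(j := 0)) l)"
    using assms by (subst sum.remove[of _ i]) auto
  also have "(\<Sum>l\<in>I - {j} - {i}. (c(i := c i + c j)) l * (k(j := 0)) l) = (\<Sum>l\<in>I - {j} - {i}. c l * k l)"
    by (rule sum.cong) auto
  also have "(c i + c j) * k i + (\<Sum>l\<in>I - {j} - {i}. c l * k l) = (\<Sum>l\<in>I. c l * k l)"
    using assms by (simp add: sum.remove[of I j] sum.remove[of "I - {j}" i] algebra_simps)
  finally show ?thesis using assms(5) by (auto simp: sols_def)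
qed

lemma inj_on_upd_merge:
  fixes i j :: nat
  assumes "i \<noteq> j"
  shows "inj_on (\<lambda>k. k(j := 0)) {k :: nat \<Rightarrow> nat. k i = k j}"
proof (rule inj_onI)
  fix k l :: "nat \<Rightarrow> nat" assume kl: "k \<in> {k. k i = k j}" "l \<in> {k. k i = k j}" "k(j := 0) = l(j := 0)"
  have e: "k a = l a" if "a \<noteq> j" for a using fun_cong[OF kl(3), of a] that by simp
  show "k = l"
  proof
    fix a
    show "k a = l a" using e[of a] e[OF assms] kl(1,2) by (cases "a = j") auto
  qed
qed

lemma sum_UN_le:
  fixes f :: "'a \<Rightarrow> real"
  assumes "finite P" "\<And>q. finite (T q)" "\<And>x. f x \<ge> 0"
  shows "sum f (\<Union>q\<in>P. T q) \<le> (\<Sum>q\<in>P. sum f (T q))"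
  using assms(1)
proof (induction P rule: finite_induct)
  case (insert q P)
  have "sum f (T q \<union> (\<Union>q\<in>P. T q)) \<le> sum f (T q) + sum f (\<Union>q\<in>P. T q)"
    using sum.union_inter[of "T q" "\<Union>q\<in>P. T q" f] insert assms(2) sum_nonneg[of "T q \<inter> (\<Union>q\<in>P. T q)" f] assms(3) by auto
  then show ?case using insert by simp
qed simp

lemma card_reps_le:
  assumes I: "finite I" "\<forall>i\<in>I. c i > 0"
  shows "card (reps c I A n) \<le> card (ireps c I A n)
     + (\<Sum>(i, j) \<in> {(i, j). i \<in> I \<and> j \<in> I \<and> i \<noteq> j}. card (reps (c(i := c i + c j)) (I - {j}) A n))"
proof -
  define P where "P = {(i, j). i \<in> I \<and> j \<in> I \<and> i \<noteq> j}"
  define T where "T q = {k \<in> reps c I A n. k (fst q) = k (snd q)}" for q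
  have finP: "finite P" unfolding P_def by (rule finite_subset[of _ "I \<times> I"]) (use I in auto)
  have finT: "finite (T q)" for q unfolding T_def using finite_reps[OF I] by simp
  have "reps c I A n \<subseteq> ireps c I A n \<union> (\<Union>q\<in>P. T q)"
    by (auto simp: reps_def ireps_def isols_def T_def P_def inj_on_def)
  then have "card (reps c I A n) \<le> card (ireps c I A n \<union> (\<Union>q\<in>P. T q))"
    by (intro card_mono) (use finP finT finite_ireps[OF I] in auto)
  also have "\<dots> \<le> card (ireps c I A n) + card (\<Union>q\<in>P. T q)" by (rule card_Un_le)
  also have "card (\<Union>q\<in>P. T q) \<le> (\<Sum>q\<in>P. card (T q))" by (rule card_UN_le[OF finP])
  also have "(\<Sum>q\<in>P. card (T q)) \<le> (\<Sum>(i, j)\<in>P. card (reps (c(i := c i + c j)) (I - {j}) A n))"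
  proof (rule sum_mono, clarify)
    fix i j assume "(i, j) \<in> P"
    then have ij: "i \<in> I" "j \<in> I" "i \<noteq> j" by (auto simp: P_def)
    show "card (T (i, j)) \<le> card (reps (c(i := c i + c j)) (I - {j}) A n)"
    proof (rule card_inj_on_le[where f = "\<lambda>k. k(j := 0)"])
      show "inj_on (\<lambda>k. k(j := 0)) (T (i, j))"
        by (rule inj_on_subset[OF inj_on_upd_merge[OF ij(3)]]) (auto simp: T_def)
      show "(\<lambda>k. k(j := 0)) ` T (i, j) \<subseteq> reps (c(i := c i + c j)) (I - {j}) A n"
        using merge_in_sols[OF I(1) ij] by (auto simp: T_def reps_def split: if_splits)
      show "finite (reps (c(i := c i + c j)) (I - {j}) A n)" by (rule finite_reps) (use I in auto)
    qed
  qed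
  finally show ?thesis unfolding P_def by simp
qed

text \<open>The weight of a tuple with \<open>k i = k j\<close> counts the repeated entry twice;
  bounding one copy by 1 leaves exactly the weight of the merged tuple.\<close>

lemma wsum_le_iwsum:
  assumes I: "finite I" "\<forall>i\<in>I. c i > 0" and p: "\<And>i. 0 \<le> p i" "\<And>i. p i \<le> 1"
  shows "wsum p c I n \<le> iwsum p c I n
     + (\<Sum>(i, j) \<in> {(i, j). i \<in> I \<and> j \<in> I \<and> i \<noteq> j}. wsum p (c(i := c i + c j)) (I - {j}) n)"
proof -
  define P where "P = {(i, j). i \<in> I \<and> j \<in> I \<and> i \<noteq> j}"
  define T where "T q = {k \<in> sols c I n. k (fst q) = k (snd q)}" for q
  define f where "f J k = (\<Prod>i\<in>J. p (k i))" for J and k :: "nat \<Rightarrow> nat"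
  have fnn: "f J k \<ge> 0" for J k unfolding f_def using p by (intro prod_nonneg) auto
  have finP: "finite P" unfolding P_def by (rule finite_subset[of _ "I \<times> I"]) (use I in auto)
  have finT: "finite (T q)" for q unfolding T_def using finite_sols[OF I] by simp
  have "sols c I n \<subseteq> isols c I n \<union> (\<Union>q\<in>P. T q)"
    by (auto simp: isols_def T_def P_def inj_on_def)
  then have "wsum p c I n \<le> sum (f I) (isols c I n \<union> (\<Union>q\<in>P. T q))"
    unfolding wsum_def f_def[symmetric] by (intro sum_mono2) (use finP finT finite_isols[OF I] fnn in auto)
  also have "\<dots> \<le> iwsum p c I n + sum (f I) (\<Union>q\<in>P. T q)"
    unfolding iwsum_def f_def[symmetric]
    using sum.union_inter[of "isols c I n" "\<Union>q\<in>P. T q" "f I"] finP finT finite_isols[OF I] sum_nonneg[of "isols c I n \<inter> (\<Union>q\<in>P. T q)" "f I"] fnn by auto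
  also have "sum (f I) (\<Union>q\<in>P. T q) \<le> (\<Sum>q\<in>P. sum (f I) (T q))"
    by (rule sum_UN_le) (use finP finT fnn in auto)
  also have "(\<Sum>q\<in>P. sum (f I) (T q)) \<le> (\<Sum>(i, j)\<in>P. wsum p (c(i := c i + c j)) (I - {j}) n)"
  proof (rule sum_mono, clarify)
    fix i j assume "(i, j) \<in> P"
    then have ij: "i \<in> I" "j \<in> I" "i \<noteq> j" by (auto simp: P_def)
    have inj: "inj_on (\<lambda>k. k(j := 0)) (T (i, j))"
      by (rule inj_on_subset[OF inj_on_upd_merge[OF ij(3)]]) (auto simp: T_def)
    have "sum (f I) (T (i, j)) \<le> (\<Sum>k\<in>T (i, j). f (I - {j}) (k(j := 0)))"
    proof (rule sum_mono)
      fix k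
      have "f I k = p (k j) * f (I - {j}) k" unfolding f_def by (rule prod.remove[OF I(1) ij(2)])
      also have "\<dots> \<le> 1 * f (I - {j}) k" by (intro mult_right_mono p fnn)
      also have "f (I - {j}) k = f (I - {j}) (k(j := 0))" unfolding f_def by (rule prod.cong) auto
      finally show "f I k \<le> f (I - {j}) (k(j := 0))" by simp
    qed
    also have "\<dots> = sum (f (I - {j})) ((\<lambda>k. k(j := 0)) ` T (i, j))" by (simp add: sum.reindex[OF inj])
    also have "\<dots> \<le> wsum p (c(i := c i + c j)) (I - {j}) n"
      unfolding wsum_def f_def[symmetric]
    proof (rule sum_mono2)
      show "finite (sols (c(i := c i + c j)) (I - {j}) n)" by (rule finite_sols) (use I in auto)
      show "(\<lambda>k. k(j := 0)) ` T (i, j) \<subseteq> sols (c(i := c i + c j)) (I - {j}) n"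
        using merge_in_sols[OF I(1) ij] by (auto simp: T_def)
    qed (rule fnn)
    finally show "sum (f I) (T (i, j)) \<le> wsum p (c(i := c i + c j)) (I - {j}) n" .
  qed
  finally show ?thesis unfolding P_def by simp
qed

text \<open>A solution that meets \<open>\<alpha>\<close> has some coordinate \<open>j\<close> equal
  to one of at most \<open>card I\<close> values. Fixing it leaves an equation without
  \<open>j\<close> and with a smaller target, so bounds on shorter equations yield sparsity.\<close>

lemma card_ireps_meet_le:
  assumes I: "finite I" "\<forall>i\<in>I. c i > 0"
    and B: "\<And>j m. j \<in> I \<Longrightarrow> m \<le> n \<Longrightarrow> real (card (reps c (I - {j}) A m)) \<le> B j"
  shows "real (card {\<beta> \<in> ireps c I A n. \<beta> ` I \<inter> \<alpha> ` I \<noteq> {}}) \<le> real (card I) * (\<Sum>j\<in>I. B j)"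
proof -
  define T where "T j x = {k \<in> reps c I A n. k j = x}" for j x
  have Bnn: "B j \<ge> 0" if "j \<in> I" for j using B[OF that, of 0] by (meson le0 of_nat_0_le_iff order_trans)
  have finT: "finite (T j x)" for j x unfolding T_def using finite_reps[OF I] by simp
  have T: "real (card (T j x)) \<le> B j" if j: "j \<in> I" for j x
  proof (cases "c j * x \<le> n")
    case True
    have "card (T j x) \<le> card (reps c (I - {j}) A (n - c j * x))"
    proof (rule card_inj_on_le[where f = "\<lambda>k. k(j := 0)"])
      have bij: "bij_betw (\<lambda>k. k(j := 0)) {k \<in> sols c I n. k j = x} (sols c (I - {j}) (n - c j * x))"
        using I(1) j True by (rule sols_fiber_bij)
      show "inj_on (\<lambda>k. k(j := 0)) (T j x)"
        by (rule inj_on_subset[OF bij_betw_imp_inj_on[OF bij]]) (auto simp: T_def reps_def)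
      show "(\<lambda>k. k(j := 0)) ` T j x \<subseteq> reps c (I - {j}) A (n - c j * x)"
        using bij_betw_imp_surj_on[OF bij] by (auto simp: T_def reps_def split: if_splits)
      show "finite (reps c (I - {j}) A (n - c j * x))" by (rule finite_reps) (use I in auto)
    qed
    then show ?thesis using B[OF j, of "n - c j * x"] by simp
  next
    case False
    have "{k \<in> sols c I n. k j = x} = {}" using I(1) j False by (rule sols_fiber_empty)
    then have "T j x = {}" unfolding T_def reps_def by blast
    then show ?thesis using Bnn[OF j] by simp
  qed
  have "{\<beta> \<in> ireps c I A n. \<beta> ` I \<inter> \<alpha> ` I \<noteq> {}} \<subseteq> (\<Union>x\<in>\<alpha> ` I. \<Union>j\<in>I. T j x)"
    by (auto simp: ireps_def isols_def T_def reps_def)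
  then have "card {\<beta> \<in> ireps c I A n. \<beta> ` I \<inter> \<alpha> ` I \<noteq> {}} \<le> card (\<Union>x\<in>\<alpha> ` I. \<Union>j\<in>I. T j x)"
    by (intro card_mono) (use I finT in auto)
  also have "\<dots> \<le> (\<Sum>x\<in>\<alpha> ` I. card (\<Union>j\<in>I. T j x))" by (rule card_UN_le) (use I in auto)
  also have "\<dots> \<le> (\<Sum>x\<in>\<alpha> ` I. \<Sum>j\<in>I. card (T j x))" by (intro sum_mono card_UN_le I)
  finally have "real (card {\<beta> \<in> ireps c I A n. \<beta> ` I \<inter> \<alpha> ` I \<noteq> {}}) \<le> real (\<Sum>x\<in>\<alpha> ` I. \<Sum>j\<in>I. card (T j x))"
    by (simp only: of_nat_le_iff)
  also have "\<dots> = (\<Sum>x\<in>\<alpha> ` I. \<Sum>j\<in>I. real (card (T j x)))" by simp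
  also have "\<dots> \<le> (\<Sum>x\<in>\<alpha> ` I. \<Sum>j\<in>I. B j)" by (intro sum_mono T)
  also have "\<dots> = real (card (\<alpha> ` I)) * (\<Sum>j\<in>I. B j)" by simp
  also have "\<dots> \<le> real (card I) * (\<Sum>j\<in>I. B j)"
    by (intro mult_right_mono sum_nonneg Bnn) (use card_image_le[OF I(1)] in auto)
  finally show ?thesis .
qed

text \<open>Sparsity is built into the event because the upper tail is available only jointly with
  it; outside this event it will follow from the absence of crowding.\<close>

definition heavy :: "(nat \<Rightarrow> nat) \<Rightarrow> nat set \<Rightarrow> real \<Rightarrow> real \<Rightarrow> nat \<Rightarrow> nat set \<Rightarrow> bool" where
  "heavy c I D z n A \<longleftrightarrow> (\<forall>\<alpha>\<in>ireps c I A n. real (card {\<beta> \<in> ireps c I A n. \<beta> ` I \<inter> \<alpha> ` I \<noteq> {}}) \<le> D)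
      \<and> z \<le> real (card (ireps c I A n))"

lemma bernoulli_family_isols:
  assumes "finite I" "\<forall>i\<in>I. c i > 0" "\<And>i. 0 \<le> p i" "\<And>i. p i \<le> 1" "n \<le> N"
  shows "bernoulli_family p {..N} (isols c I n) (\<lambda>k. k ` I)"
proof
  fix k assume "k \<in> isols c I n"
  then show "k ` I \<subseteq> {..N}" using sols_le[OF assms(1,2)] assms(5) by (fastforce simp: isols_def)
qed (use assms finite_isols in auto)

lemma isols_family_occ: "bernoulli_family p U (isols c I n) (\<lambda>k. k ` I) \<Longrightarrow>
   bernoulli_family.occ (isols c I n) (\<lambda>k. k ` I) A = ireps c I A n"
  by (simp add: bernoulli_family.occ_def ireps_def)

lemma isols_family_wt:
  assumes "bernoulli_family p U (isols c I n) (\<lambda>k. k ` I)" "k \<in> isols c I n"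
  shows "bernoulli_family.wt p (\<lambda>k. k ` I) k = (\<Prod>i\<in>I. p (k i))"
  unfolding bernoulli_family.wt_def[OF assms(1)] using assms(2) by (simp add: prod.reindex isols_def)

lemma isols_family_mu:
  assumes "bernoulli_family p U (isols c I n) (\<lambda>k. k ` I)"
  shows "bernoulli_family.\<mu> p (isols c I n) (\<lambda>k. k ` I) = iwsum p c I n"
  unfolding bernoulli_family.\<mu>_def[OF assms] iwsum_def by (rule sum.cong) (use isols_family_wt[OF assms] in auto)

lemma heavy_tail:
  assumes "finite I" "\<forall>i\<in>I. c i > 0" "\<And>i. 0 \<le> p i" "\<And>i. p i \<le> 1" "n \<le> N"
    and "y > 0" "D \<ge> 0" "z \<ge> real M * D + y"
  shows "Pr p {..N} (heavy c I D z n) \<le> (iwsum p c I n / y) ^ M"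
proof -
  have F: "bernoulli_family p {..N} (isols c I n) (\<lambda>k. k ` I)" by (rule bernoulli_family_isols[OF assms(1-5)])
  have "heavy c I D z n = (\<lambda>A. bernoulli_family.sparse (isols c I n) (\<lambda>k. k ` I) D A \<and> z \<le> real (card (bernoulli_family.occ (isols c I n) (\<lambda>k. k ` I) A)))"
    unfolding heavy_def bernoulli_family.sparse_def[OF F] isols_family_occ[OF F] ..
  then show ?thesis using bernoulli_family.upper_tail[OF F assms(6-8)] by (simp add: isols_family_mu[OF F])
qed

text \<open>Each coordinate in \<open>J\<close> has at most \<open>card X\<close> possible values,
  and fixing it only lowers the target; once \<open>J\<close> is exhausted, the weighted count of
  the equation on \<open>I - J\<close> remains.\<close>

lemma sum_sols_prescribed_le:
  assumes "finite J" "J \<subseteq> I" "finite I" "\<forall>i\<in>I. c i > 0" "finite X" "\<And>i. 0 \<le> p i" "B \<ge> 0"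
    and "\<And>m. m \<le> n \<Longrightarrow> wsum p c (I - J) m \<le> B"
  shows "(\<Sum>k\<in>sols c I n. of_bool (\<forall>i\<in>J. k i \<in> X) * (\<Prod>i\<in>I - J. p (k i))) \<le> real (card X) ^ card J * B"
  using assms(1-4,8)
proof (induction J arbitrary: I n rule: finite_induct)
  case empty
  then show ?case using empty(4)[of n] by (simp add: wsum_def)
next
  case (insert j J)
  define f where "f k = of_bool (\<forall>i\<in>J. k i \<in> X) * (\<Prod>i\<in>I - {j} - J. p (k i))" for k :: "nat \<Rightarrow> nat"
  have j: "j \<in> I" using insert by simp
  have fupd: "f (k(j := 0)) = f k" for k
  proof -
    have "(\<Prod>i\<in>I - {j} - J. p ((k(j := 0)) i)) = (\<Prod>i\<in>I - {j} - J. p (k i))" by (rule prod.cong) auto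
    moreover have "(\<forall>i\<in>J. (k(j := 0)) i \<in> X) = (\<forall>i\<in>J. k i \<in> X)" using insert by auto
    ultimately show ?thesis by (simp only: f_def)
  qed
  have "(\<Sum>k\<in>sols c I n. of_bool (\<forall>i\<in>insert j J. k i \<in> X) * (\<Prod>i\<in>I - insert j J. p (k i))) = (\<Sum>k\<in>sols c I n. \<Sum>x\<in>X. if k j = x then f (k(j := 0)) else 0)"
  proof (rule sum.cong)
    fix k
    have e: "I - insert j J = I - {j} - J" by auto
    have "(\<Sum>x\<in>X. if k j = x then f (k(j := 0)) else 0) = (if k j \<in> X then f k else 0)"
      unfolding fupd using assms(5) by (simp add: sum.delta)
    then show "of_bool (\<forall>i\<in>insert j J. k i \<in> X) * (\<Prod>i\<in>I - insert j J. p (k i)) = (\<Sum>x\<in>X. if k j = x then f (k(j := 0)) else 0)"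
      unfolding e by (simp add: f_def)
  qed simp
  also have "\<dots> = (\<Sum>x\<in>X. \<Sum>k\<in>sols c I n. if k j = x then f (k(j := 0)) else 0)" by (rule sum.swap)
  also have "\<dots> = (\<Sum>x\<in>X. \<Sum>k | k \<in> sols c I n \<and> k j = x. f (k(j := 0)))"
    by (intro sum.cong refl sum.inter_filter[symmetric] finite_sols) (use insert in auto)
  also have "\<dots> \<le> (\<Sum>x\<in>X. real (card X) ^ card J * B)"
  proof (rule sum_mono)
    fix x
    show "(\<Sum>k | k \<in> sols c I n \<and> k j = x. f (k(j := 0))) \<le> real (card X) ^ card J * B"
    proof (cases "c j * x \<le> n")
      case True
      have "(\<Sum>k | k \<in> sols c I n \<and> k j = x. f (k(j := 0))) = (\<Sum>k\<in>sols c (I - {j}) (n - c j * x). f k)"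
        using sum_sols_fiber[OF insert.prems(2) j, of f c n x] True by simp
      also have "\<dots> \<le> real (card X) ^ card J * B"
        unfolding f_def
      proof (rule insert.IH)
        show "J \<subseteq> I - {j}" using insert by auto
        show "finite (I - {j})" using insert by auto
        show "\<forall>i\<in>I - {j}. 0 < c i" using insert by auto
        show "wsum p c (I - {j} - J) m \<le> B" if "m \<le> n - c j * x" for m
        proof -
          have "I - {j} - J = I - insert j J" by auto
          then show ?thesis using insert.prems(4)[of m] that by simp
        qed
      qed
      finally show ?thesis .
    next
      case False
      have "(\<Sum>k | k \<in> sols c I n \<and> k j = x. f (k(j := 0))) = 0"
        using sum_sols_fiber[OF insert.prems(2) j, of f c n x] False by simp
      then show ?thesis using assms(7) by simp
    qed
  qed
  also have "\<dots> = real (card X) ^ card (insert j J) * B" using insert by simp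
  finally show ?case .
qed

text \<open>The solutions meeting \<open>\<alpha>\<close> are sorted by the nonempty set
  \<open>J\<close> of coordinates whose values occur in \<open>\<alpha>\<close>. By injectivity the
  weight of the union is that of \<open>\<alpha>\<close> times the weight of \<open>\<beta>\<close>
  on \<open>I - J\<close>, and the coordinates in \<open>J\<close> have at most
  \<open>card I ^ card J\<close> choices.\<close>

lemma overlap_sum_le:
  assumes I: "finite I" "\<forall>i\<in>I. c i > 0" and p: "\<And>i. 0 \<le> p i" and B0: "B \<ge> 0"
    and B: "\<And>J m. J \<subseteq> I \<Longrightarrow> J \<noteq> {} \<Longrightarrow> m \<le> n \<Longrightarrow> wsum p c (I - J) m \<le> B"
    and \<alpha>: "\<alpha> \<in> isols c I n"
  shows "(\<Sum>\<beta> | \<beta> \<in> isols c I n \<and> \<beta> ` I \<inter> \<alpha> ` I \<noteq> {}. \<Prod>i\<in>\<alpha> ` I \<union> \<beta> ` I. p i)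
     \<le> (\<Prod>i\<in>I. p (\<alpha> i)) * ((\<Sum>J\<in>Pow I. real (card I) ^ card J) * B)"
proof -
  define f where "f J \<beta> = of_bool (\<forall>i\<in>J. \<beta> i \<in> \<alpha> ` I) * (\<Prod>i\<in>I - J. p (\<beta> i))" for J and \<beta> :: "nat \<Rightarrow> nat"
  define Q where "Q = Pow I - {{}}"
  have finQ: "finite Q" using I by (simp add: Q_def)
  have fnn: "f J \<beta> \<ge> 0" for J \<beta> unfolding f_def using p by (intro mult_nonneg_nonneg prod_nonneg) auto
  have w\<alpha>: "(\<Prod>i\<in>\<alpha> ` I. p i) = (\<Prod>i\<in>I. p (\<alpha> i))" using \<alpha> by (simp add: prod.reindex isols_def)
  have "(\<Sum>\<beta> | \<beta> \<in> isols c I n \<and> \<beta> ` I \<inter> \<alpha> ` I \<noteq> {}. \<Prod>i\<in>\<alpha> ` I \<union> \<beta> ` I. p i)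
     \<le> (\<Sum>\<beta> | \<beta> \<in> isols c I n \<and> \<beta> ` I \<inter> \<alpha> ` I \<noteq> {}. (\<Prod>i\<in>I. p (\<alpha> i)) * (\<Sum>J\<in>Q. f J \<beta>))"
  proof (rule sum_mono)
    fix \<beta> assume "\<beta> \<in> {\<beta>. \<beta> \<in> isols c I n \<and> \<beta> ` I \<inter> \<alpha> ` I \<noteq> {}}"
    then have \<beta>: "inj_on \<beta> I" "\<beta> ` I \<inter> \<alpha> ` I \<noteq> {}" by (auto simp: isols_def)
    define J where "J = {i\<in>I. \<beta> i \<in> \<alpha> ` I}"
    have JQ: "J \<in> Q" using \<beta>(2) by (auto simp: Q_def J_def)
    have "\<alpha> ` I \<union> \<beta> ` I = \<alpha> ` I \<union> \<beta> ` (I - J)" by (auto simp: J_def)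
    moreover have "\<alpha> ` I \<inter> \<beta> ` (I - J) = {}" by (auto simp: J_def) (metis image_eqI)
    ultimately have "(\<Prod>i\<in>\<alpha> ` I \<union> \<beta> ` I. p i) = (\<Prod>i\<in>\<alpha> ` I. p i) * (\<Prod>i\<in>\<beta> ` (I - J). p i)"
      using prod.union_disjoint[of "\<alpha> ` I" "\<beta> ` (I - J)" p] I by simp
    also have "(\<Prod>i\<in>\<beta> ` (I - J). p i) = (\<Prod>i\<in>I - J. p (\<beta> i))"
      using prod.reindex[OF inj_on_subset[OF \<beta>(1)], of "I - J" p] by simp
    also have "\<dots> = f J \<beta>" by (simp add: f_def J_def)
    also have "(\<Prod>i\<in>\<alpha> ` I. p i) * f J \<beta> \<le> (\<Prod>i\<in>\<alpha> ` I. p i) * (\<Sum>J\<in>Q. f J \<beta>)"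
      by (intro mult_left_mono member_le_sum JQ finQ fnn prod_nonneg p)
    finally show "(\<Prod>i\<in>\<alpha> ` I \<union> \<beta> ` I. p i) \<le> (\<Prod>i\<in>I. p (\<alpha> i)) * (\<Sum>J\<in>Q. f J \<beta>)" unfolding w\<alpha> .
  qed
  also have "\<dots> \<le> (\<Sum>\<beta>\<in>sols c I n. (\<Prod>i\<in>I. p (\<alpha> i)) * (\<Sum>J\<in>Q. f J \<beta>))"
    by (rule sum_mono2) (use finite_sols[OF I] in \<open>auto simp: isols_def intro!: mult_nonneg_nonneg prod_nonneg p sum_nonneg fnn\<close>)
  also have "\<dots> = (\<Prod>i\<in>I. p (\<alpha> i)) * (\<Sum>J\<in>Q. \<Sum>\<beta>\<in>sols c I n. f J \<beta>)"
    unfolding sum_distrib_left[symmetric] by (subst sum.swap) simp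
  also have "\<dots> \<le> (\<Prod>i\<in>I. p (\<alpha> i)) * (\<Sum>J\<in>Q. real (card I) ^ card J * B)"
  proof (intro mult_left_mono sum_mono prod_nonneg p)
    fix J assume J: "J \<in> Q"
    then have J': "J \<subseteq> I" "J \<noteq> {}" "finite J" using I by (auto simp: Q_def intro: finite_subset)
    have "(\<Sum>\<beta>\<in>sols c I n. f J \<beta>) \<le> real (card (\<alpha> ` I)) ^ card J * B"
      unfolding f_def by (rule sum_sols_prescribed_le) (use J' I p B0 B in auto)
    also have "card (\<alpha> ` I) = card I" using \<alpha> by (simp add: isols_def card_image)
    finally show "(\<Sum>\<beta>\<in>sols c I n. f J \<beta>) \<le> real (card I) ^ card J * B" .
  qed
  also have "\<dots> \<le> (\<Prod>i\<in>I. p (\<alpha> i)) * (\<Sum>J\<in>Pow I. real (card I) ^ card J * B)"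
    by (intro mult_left_mono sum_mono2 prod_nonneg p) (use I B0 in \<open>auto simp: Q_def\<close>)
  finally show ?thesis by (simp add: sum_distrib_right)
qed

text \<open>The overlap estimate bounds the \<open>\<Delta>\<close> of Janson's inequality by the
  mean times a constant times \<open>B\<close>, so the exponent is governed by the ratio of the mean
  to \<open>B\<close>.\<close>

lemma light_tail:
  assumes I: "finite I" "\<forall>i\<in>I. c i > 0" and p: "\<And>i. 0 \<le> p i" "\<And>i. p i \<le> 1" and n: "n \<le> N" and B0: "B > 0"
    and B: "\<And>J m. J \<subseteq> I \<Longrightarrow> J \<noteq> {} \<Longrightarrow> m \<le> n \<Longrightarrow> wsum p c (I - J) m \<le> B"
    and pos: "iwsum p c I n > 0" and s: "s \<ge> 0"
  shows "Pr p {..N} (\<lambda>A. real (card (ireps c I A n)) \<le> iwsum p c I n - s)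
     \<le> exp (- s\<^sup>2 / (2 * (iwsum p c I n * ((\<Sum>J\<in>Pow I. real (card I) ^ card J) * B))))"
proof -
  have F: "bernoulli_family p {..N} (isols c I n) (\<lambda>k. k ` I)" by (rule bernoulli_family_isols[OF I p n])
  have "(\<Sum>J\<in>Pow I. real (card I) ^ card J) \<ge> (\<Sum>J\<in>{{} :: nat set}. real (card I) ^ card J)"
    by (rule sum_mono2) (use I in auto)
  then have K: "(\<Sum>J\<in>Pow I. real (card I) ^ card J) > 0" by simp
  have "Pr p {..N} (\<lambda>A. real (card (bernoulli_family.occ (isols c I n) (\<lambda>k. k ` I) A)) \<le> bernoulli_family.\<mu> p (isols c I n) (\<lambda>k. k ` I) - s)
     \<le> exp (- s\<^sup>2 / (2 * (iwsum p c I n * ((\<Sum>J\<in>Pow I. real (card I) ^ card J) * B))))"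
  proof (rule bernoulli_family.lower_tail[OF F])
    show "0 < iwsum p c I n * ((\<Sum>J\<in>Pow I. real (card I) ^ card J) * B)" using pos K B0 by simp
    show "(\<Sum>\<alpha>\<in>isols c I n. \<Sum>\<beta> | \<beta> \<in> isols c I n \<and> \<beta> ` I \<inter> \<alpha> ` I \<noteq> {}. \<Prod>i\<in>\<alpha> ` I \<union> \<beta> ` I. p i) \<le> iwsum p c I n * ((\<Sum>J\<in>Pow I. real (card I) ^ card J) * B)"
      unfolding iwsum_def sum_distrib_right
      by (rule sum_mono, unfold sum_distrib_right[symmetric], rule overlap_sum_le[OF I p(1) less_imp_le[OF B0] B]) auto
  qed (rule s)
  then show ?thesis unfolding isols_family_occ[OF F] isols_family_mu[OF F] .
qed

lemma sum_inverse_squares_le: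
  assumes "m \<ge> 1"
  shows "(\<Sum>n\<in>{m..N}. 1 / real (Suc n) ^ 2) \<le> 1 / real m"
proof (cases "m \<le> N")
  case True
  then have "(\<Sum>n\<in>{m..N}. 1 / real (Suc n) ^ 2) \<le> 1 / real m - 1 / real (Suc N)"
  proof (induction rule: dec_induct)
    case base
    have "1 / real (Suc m) ^ 2 \<le> 1 / (real m * real (Suc m))"
      using assms by (intro divide_left_mono) (auto simp: power2_eq_square)
    also have "\<dots> = 1 / real m - 1 / real (Suc m)" using assms by (simp add: field_simps)
    finally show ?case by simp
  next
    case (step N)
    have "1 / real (Suc (Suc N)) ^ 2 \<le> 1 / (real (Suc N) * real (Suc (Suc N)))"
      by (intro divide_left_mono) (auto simp: power2_eq_square)
    also have "\<dots> = 1 / real (Suc N) - 1 / real (Suc (Suc N))" by (simp add: field_simps)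
    finally show ?case using step by simp
  qed
  moreover have "1 / real (Suc N) \<ge> 0" by simp
  ultimately show ?thesis by linarith
qed simp

section \<open>A vanishing error term and a compactness principle\<close>

text \<open>Diagonal argument: at \<open>n\<close> the largest index \<open>k \<le> n\<close> whose
  threshold has been passed is used. It makes a single set work for all precisions
  simultaneously.\<close>

lemma exists_vanishing_choice:
  fixes Q :: "real \<Rightarrow> nat \<Rightarrow> bool"
  assumes "\<And>\<delta>. \<delta> > 0 \<Longrightarrow> eventually (Q \<delta>) sequentially"
  shows "\<exists>\<delta>. \<delta> \<longlonglongrightarrow> 0 \<and> (\<forall>n. \<delta> n > 0) \<and> (\<forall>\<^sub>F n in sequentially. Q (\<delta> n) n)"
proof -
  have "\<forall>k. \<exists>N. \<forall>n\<ge>N. Q (1 / real (Suc k)) n"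
    using assms by (simp add: eventually_sequentially del: of_nat_Suc)
  then obtain N where N: "\<And>k n. n \<ge> N k \<Longrightarrow> Q (1 / real (Suc k)) n" by metis
  define X where "X n = {k. k \<le> n \<and> (k = 0 \<or> N k \<le> n)}" for n
  define f where "f n = Max (X n)" for n
  have fin: "finite (X n)" for n by (rule finite_subset[of _ "{..n}"]) (auto simp: X_def)
  have ne: "X n \<noteq> {}" for n by (auto simp: X_def)
  have fX: "f n \<in> X n" for n unfolding f_def by (rule Max_in[OF fin ne])
  have fge: "k \<le> f n" if "n \<ge> N k" "n \<ge> k" for k n unfolding f_def by (rule Max_ge[OF fin]) (use that in \<open>auto simp: X_def\<close>)
  have "filterlim f at_top sequentially"
    unfolding filterlim_at_top
  proof
    fix k
    show "\<forall>\<^sub>F n in sequentially. k \<le> f n"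
      using eventually_ge_at_top[of "N k"] eventually_ge_at_top[of k] by eventually_elim (rule fge)
  qed
  then have "(\<lambda>n. 1 / real (Suc (f n))) \<longlonglongrightarrow> 0"
    using filterlim_compose[OF LIMSEQ_inverse_real_of_nat] by (simp add: inverse_eq_divide)
  moreover have "\<forall>\<^sub>F n in sequentially. Q (1 / real (Suc (f n))) n"
    using eventually_ge_at_top[of "N 0"]
  proof eventually_elim
    case (elim n)
    then show ?case using fX[of n] N[where n = n and k = "f n"] by (cases "f n = 0") (auto simp: X_def)
  qed
  ultimately show ?thesis by (intro exI[of _ "\<lambda>n. 1 / real (Suc (f n))"]) auto
qed

text \<open>Koenig's lemma on the binary tree of initial segments: a segment that can be completed
  up to every \<open>N\<close> has a one-step extension with the same property, since failures of
  both extensions at \<open>N1\<close> and \<open>N2\<close> would contradict a completion up to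
  \<open>max N1 N2\<close>.\<close>

lemma initial_segment_compactness:
  fixes Q :: "nat \<Rightarrow> nat set \<Rightarrow> bool"
  assumes "\<And>N. \<exists>A. \<forall>m\<le>N. Q m (A \<inter> {..m})"
  shows "\<exists>A. \<forall>m. Q m (A \<inter> {..m})"
proof -
  define ext where "ext m S \<longleftrightarrow> (\<forall>N. \<exists>A. A \<inter> {..<m} = S \<and> (\<forall>k\<le>N. Q k (A \<inter> {..k})))" for m and S :: "nat set"
  have extD: "S \<subseteq> {..<m}" if "ext m S" for m S
    using spec[OF that[unfolded ext_def], of 0] by auto
  have step: "\<exists>S'. ext (Suc m) S' \<and> S' \<inter> {..<m} = S" if e: "ext m S" for m S
  proof (rule ccontr)
    assume contra: "\<not> ?thesis"
    have sub: "S \<subseteq> {..<m}" by (rule extD[OF e])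
    then have "S \<inter> {..<m} = S" "insert m S \<inter> {..<m} = S" by auto
    then have "\<not> ext (Suc m) S" "\<not> ext (Suc m) (insert m S)" using contra by auto
    then obtain N1 N2 where N1: "\<not> (\<exists>A. A \<inter> {..<Suc m} = S \<and> (\<forall>k\<le>N1. Q k (A \<inter> {..k})))"
      and N2: "\<not> (\<exists>A. A \<inter> {..<Suc m} = insert m S \<and> (\<forall>k\<le>N2. Q k (A \<inter> {..k})))"
      unfolding ext_def by meson
    obtain A where A0: "A \<inter> {..<m} = S \<and> (\<forall>k\<le>max N1 N2. Q k (A \<inter> {..k}))"
      using spec[OF e[unfolded ext_def], of "max N1 N2"] by (rule exE)
    note A = conjunct1[OF A0] conjunct2[OF A0]
    have A1: "\<forall>k\<le>N1. Q k (A \<inter> {..k})" and A2: "\<forall>k\<le>N2. Q k (A \<inter> {..k})"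
      using A(2) by (simp_all add: le_max_iff_disj)
    show False
    proof (cases "m \<in> A")
      case True
      then have "A \<inter> {..<Suc m} = insert m S" using A(1) by (auto simp: lessThan_Suc)
      then show ?thesis using N2 exI[of "\<lambda>A. A \<inter> {..<Suc m} = insert m S \<and> (\<forall>k\<le>N2. Q k (A \<inter> {..k}))" A] A2 by simp
    next
      case False
      then have "A \<inter> {..<Suc m} = S" using A(1) by (auto simp: lessThan_Suc)
      then show ?thesis using N1 exI[of "\<lambda>A. A \<inter> {..<Suc m} = S \<and> (\<forall>k\<le>N1. Q k (A \<inter> {..k}))" A] A1 by simp
    qed
  qed
  have "\<exists>f. \<forall>m. ext m (f m) \<and> f (Suc m) \<inter> {..<m} = f m"
  proof (rule dependent_nat_choice)
    show "\<exists>S. ext 0 S" using assms by (auto simp: ext_def)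
  qed (rule step)
  then obtain f where f: "\<And>m. ext m (f m)" "\<And>m. f (Suc m) \<inter> {..<m} = f m" by blast
  have fsub: "f m \<subseteq> {..<m}" for m by (rule extD[OF f(1)])
  have f_add: "f (m + j) \<inter> {..<m} = f m" for m j
  proof (induction j)
    case 0
    then show ?case using fsub by auto
  next
    case (Suc j)
    have "f (m + Suc j) \<inter> {..<m} = f (Suc (m + j)) \<inter> {..<m + j} \<inter> {..<m}" by auto
    then show ?case using f(2)[of "m + j"] Suc by simp
  qed
  define A where "A = (\<Union>m. f m)"
  have Af: "A \<inter> {..<m} = f m" for m
  proof (intro equalityI subsetI)
    fix x assume "x \<in> A \<inter> {..<m}"
    then obtain l where l: "x \<in> f l" "x < m" by (auto simp: A_def)
    show "x \<in> f m"
    proof (cases "l \<le> m")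
      case True
      then show ?thesis using f_add[of l "m - l"] l by auto
    next
      case False
      then show ?thesis using f_add[of m "l - m"] l by auto
    qed
  next
    fix x assume "x \<in> f m"
    then show "x \<in> A \<inter> {..<m}" using fsub by (auto simp: A_def)
  qed
  have "Q m (A \<inter> {..m})" for m
  proof -
    obtain B where "B \<inter> {..<Suc m} = f (Suc m)" "Q m (B \<inter> {..m})"
      using spec[OF f(1)[of "Suc m", unfolded ext_def], of m] by auto
    then show ?thesis using Af[of "Suc m"] by (simp add: lessThan_Suc_atMost)
  qed
  then show ?thesis by blast
qed

section \<open>Equations with fewer variables\<close>

text \<open>One event for all targets up to \<open>N\<close>: its complement has to cover the
  various smaller targets that appear when a coordinate is fixed, and its probability is to be small
  uniformly in \<open>N\<close>.\<close>

definition crowded :: "(nat \<Rightarrow> nat) \<Rightarrow> nat set \<Rightarrow> real \<Rightarrow> real \<Rightarrow> nat \<Rightarrow> nat set \<Rightarrow> bool" where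
  "crowded c I g C N A \<longleftrightarrow> (\<exists>m\<in>{..N}. C * real (Suc m) powr g < real (card (reps c I A m)))"

lemma not_crowdedD: "\<not> crowded c I g C N A \<Longrightarrow> m \<le> N \<Longrightarrow> real (card (reps c I A m)) \<le> C * real (Suc m) powr g"
  unfolding crowded_def by force

definition distinct_pairs :: "nat set \<Rightarrow> (nat \<times> nat) set" where
  "distinct_pairs I = {(i, j). i \<in> I \<and> j \<in> I \<and> i \<noteq> j}"

abbreviation merge_coeff :: "(nat \<Rightarrow> nat) \<Rightarrow> nat \<times> nat \<Rightarrow> nat \<Rightarrow> nat" where
  "merge_coeff c q \<equiv> c(fst q := c (fst q) + c (snd q))"

lemma finite_distinct_pairs: "finite I \<Longrightarrow> finite (distinct_pairs I)"
  unfolding distinct_pairs_def by (rule finite_subset[of _ "I \<times> I"]) auto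

lemma card_distinct_pairs: "finite I \<Longrightarrow> card (distinct_pairs I) \<le> card I * card I"
  unfolding distinct_pairs_def card_cartesian_product[symmetric] by (rule card_mono) auto

lemma card_reps_le_merge:
  assumes I: "finite I" "\<forall>i\<in>I. c i > 0"
  shows "real (card (reps c I A n)) \<le> real (card (ireps c I A n))
     + (\<Sum>q\<in>distinct_pairs I. real (card (reps (merge_coeff c q) (I - {snd q}) A n)))"
proof -
  have "real (card (reps c I A n)) \<le> real (card (ireps c I A n)
     + (\<Sum>q\<in>distinct_pairs I. card (reps (merge_coeff c q) (I - {snd q}) A n)))"
    using card_reps_le[OF assms, of A n] by (simp only: of_nat_le_iff distinct_pairs_def case_prod_unfold)
  then show ?thesis by simp
qed

text \<open>If an equation is crowded while all equations obtained by deleting or merging a variable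
  are not, then its injective solutions are sparse yet too numerous, that is, heavy. As the mean is
  \<open>O(m^e)\<close> with \<open>e < g\<close>, tuples of a fixed length \<open>M\<close> already
  make heaviness summable in \<open>m\<close>.\<close>

lemma crowded_unlikely:
  fixes p :: "nat \<Rightarrow> real"
  assumes p: "\<And>i. 0 \<le> p i" "\<And>i. p i \<le> 1" and g: "0 \<le> g" "e < g"
    and W: "\<And>c I. finite I \<Longrightarrow> I \<noteq> {} \<Longrightarrow> card I \<le> h \<Longrightarrow> \<forall>i\<in>I. c i > 0 \<Longrightarrow> \<exists>C>0. \<forall>m. wsum p c I m \<le> C * real (Suc m) powr e"
    and I: "finite I" "card I \<le> h" "\<forall>i\<in>I. c i > 0" and \<epsilon>: "\<epsilon> > 0"
  shows "\<exists>C>0. \<forall>N. Pr p {..N} (crowded c I g C N) \<le> \<epsilon>"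
  using I \<epsilon>
proof (induction "card I" arbitrary: c I \<epsilon> rule: less_induct)
  case less
  note I = less.prems(1,3)
  have Pr_False: "Pr p {..N} (\<lambda>_. False) = 0" for N unfolding Pr_def by (simp add: expect_const)
  show ?case
  proof (cases "I = {}")
    case True
    have "\<not> crowded c I g 1 N A" for N A
    proof -
      have "real (card (reps c I A m)) \<le> 1 * real (Suc m) powr g" for m
      proof -
        have "reps c I A m \<subseteq> {\<lambda>_. 0}" unfolding True by (auto simp: reps_def sols_def)
        then have "card (reps c I A m) \<le> card {\<lambda>_::nat. 0::nat}" by (intro card_mono) auto
        then have "real (card (reps c I A m)) \<le> 1" by simp
        also have "1 \<le> real (Suc m) powr g" using g by (simp add: ge_one_powr_ge_zero)
        finally show ?thesis by simp
      qed
      then show ?thesis unfolding crowded_def by (simp add: not_less)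
    qed
    then have "crowded c I g 1 N = (\<lambda>_. False)" for N by auto
    then show ?thesis using Pr_False less.prems(4) by (intro exI[of _ 1]) auto
  next
    case False
    define d where "d = card I"
    define P where "P = distinct_pairs I"
    have d1: "d \<ge> 1" unfolding d_def using False I by (simp add: Suc_leI card_gt_0_iff)
    \<comment> \<open>There are at most \<open>d\<close> deletions and \<open>d * d\<close> merges;
      together they may use half of \<open>\<epsilon>\<close>.\<close>
    define \<delta> where "\<delta> = \<epsilon> / (2 * (real d + real d * real d))"
    have \<delta>: "\<delta> > 0" unfolding \<delta>_def using d1 less.prems(4) by (simp add: add_pos_pos)
    have finP: "finite P" unfolding P_def by (rule finite_distinct_pairs[OF I(1)])
    have "\<forall>j\<in>I. \<exists>C>0. \<forall>N. Pr p {..N} (crowded c (I - {j}) g C N) \<le> \<delta>"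
    proof
      fix j assume "j \<in> I"
      then have "card (I - {j}) < card I" using I by (meson card_Diff1_less)
      then show "\<exists>C>0. \<forall>N. Pr p {..N} (crowded c (I - {j}) g C N) \<le> \<delta>"
        by (intro less.hyps) (use less.prems \<delta> in auto)
    qed
    then obtain Cd where Cd: "\<And>j. j \<in> I \<Longrightarrow> Cd j > 0" "\<And>j N. j \<in> I \<Longrightarrow> Pr p {..N} (crowded c (I - {j}) g (Cd j) N) \<le> \<delta>" by metis
    have "\<forall>q\<in>P. \<exists>C>0. \<forall>N. Pr p {..N} (crowded (merge_coeff c q) (I - {snd q}) g C N) \<le> \<delta>"
    proof
      fix q assume "q \<in> P"
      then have "snd q \<in> I" by (auto simp: P_def distinct_pairs_def)
      then have "card (I - {snd q}) < card I" using I by (meson card_Diff1_less)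
      then show "\<exists>C>0. \<forall>N. Pr p {..N} (crowded (merge_coeff c q) (I - {snd q}) g C N) \<le> \<delta>"
        by (intro less.hyps) (use less.prems \<delta> in auto)
    qed
    then obtain Cm where Cm: "\<And>q. q \<in> P \<Longrightarrow> Cm q > 0" "\<And>q N. q \<in> P \<Longrightarrow> Pr p {..N} (crowded (merge_coeff c q) (I - {snd q}) g (Cm q) N) \<le> \<delta>" by metis
    obtain C0 where C0: "C0 > 0" "\<And>m. wsum p c I m \<le> C0 * real (Suc m) powr e"
      using W[of I c] False less.prems by blast
    define D1 where "D1 = real d * (\<Sum>j\<in>I. Cd j)"
    have D1: "D1 \<ge> 0" unfolding D1_def using Cd(1) by (intro mult_nonneg_nonneg sum_nonneg) (auto simp: less_imp_le)
    \<comment> \<open>Large enough that the gain \<open>(m + 1) powr (e - g)\<close> per chain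
      member, taken \<open>M\<close> times, beats the inverse square.\<close>
    define M where "M = Suc (nat \<lceil>2 / (g - e)\<rceil>)"
    have M: "real M * (g - e) \<ge> 2"
    proof -
      have "2 / (g - e) \<le> real M" unfolding M_def by linarith
      then show ?thesis using g by (simp add: field_simps)
    qed
    \<comment> \<open>Chosen so that \<open>C0 / Y\<close> is at most 1 and at most
      \<open>\<epsilon> / 4\<close>: the former lets the \<open>M\<close>-th power be replaced by a
      single factor, the latter pays for a sum of inverse squares that is at most 2.\<close>
    define Y where "Y = C0 * (1 + 4 / \<epsilon>)"
    have Ypos: "Y > 0" unfolding Y_def using C0 less.prems(4) by (simp add: add_pos_pos)
    have CY: "C0 / Y = 1 / (1 + 4 / \<epsilon>)" unfolding Y_def using C0(1) by simp
    have "4 / \<epsilon> > 0" using less.prems(4) by simp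
    then have "1 / (1 + 4 / \<epsilon>) \<le> 1 / (4 / \<epsilon>)" "1 / (1 + 4 / \<epsilon>) \<le> 1 / 1"
      by (intro frac_le; linarith)+
    moreover have "1 / (1 + 4 / \<epsilon>) \<ge> 0" using \<open>4 / \<epsilon> > 0\<close> by (intro divide_nonneg_nonneg) linarith+
    ultimately have Y: "Y > 0" "C0 / Y \<le> \<epsilon> / 4" "C0 / Y \<le> 1" "C0 / Y \<ge> 0"
      unfolding CY using Ypos by simp_all
    \<comment> \<open>The summands account for the solutions blocked by \<open>M\<close> disjoint
      choices, the room left for each choice, and the solutions with repeated entries.\<close>
    define C where "C = real M * D1 + Y + (\<Sum>q\<in>P. Cm q)"
    have Cpos: "C > 0" unfolding C_def
      by (intro add_pos_nonneg add_nonneg_pos mult_nonneg_nonneg sum_nonneg) (use D1 Y(1) Cm(1) in \<open>auto simp: less_imp_le\<close>)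
    define z where "z m = (real M * D1 + Y) * real (Suc m) powr g" for m
    define H where "H m = heavy c I (D1 * real (Suc m) powr g) (z m) m" for m
    have incl: "(\<exists>j\<in>I. crowded c (I - {j}) g (Cd j) N A) \<or> (\<exists>q\<in>P. crowded (merge_coeff c q) (I - {snd q}) g (Cm q) N A) \<or> (\<exists>m\<in>{..N}. H m A)"
      if cr: "crowded c I g C N A" for N A
    proof (rule ccontr)
      assume no: "\<not> ?thesis"
      obtain m where m: "m \<le> N" "C * real (Suc m) powr g < real (card (reps c I A m))" using cr by (auto simp: crowded_def)
      have "real (card (reps c I A m)) \<le> real (card (ireps c I A m)) + (\<Sum>q\<in>P. real (card (reps (merge_coeff c q) (I - {snd q}) A m)))"
        unfolding P_def by (rule card_reps_le_merge[OF I])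
      also have "(\<Sum>q\<in>P. real (card (reps (merge_coeff c q) (I - {snd q}) A m))) \<le> (\<Sum>q\<in>P. Cm q * real (Suc m) powr g)"
        by (intro sum_mono not_crowdedD[OF _ m(1)]) (use no in blast)
      finally have "z m \<le> real (card (ireps c I A m))" using m(2) unfolding C_def z_def by (simp add: algebra_simps sum_distrib_right)
      moreover have "real (card {\<beta> \<in> ireps c I A m. \<beta> ` I \<inter> \<alpha> ` I \<noteq> {}}) \<le> D1 * real (Suc m) powr g" for \<alpha>
      proof -
        have "real (card {\<beta> \<in> ireps c I A m. \<beta> ` I \<inter> \<alpha> ` I \<noteq> {}}) \<le> real (card I) * (\<Sum>j\<in>I. Cd j * real (Suc m) powr g)"
        proof (rule card_ireps_meet_le[OF I])
          fix j k assume jk: "j \<in> I" "k \<le> m"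
          have "real (card (reps c (I - {j}) A k)) \<le> Cd j * real (Suc k) powr g"
            by (rule not_crowdedD[where N = N]) (use no jk m in auto)
          also have "\<dots> \<le> Cd j * real (Suc m) powr g" using Cd(1)[OF jk(1)] jk(2) g by (intro mult_left_mono powr_mono2) auto
          finally show "real (card (reps c (I - {j}) A k)) \<le> Cd j * real (Suc m) powr g" .
        qed
        then show ?thesis unfolding D1_def d_def by (simp add: sum_distrib_right mult.assoc)
      qed
      ultimately have "H m A" unfolding H_def heavy_def by blast
      then show False using no m(1) by auto
    qed
    have "Pr p {..N} (crowded c I g C N) \<le> \<epsilon>" for N
    proof -
      have HP: "Pr p {..N} (H m) \<le> (\<epsilon> / 4) * (1 / real (Suc m) ^ 2)" if "m \<in> {..N}" for m
      proof -
        have "Pr p {..N} (H m) \<le> (iwsum p c I m / (Y * real (Suc m) powr g)) ^ M"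
          unfolding H_def
        proof (rule heavy_tail[OF I p])
          show "z m \<ge> real M * (D1 * real (Suc m) powr g) + Y * real (Suc m) powr g" unfolding z_def by (simp add: algebra_simps)
        qed (use that Y D1 in auto)
        also have "\<dots> \<le> (C0 / Y * real (Suc m) powr (e - g)) ^ M"
        proof (rule power_mono)
          have "iwsum p c I m \<le> C0 * real (Suc m) powr e" by (rule order_trans[OF iwsum_le_wsum[OF I p(1)] C0(2)])
          then have "iwsum p c I m / (Y * real (Suc m) powr g) \<le> C0 * real (Suc m) powr e / (Y * real (Suc m) powr g)"
            using Y(1) by (intro divide_right_mono) auto
          then show "iwsum p c I m / (Y * real (Suc m) powr g) \<le> C0 / Y * real (Suc m) powr (e - g)" by (simp add: powr_diff)
          show "0 \<le> iwsum p c I m / (Y * real (Suc m) powr g)"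
            unfolding iwsum_def using p Y(1) by (intro divide_nonneg_nonneg sum_nonneg prod_nonneg) auto
        qed
        also have "\<dots> = (C0 / Y) ^ M * real (Suc m) powr (- (real M * (g - e)))"
        proof -
          have "(real (Suc m) powr (e - g)) ^ M = real (Suc m) powr ((e - g) * real M)"
            by (simp add: powr_realpow[symmetric] powr_powr)
          also have "(e - g) * real M = - (real M * (g - e))" by (simp add: algebra_simps)
          finally show ?thesis by (simp only: power_mult_distrib)
        qed
        also have "\<dots> \<le> (C0 / Y) * real (Suc m) powr (- 2)"
        proof (rule mult_mono)
          show "(C0 / Y) ^ M \<le> C0 / Y" using power_decreasing[of 1 M "C0 / Y"] Y(3,4) by (simp add: M_def)
          show "real (Suc m) powr (- (real M * (g - e))) \<le> real (Suc m) powr - 2" using M by (intro powr_mono) auto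
        qed (use Y in auto)
        also have "\<dots> \<le> (\<epsilon> / 4) * real (Suc m) powr (- 2)" using Y(2) by (intro mult_right_mono) auto
        also have "real (Suc m) powr (- 2) = 1 / real (Suc m) ^ 2" by (simp add: powr_minus_divide)
        finally show ?thesis .
      qed
      have "Pr p {..N} (crowded c I g C N) \<le> Pr p {..N} (\<lambda>A. (\<exists>j\<in>I. crowded c (I - {j}) g (Cd j) N A) \<or> (\<exists>q\<in>P. crowded (merge_coeff c q) (I - {snd q}) g (Cm q) N A) \<or> (\<exists>m\<in>{..N}. H m A))"
        by (rule Pr_mono[OF p]) (rule incl)
      also have "\<dots> \<le> Pr p {..N} (\<lambda>A. \<exists>j\<in>I. crowded c (I - {j}) g (Cd j) N A) + (Pr p {..N} (\<lambda>A. \<exists>q\<in>P. crowded (merge_coeff c q) (I - {snd q}) g (Cm q) N A) + Pr p {..N} (\<lambda>A. \<exists>m\<in>{..N}. H m A))"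
        by (rule order_trans, rule Pr_disj[OF p], rule add_left_mono, rule Pr_disj[OF p])
      also have "\<dots> \<le> (\<Sum>j\<in>I. \<delta>) + ((\<Sum>q\<in>P. \<delta>) + (\<Sum>m\<in>{..N}. (\<epsilon> / 4) * (1 / real (Suc m) ^ 2)))"
      proof (intro add_mono)
        show "Pr p {..N} (\<lambda>A. \<exists>j\<in>I. crowded c (I - {j}) g (Cd j) N A) \<le> (\<Sum>j\<in>I. \<delta>)"
          by (rule order_trans, rule Pr_UN[OF p I(1)], rule sum_mono, rule Cd(2))
        show "Pr p {..N} (\<lambda>A. \<exists>q\<in>P. crowded (merge_coeff c q) (I - {snd q}) g (Cm q) N A) \<le> (\<Sum>q\<in>P. \<delta>)"
          by (rule order_trans, rule Pr_UN[OF p finP], rule sum_mono, rule Cm(2))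
        show "Pr p {..N} (\<lambda>A. \<exists>m\<in>{..N}. H m A) \<le> (\<Sum>m\<in>{..N}. (\<epsilon> / 4) * (1 / real (Suc m) ^ 2))"
          by (rule order_trans, rule Pr_UN[OF p finite_atMost], rule sum_mono, rule HP)
      qed
      also have "\<dots> \<le> real d * \<delta> + (real d * real d * \<delta> + \<epsilon> / 2)"
      proof (intro add_mono)
        show "(\<Sum>j\<in>I. \<delta>) \<le> real d * \<delta>" by (simp add: d_def)
        have "real (card P) \<le> real (d * d)" using card_distinct_pairs[OF I(1)] unfolding P_def d_def by (simp only: of_nat_le_iff)
        then show "(\<Sum>q\<in>P. \<delta>) \<le> real d * real d * \<delta>" using \<delta> by simp
        have "(\<Sum>m\<in>{..N}. 1 / real (Suc m) ^ 2) \<le> 2"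
        proof -
          have "{..N} = insert 0 {1..N}" by auto
          then show ?thesis using sum_inverse_squares_le[of 1 N] by (simp del: of_nat_Suc) simp
        qed
        then have "(\<epsilon> / 4) * (\<Sum>m\<in>{..N}. 1 / real (Suc m) ^ 2) \<le> (\<epsilon> / 4) * 2" using less.prems(4) by (intro mult_left_mono) auto
        then show "(\<Sum>m\<in>{..N}. (\<epsilon> / 4) * (1 / real (Suc m) ^ 2)) \<le> \<epsilon> / 2" unfolding sum_distrib_left[symmetric] by linarith
      qed
      also have "\<dots> = \<epsilon>"
      proof -
        have "real d + real d * real d > 0" using d1 by (simp add: add_pos_pos)
        moreover have "x * (\<epsilon> / (2 * x)) = \<epsilon> / 2" if "x > 0" for x :: real using that by simp
        ultimately have "(real d + real d * real d) * \<delta> = \<epsilon> / 2" unfolding \<delta>_def by blast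
        then show ?thesis by (simp add: algebra_simps)
      qed
      finally show ?thesis .
    qed
    then show ?thesis using Cpos by blast
  qed
qed

lemma half_le_ln_Suc:
  assumes "n \<ge> 1"
  shows "1 / 2 \<le> ln (real (Suc n))"
proof -
  have "ln 2 \<le> ln (real (Suc n))" using assms by simp
  moreover have "(1 / 2 :: real) \<le> ln 2" using ln_add_one_self_le_self2[of "-1/2"] by (simp add: ln_div)
  ultimately show ?thesis by linarith
qed

lemma reps_Int_atMost:
  assumes "finite I" "\<forall>i\<in>I. c i > 0" "n \<le> m"
  shows "reps c I (A \<inter> {..m}) n = reps c I A n"
  using sols_le[OF assms(1,2)] assms(3) unfolding reps_def by fastforce

lemma ireps_Int_atMost:
  assumes "finite I" "\<forall>i\<in>I. c i > 0" "n \<le> m"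
  shows "ireps c I (A \<inter> {..m}) n = ireps c I A n"
  using sols_le[OF assms(1,2)] assms(3) unfolding ireps_def isols_def by fastforce

section \<open>Concentration of the number of representations\<close>

text \<open>Half of the excess \<open>\<delta> * \<mu>\<close> is spent on blocked members, which
  permits chains of length \<open>M\<close> about \<open>\<delta> * \<mu> / (2 * D)\<close>; the
  other half leaves \<open>y = (1 + \<delta> / 2) * \<mu>\<close>. The resulting bound
  \<open>(1 + \<delta> / 2) ^ (- M)\<close> is an inverse square once
  \<open>\<mu> / (D * ln n)\<close> is large.\<close>

lemma heavy_unlikely:
  assumes I: "finite I" "\<forall>i\<in>I. c i > 0" and p: "\<And>i. 0 \<le> p i" "\<And>i. p i \<le> 1" and n: "n \<ge> 1" "n \<le> N"
    and \<delta>: "\<delta> > 0" and D: "D > 0" and pos: "iwsum p c I n > 0"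
    and big: "iwsum p c I n \<ge> (2 / \<delta>) * (2 / ln (1 + \<delta> / 2) + 2) * D * ln (real (Suc n))"
  shows "Pr p {..N} (heavy c I D ((1 + \<delta>) * iwsum p c I n) n) \<le> 1 / real (Suc n) ^ 2"
proof -
  define \<mu> where "\<mu> = iwsum p c I n"
  define L where "L = ln (real (Suc n))"
  define r where "r = ln (1 + \<delta> / 2)"
  define x where "x = \<delta> * \<mu> / (2 * D)"
  define M where "M = nat \<lfloor>x\<rfloor>"
  have r: "r > 0" unfolding r_def using \<delta> by simp
  have \<mu>: "\<mu> > 0" using pos by (simp add: \<mu>_def)
  have L: "L \<ge> 1 / 2" unfolding L_def by (rule half_le_ln_Suc[OF n(1)])
  have x0: "x \<ge> 0" unfolding x_def using \<delta> \<mu> D by simp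
  have Mx: "real M \<le> x" "x - 1 \<le> real M" unfolding M_def using x0 by linarith+
  have "x \<ge> (2 / r + 2) * L"
  proof -
    have "\<delta> * \<mu> \<ge> \<delta> * ((2 / \<delta>) * (2 / r + 2) * D * L)"
      using big \<delta> unfolding \<mu>_def r_def L_def by (intro mult_left_mono) auto
    also have "\<delta> * ((2 / \<delta>) * (2 / r + 2) * D * L) = ((2 / r + 2) * L) * (2 * D)" using \<delta> by simp
    finally show ?thesis unfolding x_def using D by (simp add: pos_le_divide_eq)
  qed
  moreover have "(2 / r + 2) * L = 2 * L / r + 2 * L" by (simp add: algebra_simps)
  \<comment> \<open>Since \<open>2 * L \<ge> 1\<close>, the summand 2 in the assumed lower bound
    pays for rounding \<open>x\<close> down to \<open>M\<close>.\<close>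
  ultimately have "real M \<ge> 2 * L / r" using Mx(2) L by linarith
  then have Mr: "real M * r \<ge> 2 * L" using r by (simp add: pos_divide_le_eq)
  have "Pr p {..N} (heavy c I D ((1 + \<delta>) * \<mu>) n) \<le> (iwsum p c I n / ((1 + \<delta> / 2) * \<mu>)) ^ M"
  proof (rule heavy_tail[OF I p n(2)])
    have "real M * D \<le> x * D" using Mx D by simp
    also have "x * D = \<delta> / 2 * \<mu>" unfolding x_def using D by simp
    finally show "real M * D + (1 + \<delta> / 2) * \<mu> \<le> (1 + \<delta>) * \<mu>" by (simp add: algebra_simps)
  qed (use \<mu> \<delta> D in auto)
  also have "iwsum p c I n / ((1 + \<delta> / 2) * \<mu>) = exp (- r)"
  proof -
    have "exp (- r) = 1 / (1 + \<delta> / 2)" unfolding r_def exp_minus using \<delta> by (simp add: inverse_eq_divide)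
    then show ?thesis unfolding \<mu>_def[symmetric] using \<mu> by simp
  qed
  also have "exp (- r) ^ M = exp (- (real M * r))" by (simp add: exp_of_nat_mult[symmetric])
  also have "\<dots> \<le> exp (- (2 * L))" using Mr by simp
  also have "\<dots> = 1 / real (Suc n) ^ 2"
    unfolding L_def exp_minus using exp_of_nat_mult[of 2 "ln (real (Suc n))"] by (simp add: inverse_eq_divide)
  finally show ?thesis unfolding \<mu>_def .
qed

text \<open>With deviation \<open>\<delta> * \<mu>\<close> the Janson exponent is
  \<open>\<delta>^2 * \<mu> / (2 * K * B)\<close>, and the assumed lower bound on the mean makes it
  at least \<open>2 * ln (n + 1)\<close>.\<close>

lemma light_unlikely:
  assumes I: "finite I" "\<forall>i\<in>I. c i > 0" and p: "\<And>i. 0 \<le> p i" "\<And>i. p i \<le> 1" and n: "n \<le> N"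
    and \<delta>: "\<delta> > 0" and B0: "B > 0"
    and B: "\<And>J m. J \<subseteq> I \<Longrightarrow> J \<noteq> {} \<Longrightarrow> m \<le> n \<Longrightarrow> wsum p c (I - J) m \<le> B"
    and pos: "iwsum p c I n > 0"
    and big: "iwsum p c I n \<ge> 4 * (\<Sum>J\<in>Pow I. real (card I) ^ card J) / \<delta>\<^sup>2 * B * ln (real (Suc n))"
  shows "Pr p {..N} (\<lambda>A. real (card (ireps c I A n)) \<le> (1 - \<delta>) * iwsum p c I n) \<le> 1 / real (Suc n) ^ 2"
proof -
  define \<mu> where "\<mu> = iwsum p c I n"
  define L where "L = ln (real (Suc n))"
  define K where "K = (\<Sum>J\<in>Pow I. real (card I) ^ card J)"
  have "(\<Sum>J\<in>Pow I. real (card I) ^ card J) \<ge> (\<Sum>J\<in>{{} :: nat set}. real (card I) ^ card J)"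
    by (rule sum_mono2) (use I in auto)
  then have K: "K > 0" by (simp add: K_def)
  have \<mu>: "\<mu> > 0" using pos by (simp add: \<mu>_def)
  have "2 * L \<le> (\<delta> * \<mu>)\<^sup>2 / (2 * (\<mu> * (K * B)))"
  proof -
    have "(4 * K / \<delta>\<^sup>2 * B * L) * (\<delta>\<^sup>2 * \<mu>) \<le> \<mu> * (\<delta>\<^sup>2 * \<mu>)"
      using big \<mu> \<delta> unfolding \<mu>_def K_def L_def by (intro mult_right_mono) auto
    also have "(4 * K / \<delta>\<^sup>2 * B * L) * (\<delta>\<^sup>2 * \<mu>) = 2 * L * (2 * (\<mu> * (K * B)))" using \<delta> by simp
    finally have "2 * L * (2 * (\<mu> * (K * B))) \<le> (\<delta> * \<mu>)\<^sup>2" by (simp add: power2_eq_square mult_ac)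
    then show ?thesis using \<mu> K B0 by (simp add: pos_le_divide_eq)
  qed
  then have "exp (- (\<delta> * \<mu>)\<^sup>2 / (2 * (\<mu> * (K * B)))) \<le> exp (- (2 * L))" by simp
  also have "\<dots> = 1 / real (Suc n) ^ 2"
    unfolding L_def exp_minus using exp_of_nat_mult[of 2 "ln (real (Suc n))"] by (simp add: inverse_eq_divide)
  finally have 1: "exp (- (\<delta> * \<mu>)\<^sup>2 / (2 * (\<mu> * (K * B)))) \<le> 1 / real (Suc n) ^ 2" .
  have "Pr p {..N} (\<lambda>A. real (card (ireps c I A n)) \<le> \<mu> - \<delta> * \<mu>) \<le> exp (- (\<delta> * \<mu>)\<^sup>2 / (2 * (\<mu> * (K * B))))"
    unfolding \<mu>_def K_def by (rule light_tail[OF I p n B0 B pos]) (use \<delta> pos in auto)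
  moreover have "\<mu> - \<delta> * \<mu> = (1 - \<delta>) * \<mu>" by (simp add: algebra_simps)
  ultimately show ?thesis using 1 unfolding \<mu>_def by simp
qed

text \<open>Crowding of the shorter equations has probability at most 1/4 in total, heavy and light
  counts beyond \<open>n0\<close> at most 1/8 each, uniformly in the range; some finite set avoids
  all of them, and compactness produces one infinite set.\<close>

lemma exists_concentrated_set:
  fixes p :: "nat \<Rightarrow> real"
  assumes p: "\<And>i. 0 \<le> p i" "\<And>i. p i \<le> 1" and g: "0 \<le> g" "e < g"
    and W: "\<And>c I. finite I \<Longrightarrow> I \<noteq> {} \<Longrightarrow> card I \<le> h \<Longrightarrow> \<forall>i\<in>I. c i > 0 \<Longrightarrow> \<exists>C>0. \<forall>m. wsum p c I m \<le> C * real (Suc m) powr e"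
    and I: "finite I" "\<forall>i\<in>I. c i > 0" and cI: "card I = Suc h"
    and big: "filterlim (\<lambda>n. iwsum p c I n / (real (Suc n) powr g * ln (real (Suc n)))) at_top sequentially"
  shows "\<exists>A. (\<lambda>n. real (card (reps c I A n)) / iwsum p c I n) \<longlonglongrightarrow> 1"
proof -
  define \<mu> where "\<mu> n = iwsum p c I n" for n
  define G where "G n = real (Suc n) powr g" for n
  define L where "L n = ln (real (Suc n))" for n
  define P where "P = distinct_pairs I"
  have Gpos: "G n > 0" for n by (simp add: G_def)
  have G1: "G n \<ge> 1" for n unfolding G_def using g by (simp add: ge_one_powr_ge_zero)
  have Gmono: "G m \<le> G n" if "m \<le> n" for m n unfolding G_def using that g by (intro powr_mono2) auto
  have eG: "real (Suc m) powr e \<le> G m" for m unfolding G_def using g by (intro powr_mono) auto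
  have finP: "finite P" unfolding P_def by (rule finite_distinct_pairs[OF I(1)])
  have Ine: "I \<noteq> {}" using cI by auto
  have large: "\<forall>\<^sub>F n in sequentially. K * G n * L n \<le> \<mu> n" for K
  proof -
    have "\<forall>\<^sub>F n in sequentially. K \<le> \<mu> n / (G n * L n)" using big by (simp add: filterlim_at_top \<mu>_def G_def L_def)
    then show ?thesis using eventually_ge_at_top[of 1]
    proof eventually_elim
      case (elim n)
      then have "L n > 0" by (simp add: L_def)
      then have "G n * L n > 0" using Gpos by simp
      then show ?case using elim by (simp add: pos_le_divide_eq mult.assoc)
    qed
  qed
  have \<mu>pos: "\<forall>\<^sub>F n in sequentially. \<mu> n > 0"
    using large[of 1] eventually_ge_at_top[of 1]
  proof eventually_elim
    case (elim n)
    then have "L n > 0" by (simp add: L_def)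
    then have "1 * G n * L n > 0" using Gpos by simp
    then show ?case using elim by linarith
  qed
  \<comment> \<open>The deletions and merges number at most \<open>card I + card I * card I\<close>,
    so all of them together cost at most 1/4.\<close>
  define \<eta> where "\<eta> = 1 / (4 * (real (card I) + real (card I) * real (card I)))"
  have d0: "real (card I) > 0" using cI by simp
  have \<eta>: "\<eta> > 0" unfolding \<eta>_def using d0 by (simp add: add_pos_pos)
  have "\<forall>j\<in>I. \<exists>C>0. \<forall>N. Pr p {..N} (crowded c (I - {j}) g C N) \<le> \<eta>"
  proof
    fix j assume "j \<in> I"
    then have "card (I - {j}) \<le> h" using I cI by simp
    then show "\<exists>C>0. \<forall>N. Pr p {..N} (crowded c (I - {j}) g C N) \<le> \<eta>"
      by (intro crowded_unlikely[OF p g W]) (use I \<eta> in auto)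
  qed
  then obtain Cd where Cd: "\<And>j. j \<in> I \<Longrightarrow> Cd j > 0" "\<And>j N. j \<in> I \<Longrightarrow> Pr p {..N} (crowded c (I - {j}) g (Cd j) N) \<le> \<eta>" by metis
  have "\<forall>q\<in>P. \<exists>C>0. \<forall>N. Pr p {..N} (crowded (merge_coeff c q) (I - {snd q}) g C N) \<le> \<eta>"
  proof
    fix q assume "q \<in> P"
    then have "snd q \<in> I" by (auto simp: P_def distinct_pairs_def)
    then have "card (I - {snd q}) \<le> h" using I cI by simp
    then show "\<exists>C>0. \<forall>N. Pr p {..N} (crowded (merge_coeff c q) (I - {snd q}) g C N) \<le> \<eta>"
      by (intro crowded_unlikely[OF p g W]) (use I \<eta> in auto)
  qed
  then obtain Cm where Cm: "\<And>q. q \<in> P \<Longrightarrow> Cm q > 0" "\<And>q N. q \<in> P \<Longrightarrow> Pr p {..N} (crowded (merge_coeff c q) (I - {snd q}) g (Cm q) N) \<le> \<eta>" by metis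
  define D1 where "D1 = real (card I) * (\<Sum>j\<in>I. Cd j)"
  have D1: "D1 > 0" unfolding D1_def using Cd(1) d0 Ine I by (intro mult_pos_pos sum_pos) auto
  have "\<exists>C>0. \<forall>m. wsum p c (I - J) m \<le> C * G m" if J: "J \<in> Pow I - {{}}" for J
  proof (cases "I - J = {}")
    case True
    \<comment> \<open>For \<open>J = I\<close> the empty equation remains, with weighted count at
      most 1; \<open>g \<ge> 0\<close> makes \<open>G\<close> large enough to cover it.\<close>
    have "wsum p c (I - J) m \<le> 1 * G m" for m unfolding True wsum_empty using G1[of m] by (cases "m = 0") auto
    then show ?thesis by (intro exI[of _ 1]) auto
  next
    case False
    have "card (I - J) < card I" using J I by (intro psubset_card_mono) auto
    then obtain C where C: "C > 0" "\<And>m. wsum p c (I - J) m \<le> C * real (Suc m) powr e"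
      using W[of "I - J" c] I False cI by auto
    have "wsum p c (I - J) m \<le> C * G m" for m
      by (rule order_trans[OF C(2)]) (use C(1) eG in \<open>intro mult_left_mono, auto\<close>)
    then show ?thesis using C(1) by blast
  qed
  then have "\<forall>J\<in>Pow I - {{}}. \<exists>C>0. \<forall>m. wsum p c (I - J) m \<le> C * G m" by blast
  then obtain CJ where CJ: "\<And>J. J \<in> Pow I - {{}} \<Longrightarrow> CJ J > 0" "\<And>J m. J \<in> Pow I - {{}} \<Longrightarrow> wsum p c (I - J) m \<le> CJ J * G m" by metis
  define CB where "CB = 1 + (\<Sum>J\<in>Pow I - {{}}. CJ J)"
  have CB: "CB > 0" unfolding CB_def using CJ(1) by (intro add_pos_nonneg sum_nonneg) (auto simp: less_imp_le)
  have B: "wsum p c (I - J) m \<le> CB * G n" if "J \<subseteq> I" "J \<noteq> {}" "m \<le> n" for J m n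
  proof -
    have J: "J \<in> Pow I - {{}}" using that by simp
    have "CJ J \<le> (\<Sum>J\<in>Pow I - {{}}. CJ J)" by (rule member_le_sum[OF J]) (use CJ(1) I in \<open>auto simp: less_imp_le\<close>)
    then have "CJ J \<le> CB" unfolding CB_def by simp
    then have "CJ J * G m \<le> CB * G n" using Gmono[OF that(3)] Gpos[of m] CB by (intro mult_mono) (auto simp: less_imp_le)
    then show ?thesis using CJ(2)[OF J, of m] by linarith
  qed
  define Hv where "Hv \<delta> n = heavy c I (D1 * G n) ((1 + \<delta>) * \<mu> n) n" for \<delta> n
  define Lt where "Lt \<delta> n A \<longleftrightarrow> real (card (ireps c I A n)) \<le> (1 - \<delta>) * \<mu> n" for \<delta> n A
  define Q where "Q \<delta> n \<longleftrightarrow> (\<forall>N\<ge>n. Pr p {..N} (Hv \<delta> n) \<le> 1 / real (Suc n) ^ 2 \<and> Pr p {..N} (Lt \<delta> n) \<le> 1 / real (Suc n) ^ 2)" for \<delta> n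
  have "eventually (Q \<delta>) sequentially" if \<delta>: "\<delta> > 0" for \<delta>
    using large[of "(2 / \<delta>) * (2 / ln (1 + \<delta> / 2) + 2) * D1"] large[of "4 * (\<Sum>J\<in>Pow I. real (card I) ^ card J) / \<delta>\<^sup>2 * CB"] \<mu>pos eventually_ge_at_top[of 1]
  proof eventually_elim
    case (elim n)
    show "Q \<delta> n" unfolding Q_def
    proof (intro allI impI conjI)
      fix N assume N: "n \<le> N"
      show "Pr p {..N} (Hv \<delta> n) \<le> 1 / real (Suc n) ^ 2"
        unfolding Hv_def \<mu>_def
      proof (rule heavy_unlikely[OF I p elim(4) N \<delta>])
        show "(2 / \<delta>) * (2 / ln (1 + \<delta> / 2) + 2) * (D1 * G n) * ln (real (Suc n)) \<le> iwsum p c I n"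
          using elim(1) unfolding \<mu>_def L_def by (simp only: mult.assoc)
      qed (use D1 Gpos elim in \<open>auto simp: \<mu>_def\<close>)
      show "Pr p {..N} (Lt \<delta> n) \<le> 1 / real (Suc n) ^ 2"
        unfolding Lt_def \<mu>_def
      proof (rule light_unlikely[OF I p N \<delta>])
        show "4 * (\<Sum>J\<in>Pow I. real (card I) ^ card J) / \<delta>\<^sup>2 * (CB * G n) * ln (real (Suc n)) \<le> iwsum p c I n"
          using elim(2) unfolding \<mu>_def L_def by (simp only: mult.assoc)
        show "wsum p c (I - J) m \<le> CB * G n" if "J \<subseteq> I" "J \<noteq> {}" "m \<le> n" for J m by (rule B[OF that])
      qed (use CB Gpos elim in \<open>auto simp: \<mu>_def\<close>)
    qed
  qed
  from exists_vanishing_choice[of Q, OF this] obtain \<delta> where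
    \<delta>0: "\<delta> \<longlonglongrightarrow> 0 \<and> (\<forall>n. \<delta> n > 0) \<and> (\<forall>\<^sub>F n in sequentially. Q (\<delta> n) n)" by (rule exE)
  then have \<delta>: "\<delta> \<longlonglongrightarrow> 0" "\<And>n. \<delta> n > 0" "\<forall>\<^sub>F n in sequentially. Q (\<delta> n) n" by simp_all
  obtain n1 where n1: "\<And>n. n \<ge> n1 \<Longrightarrow> Q (\<delta> n) n" using \<delta>(3) by (auto simp: eventually_sequentially)
  \<comment> \<open>From 8 on the inverse squares of \<open>m + 1\<close> sum to at most
    1/8.\<close>
  define n0 where "n0 = max n1 8"
  define Good where "Good m A \<longleftrightarrow> (\<forall>j\<in>I. real (card (reps c (I - {j}) A m)) \<le> Cd j * G m)
     \<and> (\<forall>q\<in>P. real (card (reps (merge_coeff c q) (I - {snd q}) A m)) \<le> Cm q * G m)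
     \<and> (n0 \<le> m \<longrightarrow> \<not> Hv (\<delta> m) m A \<and> \<not> Lt (\<delta> m) m A)" for m A
  \<comment> \<open>With positive coefficients a solution for target \<open>m\<close> uses only
    elements up to \<open>m\<close>, so each condition depends on an initial segment, as compactness
    requires.\<close>
  have Good_Int: "Good m (A \<inter> {..m}) = Good m A" for m A
  proof -
    have "reps c (I - {j}) (A \<inter> {..m}) m = reps c (I - {j}) A m" for j
      by (rule reps_Int_atMost) (use I in auto)
    moreover have "reps (merge_coeff c q) (I - {snd q}) (A \<inter> {..m}) m = reps (merge_coeff c q) (I - {snd q}) A m" for q
      by (rule reps_Int_atMost) (use I in auto)
    moreover have "ireps c I (A \<inter> {..m}) m = ireps c I A m" by (rule ireps_Int_atMost[OF I]) simp
    ultimately show ?thesis unfolding Good_def Hv_def Lt_def heavy_def by simp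
  qed
  have "\<exists>A. \<forall>m\<le>N. Good m (A \<inter> {..m})" for N
  proof -
    define X where "X = {n0..N}"
    define E where "E A \<longleftrightarrow> (\<exists>j\<in>I. crowded c (I - {j}) g (Cd j) N A) \<or> (\<exists>q\<in>P. crowded (merge_coeff c q) (I - {snd q}) g (Cm q) N A)
       \<or> (\<exists>m\<in>X. Hv (\<delta> m) m A) \<or> (\<exists>m\<in>X. Lt (\<delta> m) m A)" for A
    have e1: "Pr p {..N} (\<lambda>A. \<exists>j\<in>I. crowded c (I - {j}) g (Cd j) N A) \<le> real (card I) * \<eta>"
      using order_trans[OF Pr_UN[OF p I(1), where E = "\<lambda>j. crowded c (I - {j}) g (Cd j) N" and U = "{..N}"] sum_bounded_above[of I _ \<eta>]] Cd(2) by simp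
    have e2: "Pr p {..N} (\<lambda>A. \<exists>q\<in>P. crowded (merge_coeff c q) (I - {snd q}) g (Cm q) N A) \<le> real (card P) * \<eta>"
      using order_trans[OF Pr_UN[OF p finP, where E = "\<lambda>q. crowded (merge_coeff c q) (I - {snd q}) g (Cm q) N" and U = "{..N}"] sum_bounded_above[of P _ \<eta>]] Cm(2) by simp
    have sq: "(\<Sum>m\<in>X. 1 / real (Suc m) ^ 2) \<le> 1 / 8"
    proof -
      have "n0 \<ge> 8" by (simp add: n0_def)
      then have "(\<Sum>m\<in>X. 1 / real (Suc m) ^ 2) \<le> 1 / real n0" unfolding X_def by (intro sum_inverse_squares_le) simp
      also have "\<dots> \<le> 1 / 8" using \<open>n0 \<ge> 8\<close> by (intro divide_left_mono) auto
      finally show ?thesis .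
    qed
    have QX: "Pr p {..N} (Hv (\<delta> m) m) \<le> 1 / real (Suc m) ^ 2" "Pr p {..N} (Lt (\<delta> m) m) \<le> 1 / real (Suc m) ^ 2" if "m \<in> X" for m
      using n1[of m] that unfolding Q_def X_def n0_def by auto
    have e3: "Pr p {..N} (\<lambda>A. \<exists>m\<in>X. Hv (\<delta> m) m A) \<le> 1 / 8"
    proof -
      have "Pr p {..N} (\<lambda>A. \<exists>m\<in>X. Hv (\<delta> m) m A) \<le> (\<Sum>m\<in>X. Pr p {..N} (Hv (\<delta> m) m))"
        by (rule Pr_UN[OF p]) (simp add: X_def)
      also have "\<dots> \<le> (\<Sum>m\<in>X. 1 / real (Suc m) ^ 2)" by (rule sum_mono) (rule QX)
      finally show ?thesis using sq by linarith
    qed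
    have e4: "Pr p {..N} (\<lambda>A. \<exists>m\<in>X. Lt (\<delta> m) m A) \<le> 1 / 8"
    proof -
      have "Pr p {..N} (\<lambda>A. \<exists>m\<in>X. Lt (\<delta> m) m A) \<le> (\<Sum>m\<in>X. Pr p {..N} (Lt (\<delta> m) m))"
        by (rule Pr_UN[OF p]) (simp add: X_def)
      also have "\<dots> \<le> (\<Sum>m\<in>X. 1 / real (Suc m) ^ 2)" by (rule sum_mono) (rule QX)
      finally show ?thesis using sq by linarith
    qed
    have e12: "real (card I) * \<eta> + real (card P) * \<eta> \<le> 1 / 4"
    proof -
      have "real (card P) \<le> real (card I * card I)" using card_distinct_pairs[OF I(1)] unfolding P_def by (simp only: of_nat_le_iff)
      then have "(real (card I) + real (card P)) * \<eta> \<le> (real (card I) + real (card I) * real (card I)) * \<eta>"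
        using \<eta> by (intro mult_right_mono) auto
      also have "\<dots> = 1 / 4"
      proof -
        have "real (card I) + real (card I) * real (card I) > 0" using d0 by (simp add: add_pos_pos)
        moreover have "x * (1 / (4 * x)) = 1 / 4" if "x > 0" for x :: real using that by simp
        ultimately show ?thesis unfolding \<eta>_def by blast
      qed
      finally show ?thesis by (simp add: algebra_simps)
    qed
    have "Pr p {..N} E \<le> Pr p {..N} (\<lambda>A. \<exists>j\<in>I. crowded c (I - {j}) g (Cd j) N A) + (Pr p {..N} (\<lambda>A. \<exists>q\<in>P. crowded (merge_coeff c q) (I - {snd q}) g (Cm q) N A)
       + (Pr p {..N} (\<lambda>A. \<exists>m\<in>X. Hv (\<delta> m) m A) + Pr p {..N} (\<lambda>A. \<exists>m\<in>X. Lt (\<delta> m) m A)))"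
      unfolding E_def by (rule order_trans, rule Pr_disj[OF p], rule add_left_mono, rule order_trans, rule Pr_disj[OF p], rule add_left_mono, rule Pr_disj[OF p])
    also have "\<dots> < 1" using e1 e2 e3 e4 e12 by linarith
    finally obtain A where A: "\<not> E A" using Pr_less_1_ex[where p = p and U = "{..N}" and E = E] p by blast
    have "Good m A" if m: "m \<le> N" for m
      unfolding Good_def
    proof (intro conjI ballI impI)
      show "real (card (reps c (I - {j}) A m)) \<le> Cd j * G m" if "j \<in> I" for j
        unfolding G_def by (rule not_crowdedD[OF _ m]) (use A that in \<open>auto simp: E_def\<close>)
      show "real (card (reps (merge_coeff c q) (I - {snd q}) A m)) \<le> Cm q * G m" if "q \<in> P" for q
        unfolding G_def by (rule not_crowdedD[OF _ m]) (use A that in \<open>auto simp: E_def\<close>)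
      show "\<not> Hv (\<delta> m) m A" "\<not> Lt (\<delta> m) m A" if "n0 \<le> m" using A m that by (auto simp: E_def X_def)
    qed
    then show ?thesis using Good_Int by blast
  qed
  from initial_segment_compactness[of Good, OF this] obtain A where "\<forall>m. Good m (A \<inter> {..m})" by (rule exE)
  then have A: "Good m A" for m using Good_Int by blast
  define CM where "CM = (\<Sum>q\<in>P. Cm q)"
  have bounds: "\<forall>\<^sub>F n in sequentially. 1 - \<delta> n \<le> real (card (reps c I A n)) / \<mu> n \<and> real (card (reps c I A n)) / \<mu> n \<le> 1 + \<delta> n + CM * (G n / \<mu> n)"
    using \<mu>pos eventually_ge_at_top[of n0]
  proof eventually_elim
    case (elim n)
    have nH: "\<not> Hv (\<delta> n) n A" and nL: "\<not> Lt (\<delta> n) n A" using A[of n] elim by (auto simp: Good_def)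
    have "real (card {\<beta> \<in> ireps c I A n. \<beta> ` I \<inter> \<alpha> ` I \<noteq> {}}) \<le> D1 * G n" for \<alpha>
    proof -
      have "real (card {\<beta> \<in> ireps c I A n. \<beta> ` I \<inter> \<alpha> ` I \<noteq> {}}) \<le> real (card I) * (\<Sum>j\<in>I. Cd j * G n)"
      proof (rule card_ireps_meet_le[OF I])
        fix j m assume jm: "j \<in> I" "m \<le> n"
        have "real (card (reps c (I - {j}) A m)) \<le> Cd j * G m" using A[of m] jm by (simp add: Good_def)
        also have "\<dots> \<le> Cd j * G n" using Cd(1)[OF jm(1)] Gmono[OF jm(2)] by (intro mult_left_mono) auto
        finally show "real (card (reps c (I - {j}) A m)) \<le> Cd j * G n" .
      qed
      then show ?thesis unfolding D1_def by (simp add: sum_distrib_right mult.assoc)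
    qed
    \<comment> \<open>Sparsity has just been derived from the uncrowded shorter equations, so a set
      that is not heavy must violate the size clause.\<close>
    then have up: "real (card (ireps c I A n)) < (1 + \<delta> n) * \<mu> n" using nH unfolding Hv_def heavy_def by (auto simp: not_le)
    have lo: "(1 - \<delta> n) * \<mu> n < real (card (ireps c I A n))" using nL by (simp add: Lt_def not_le)
    have "card (ireps c I A n) \<le> card (reps c I A n)"
      by (rule card_mono[OF finite_reps[OF I]]) (auto simp: ireps_def reps_def isols_def)
    then have 1: "(1 - \<delta> n) * \<mu> n \<le> real (card (reps c I A n))" using lo by linarith
    have "real (card (reps c I A n)) \<le> real (card (ireps c I A n)) + (\<Sum>q\<in>P. real (card (reps (merge_coeff c q) (I - {snd q}) A n)))"
      unfolding P_def by (rule card_reps_le_merge[OF I])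
    also have "(\<Sum>q\<in>P. real (card (reps (merge_coeff c q) (I - {snd q}) A n))) \<le> (\<Sum>q\<in>P. Cm q * G n)"
      by (rule sum_mono) (use A[of n] in \<open>simp add: Good_def\<close>)
    also have "(\<Sum>q\<in>P. Cm q * G n) = CM * G n" by (simp add: CM_def sum_distrib_right)
    finally have 2: "real (card (reps c I A n)) \<le> (1 + \<delta> n) * \<mu> n + CM * G n" using up by linarith
    show ?case
    proof
      show "1 - \<delta> n \<le> real (card (reps c I A n)) / \<mu> n" using 1 elim by (simp add: pos_le_divide_eq)
      have "real (card (reps c I A n)) / \<mu> n \<le> ((1 + \<delta> n) * \<mu> n + CM * G n) / \<mu> n" using 2 elim by (intro divide_right_mono) auto
      also have "\<dots> = 1 + \<delta> n + CM * (G n / \<mu> n)" using elim by (simp add: add_divide_distrib)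
      finally show "real (card (reps c I A n)) / \<mu> n \<le> 1 + \<delta> n + CM * (G n / \<mu> n)" .
    qed
  qed
  have G0: "(\<lambda>n. G n / \<mu> n) \<longlonglongrightarrow> 0"
  proof (rule LIMSEQ_I)
    fix r :: real assume r: "r > 0"
    have "\<forall>\<^sub>F n in sequentially. norm (G n / \<mu> n - 0) < r"
      using large[of "4 / r"] eventually_ge_at_top[of 1] \<mu>pos
    proof eventually_elim
      case (elim n)
      have "L n \<ge> 1 / 2" unfolding L_def by (rule half_le_ln_Suc[OF elim(2)])
      then have "4 / r * G n * (1 / 2) \<le> 4 / r * G n * L n" using r Gpos[of n] by (intro mult_left_mono) auto
      then have "2 * G n / r \<le> \<mu> n" using elim by simp
      then have "2 * G n \<le> \<mu> n * r" using r by (simp add: pos_divide_le_eq)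
      then show ?case using Gpos[of n] elim by (simp add: pos_divide_less_eq mult.commute)
    qed
    then show "\<exists>no. \<forall>n\<ge>no. norm (G n / \<mu> n - 0) < r" by (simp add: eventually_sequentially)
  qed
  have "(\<lambda>n. real (card (reps c I A n)) / \<mu> n) \<longlonglongrightarrow> 1"
  proof (rule tendsto_sandwich)
    show "\<forall>\<^sub>F n in sequentially. 1 - \<delta> n \<le> real (card (reps c I A n)) / \<mu> n" using bounds by (auto elim: eventually_mono)
    show "\<forall>\<^sub>F n in sequentially. real (card (reps c I A n)) / \<mu> n \<le> 1 + \<delta> n + CM * (G n / \<mu> n)" using bounds by (auto elim: eventually_mono)
    show "(\<lambda>n. 1 - \<delta> n) \<longlonglongrightarrow> 1" using tendsto_diff[OF tendsto_const[of 1] \<delta>(1)] by simp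
    show "(\<lambda>n. 1 + \<delta> n + CM * (G n / \<mu> n)) \<longlonglongrightarrow> 1"
      using tendsto_add[OF tendsto_add[OF tendsto_const[of 1] \<delta>(1)] tendsto_mult[OF tendsto_const[of CM] G0]] by simp
  qed
  then show ?thesis unfolding \<mu>_def by blast
qed

subsection \<open>The theorem\<close>

lemma rep_eq_card_reps: "rep b A l n = card (reps b {1..l} A n)"
  unfolding rep_def reps_def sols_def by (rule arg_cong[where f = card]) auto

lemma dirichlet_const_pos:
  assumes "\<sigma> > 0" "finite I" "I \<noteq> {}" "\<forall>i\<in>I. c i > 0"
  shows "dirichlet_const \<sigma> c I > 0"
proof -
  have "card I > 0" using assms by (simp add: card_gt_0_iff)
  then show ?thesis unfolding dirichlet_const_def using assms
    by (intro divide_pos_pos mult_pos_pos prod_pos zero_less_power Gamma_real_pos) auto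
qed

text \<open>At the extreme index \<open>\<sigma> = 1\<close> the Gamma quotient is
  \<open>1 / (h - 1)!\<close>. This identifies the normalising constant with the one in the
  hypothesis on \<open>F\<close>.\<close>

lemma dirichlet_const_1:
  assumes "h \<ge> 1" "\<forall>i\<in>{1..h}. b i > 0"
  shows "dirichlet_const 1 b {1..h} = 1 / (fact (h - 1) * real (\<Prod>i=1..h. b i))"
proof -
  have "(\<Prod>i\<in>{1..h}. real (b i) powr (-1)) = (\<Prod>i\<in>{1..h}. inverse (real (b i)))"
    by (rule prod.cong) (use assms in \<open>auto simp: powr_minus\<close>)
  also have "\<dots> = 1 / real (\<Prod>i=1..h. b i)" by (simp add: prod_dividef inverse_eq_divide)
  finally have "(\<Prod>i\<in>{1..h}. real (b i) powr (-1)) = 1 / real (\<Prod>i=1..h. b i)" .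
  moreover have "Gamma (real h) = fact (h - 1)" using Gamma_fact[of "h - 1", where 'a = real] assms by (simp add: of_nat_diff)
  ultimately show ?thesis unfolding dirichlet_const_def by simp
qed

text \<open>For negative \<open>\<kappa>\<close> the upper power bound with loss
  \<open>-\<kappa>\<close> would make \<open>F\<close> bounded along the naturals, against
  divergence of \<open>F / ln\<close>.\<close>

lemma index_nonneg:
  fixes F :: "real \<Rightarrow> real"
  assumes u: "rv_seq (\<lambda>n. if n = 0 then 1 else F (real n)) \<kappa>"
    and "filterlim (\<lambda>x. F x / ln x) at_top at_top"
  shows "\<kappa> \<ge> 0"
proof (rule ccontr)
  assume neg: "\<not> \<kappa> \<ge> 0"
  obtain C where C: "C > 0" "\<And>m. (if m = 0 then 1 else F (real m)) \<le> C * real (Suc m) powr (\<kappa> + - \<kappa>)"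
    using rv_seq_upper[OF u, of "- \<kappa>"] neg by auto
  have "filterlim (\<lambda>n. F (real n) / ln (real n)) at_top sequentially"
    by (rule filterlim_compose[OF assms(2) filterlim_real_sequentially])
  then have "\<forall>\<^sub>F n in sequentially. C + 1 \<le> F (real n) / ln (real n)" by (simp add: filterlim_at_top)
  moreover have "filterlim (\<lambda>n. ln (real n)) at_top sequentially"
    by (rule filterlim_compose[OF ln_at_top filterlim_real_sequentially])
  then have "\<forall>\<^sub>F n in sequentially. 1 \<le> ln (real n)" by (simp add: filterlim_at_top)
  ultimately have "\<forall>\<^sub>F n in sequentially. False" using eventually_gt_at_top[of 0]
  proof eventually_elim
    case (elim n)
    have ln0: "0 < ln (real n)" using elim(2) by linarith
    have "(C + 1) * 1 \<le> (C + 1) * ln (real n)" using elim C(1) by (intro mult_left_mono) auto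
    also have "\<dots> \<le> F (real n)" using elim(1) by (simp only: pos_le_divide_eq[OF ln0])
    also have "\<dots> \<le> C" using C(2)[of n] elim by simp
    finally show False by simp
  qed
  then show False by simp
qed

text \<open>Half of the surplus \<open>\<kappa> - d\<close> is given up in the lower power bound;
  the other half still outgrows the constant \<open>K\<close>.\<close>

lemma index_le:
  fixes F :: "real \<Rightarrow> real"
  assumes u: "rv_seq (\<lambda>n. if n = 0 then 1 else F (real n)) \<kappa>"
    and bound: "\<forall>\<^sub>F n in sequentially. F (real n) \<le> K * real n ^ d"
  shows "\<kappa> \<le> real d"
proof (rule ccontr)
  assume gt: "\<not> \<kappa> \<le> real d"
  define \<delta> where "\<delta> = (\<kappa> - real d) / 2"
  have \<delta>: "\<delta> > 0" using gt by (simp add: \<delta>_def)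
  obtain c where c: "c > 0" "\<And>m. c * real (Suc m) powr (\<kappa> - \<delta>) \<le> (if m = 0 then 1 else F (real m))"
    using rv_seq_lower[OF u \<delta>] by auto
  have "filterlim (\<lambda>n. real (Suc n) powr \<delta>) at_top sequentially" using \<delta> by real_asymp
  then have "\<forall>\<^sub>F n in sequentially. (\<bar>K\<bar> + 1) / c \<le> real (Suc n) powr \<delta>" by (simp add: filterlim_at_top)
  then have "\<forall>\<^sub>F n in sequentially. False" using bound eventually_gt_at_top[of 0]
  proof eventually_elim
    case (elim n)
    define s where "s = real (Suc n) ^ d"
    have s: "s \<ge> real n ^ d" "s > 0" unfolding s_def by (auto intro!: power_mono)
    have "\<kappa> - \<delta> = real d + \<delta>" by (simp add: \<delta>_def field_simps)
    then have "real (Suc n) powr (\<kappa> - \<delta>) = s * real (Suc n) powr \<delta>"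
      by (simp only: powr_add s_def powr_realpow of_nat_0_less_iff zero_less_Suc)
    then have "c * (s * real (Suc n) powr \<delta>) \<le> F (real n)" using c(2)[of n] elim by simp
    also have "\<dots> \<le> K * real n ^ d" by (rule elim)
    also have "\<dots> \<le> \<bar>K\<bar> * s" using s by (intro mult_mono) auto
    finally have "s * (c * real (Suc n) powr \<delta>) \<le> s * \<bar>K\<bar>" by (simp add: mult_ac)
    then have "c * real (Suc n) powr \<delta> \<le> \<bar>K\<bar>" using s(2) by simp
    moreover have "\<bar>K\<bar> + 1 \<le> c * real (Suc n) powr \<delta>" using elim c(1) by (simp add: pos_divide_le_eq mult.commute)
    ultimately show False by linarith
  qed
  then show False by simp
qed

text \<open>Truncation at 1 is asymptotically invisible because the excess of \<open>q\<close> over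
  1 tends to 0; this is the only way in which the upper bound on \<open>F\<close> affects the
  probabilities.\<close>

lemma min_1_equiv:
  fixes q :: "nat \<Rightarrow> real"
  assumes "\<And>n. q n > 0" and "e \<longlonglongrightarrow> 0" and "\<forall>\<^sub>F n in sequentially. q n \<le> 1 + \<bar>e n\<bar>"
  shows "(\<lambda>n. min 1 (q n) / q n) \<longlonglongrightarrow> 1"
proof (rule tendsto_sandwich)
  show "\<forall>\<^sub>F n in sequentially. 1 / (1 + \<bar>e n\<bar>) \<le> min 1 (q n) / q n"
    using assms(3)
  proof eventually_elim
    case (elim n)
    show ?case
    proof (cases "q n \<le> 1")
      case True
      then show ?thesis using assms(1)[of n] by simp
    next
      case False
      then show ?thesis using assms(1)[of n] elim by (simp add: frac_le)
    qed
  qed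
  show "\<forall>\<^sub>F n in sequentially. min 1 (q n) / q n \<le> 1" using assms(1) by (simp add: less_imp_le)
  have "(\<lambda>n. 1 / (1 + \<bar>e n\<bar>)) \<longlonglongrightarrow> 1 / (1 + \<bar>0\<bar>)" by (intro tendsto_intros assms(2)) auto
  then show "(\<lambda>n. 1 / (1 + \<bar>e n\<bar>)) \<longlonglongrightarrow> 1" by simp
qed simp

theorem theorem1:
  fixes h :: nat and b :: "nat \<Rightarrow> nat" and F :: "real \<Rightarrow> real"
  assumes "h \<ge> 2"
    and "\<forall>i\<in>{1..h}. b i > 0"
    and "Gcd (b ` {1..h}) = 1"
    and "regularly_varying F"
    and "filterlim (\<lambda>x. F x / ln x) at_top at_top"
    and "\<exists>g :: real \<Rightarrow> real. (g \<longlongrightarrow> 0) at_top \<and>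
           (\<forall>\<^sub>F x in at_top. F x \<le> (1 + g x) * (x ^ (h - 1) /
              (fact (h - 1) * real (\<Prod>i=1..h. b i))))"
  shows "\<exists>A :: nat set. (\<lambda>n. real (rep b A h n)) \<sim>[at_top] (\<lambda>n. F (real n))"
proof -
  define I where "I = {1..h}"
  have I: "finite I" "\<forall>i\<in>I. b i > 0" "I \<noteq> {}" and cI: "card I = h" using assms(1,2) by (auto simp: I_def)
  define K1 where "K1 = 1 / (fact (h - 1) * real (\<Prod>i=1..h. b i))"
  have "(\<Prod>i=1..h. b i) > 0" using assms(2) by (intro prod_pos) auto
  then have K1: "K1 > 0" unfolding K1_def by (intro divide_pos_pos mult_pos_pos) (simp_all only: of_nat_0_less_iff fact_gt_zero zero_less_one)
  \<comment> \<open>The value at 0 is set to 1 because nothing is assumed about \<open>F\<close>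
    there and \<open>rv_seq\<close> needs positive terms.\<close>
  define u where "u n = (if n = 0 then 1 else F (real n))" for n :: nat
  obtain \<kappa> where u: "rv_seq u \<kappa>" using regularly_varying_imp_rv_seq[OF assms(4)] unfolding u_def by blast
  have upos: "u n > 0" for n by (rule rv_seq_pos[OF u])
  obtain f :: "real \<Rightarrow> real" where f: "(f \<longlongrightarrow> 0) at_top" "\<forall>\<^sub>F x in at_top. F x \<le> (1 + f x) * (x ^ (h - 1) * K1)"
    using assms(6) unfolding K1_def by auto
  have fn: "(\<lambda>n. f (real n)) \<longlonglongrightarrow> 0" by (rule filterlim_compose[OF f(1) filterlim_real_sequentially])
  have Fn: "\<forall>\<^sub>F n in sequentially. F (real n) \<le> (1 + f (real n)) * (real n ^ (h - 1) * K1)"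
    by (rule eventually_compose_filterlim[OF f(2) filterlim_real_sequentially])
  have \<kappa>0: "\<kappa> \<ge> 0" by (rule index_nonneg[OF u[unfolded u_def] assms(5)])
  have "\<kappa> \<le> real (h - 1)"
  proof (rule index_le[OF u[unfolded u_def], where K = "2 * K1"])
    have "\<forall>\<^sub>F n in sequentially. f (real n) < 1" using order_tendstoD(2)[OF fn, of 1] by simp
    with Fn show "\<forall>\<^sub>F n in sequentially. F (real n) \<le> 2 * K1 * real n ^ (h - 1)"
    proof eventually_elim
      case (elim n)
      have "(1 + f (real n)) * (real n ^ (h - 1) * K1) \<le> 2 * (real n ^ (h - 1) * K1)"
        using elim K1 by (intro mult_right_mono) auto
      then show ?case using elim by (simp add: mult_ac)
    qed
  qed
  then have \<kappa>h: "\<kappa> \<le> real h - 1" using assms(1) by (simp add: of_nat_diff)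
  have hpos: "real h > 0" using assms(1) by simp
  define \<sigma> where "\<sigma> = (\<kappa> + 1) / real h"
  have \<sigma>: "0 < \<sigma>" "\<sigma> \<le> 1" using \<kappa>0 \<kappa>h hpos unfolding \<sigma>_def by (auto simp: field_simps)
  define Kc where "Kc = dirichlet_const \<sigma> b I"
  have Kc: "Kc > 0" unfolding Kc_def by (rule dirichlet_const_pos) (use \<sigma> I in auto)
  \<comment> \<open>Chosen so that the predicted main term
    \<open>Kc * (n + 1)^(h - 1) * q n ^ h\<close> equals \<open>u n\<close> exactly.\<close>
  define q where "q n = (u n / (Kc * real (Suc n) ^ (h - 1))) powr (1 / real h)" for n
  have qpos: "q n > 0" for n unfolding q_def using upos[of n] Kc by simp
  have qh: "q n ^ h = u n / (Kc * real (Suc n) ^ (h - 1))" for n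
  proof -
    have "q n ^ h = q n powr real h" using qpos[of n] by (simp add: powr_realpow)
    also have "\<dots> = (u n / (Kc * real (Suc n) ^ (h - 1))) powr 1" unfolding q_def powr_powr using hpos by simp
    finally show ?thesis using upos[of n] Kc by simp
  qed
  have rvq: "rv_seq q (\<sigma> - 1)"
  proof -
    have "rv_seq (\<lambda>n. u n * real (Suc n) powr (- (real h - 1))) (\<kappa> + - (real h - 1))"
      by (rule rv_seq_mult[OF u rv_seq_Suc_powr])
    then have "rv_seq (\<lambda>n. (u n * real (Suc n) powr (- (real h - 1))) powr (1 / real h)) ((\<kappa> + - (real h - 1)) * (1 / real h))"
      by (rule rv_seq_powr)
    moreover have "(\<kappa> + - (real h - 1)) * (1 / real h) = \<sigma> - 1" unfolding \<sigma>_def using hpos by (simp add: field_simps)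
    ultimately have rv: "rv_seq (\<lambda>n. (u n * real (Suc n) powr (- (real h - 1))) powr (1 / real h)) (\<sigma> - 1)" by simp
    have q_eq: "q n = (1 / Kc) powr (1 / real h) * (u n * real (Suc n) powr (- (real h - 1))) powr (1 / real h)" for n
    proof -
      have "real (Suc n) powr (- (real h - 1)) = 1 / real (Suc n) ^ (h - 1)"
        using assms(1) by (simp only: powr_minus_divide) (simp add: powr_realpow[symmetric] of_nat_diff)
      then have "u n / (Kc * real (Suc n) ^ (h - 1)) = (1 / Kc) * (u n * real (Suc n) powr (- (real h - 1)))" by simp
      then show ?thesis unfolding q_def using Kc upos[of n] by (simp only: powr_mult)
    qed
    show ?thesis
    proof (rule rv_seq_equiv[OF rv qpos])
      show "(\<lambda>n. q n / (u n * real (Suc n) powr (- (real h - 1))) powr (1 / real h)) \<longlonglongrightarrow> (1 / Kc) powr (1 / real h)"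
        unfolding q_eq using rv_seq_pos[OF rv] by (simp add: less_imp_neq[symmetric])
      show "0 < (1 / Kc) powr (1 / real h)" using Kc by simp
    qed
  qed
  define p where "p n = min 1 (q n)" for n
  have p01: "0 \<le> p i" "p i \<le> 1" and ppos: "p i > 0" for i unfolding p_def using qpos[of i] by auto
  have pq: "(\<lambda>n. p n / q n) \<longlonglongrightarrow> 1"
  proof (cases "\<kappa> = real h - 1")
    case True
    then have "\<sigma> = 1" using hpos by (simp add: \<sigma>_def)
    then have "Kc = K1" unfolding Kc_def K1_def I_def using dirichlet_const_1[of h b] assms(1,2) by simp
    have "\<forall>\<^sub>F n in sequentially. q n \<le> 1 + \<bar>f (real n)\<bar>"
      using Fn eventually_gt_at_top[of 0]
    proof eventually_elim
      case (elim n)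
      have "u n \<le> (1 + \<bar>f (real n)\<bar>) * (Kc * real (Suc n) ^ (h - 1))"
      proof -
        have "u n \<le> (1 + f (real n)) * (real n ^ (h - 1) * K1)" using elim by (simp add: u_def)
        also have "\<dots> \<le> (1 + \<bar>f (real n)\<bar>) * (real (Suc n) ^ (h - 1) * K1)"
          using K1 by (intro mult_mono mult_right_mono power_mono) auto
        finally show ?thesis by (simp add: \<open>Kc = K1\<close> mult_ac)
      qed
      then have qh1: "q n ^ h \<le> 1 + \<bar>f (real n)\<bar>" unfolding qh using Kc by (simp add: pos_divide_le_eq)
      show ?case
      \<comment> \<open>Above 1 the \<open>h\<close>-th power dominates \<open>q n\<close> itself,
        so the bound on the power carries over to the base.\<close>
      proof (cases "q n \<le> 1")
        case False
        then have "q n ^ 1 \<le> q n ^ h" using assms(1) by (intro power_increasing) auto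
        then show ?thesis using qh1 by simp
      qed simp
    qed
    then show ?thesis unfolding p_def by (rule min_1_equiv[OF qpos fn])
  next
    case False
    \<comment> \<open>Below the extreme index \<open>q\<close> has negative index, hence tends to 0,
      and the truncation eventually stops acting.\<close>
    then have \<sigma>1: "\<sigma> < 1" using \<kappa>h hpos unfolding \<sigma>_def by (simp add: field_simps)
    define \<delta> where "\<delta> = (1 - \<sigma>) / 2"
    have \<delta>: "\<delta> > 0" using \<sigma>1 by (simp add: \<delta>_def)
    obtain C where C: "C > 0" "\<And>m. q m \<le> C * real (Suc m) powr (\<sigma> - 1 + \<delta>)" using rv_seq_upper[OF rvq \<delta>] by blast
    have \<sigma>\<delta>: "\<sigma> - 1 + \<delta> = - \<delta>" by (simp add: \<delta>_def field_simps)
    have "(\<lambda>n. C * real (Suc n) powr (- \<delta>)) \<longlonglongrightarrow> 0" using \<delta> by real_asymp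
    then have "\<forall>\<^sub>F n in sequentially. C * real (Suc n) powr (- \<delta>) < 1" by (rule order_tendstoD) simp
    then have "\<forall>\<^sub>F n in sequentially. q n \<le> 1 + \<bar>0\<bar>"
    proof eventually_elim
      case (elim n)
      then show ?case using C(2)[of n] unfolding \<sigma>\<delta> by simp
    qed
    then show ?thesis unfolding p_def by (rule min_1_equiv[OF qpos tendsto_const])
  qed
  have rvp: "rv_seq p (\<sigma> - 1)" by (rule rv_seq_equiv[OF rvq ppos pq]) simp
  have wu: "(\<lambda>n. wsum p b I n / u n) \<longlonglongrightarrow> 1"
  proof -
    have "(\<lambda>m. wsum p b I m / (real (Suc m) ^ (h - 1) * p m ^ h) - Kc) \<longlonglongrightarrow> 0"
      using wsum_asymptotics[OF rvp \<sigma> I(1,3,2)] assms(3) unfolding cI Kc_def I_def by simp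
    then have "(\<lambda>m. wsum p b I m / (real (Suc m) ^ (h - 1) * p m ^ h)) \<longlonglongrightarrow> Kc" by (rule LIM_zero_cancel)
    then have "(\<lambda>m. wsum p b I m / (real (Suc m) ^ (h - 1) * p m ^ h) * (p m / q m) ^ h / Kc) \<longlonglongrightarrow> Kc * 1 ^ h / Kc"
      by (intro tendsto_intros pq) (use Kc in auto)
    moreover have "wsum p b I m / (real (Suc m) ^ (h - 1) * p m ^ h) * (p m / q m) ^ h / Kc = wsum p b I m / u m" for m
    proof -
      have "wsum p b I m / (real (Suc m) ^ (h - 1) * p m ^ h) * (p m / q m) ^ h / Kc = wsum p b I m / (Kc * real (Suc m) ^ (h - 1) * q m ^ h)"
        using ppos[of m] by (simp add: power_divide mult_ac)
      also have "Kc * real (Suc m) ^ (h - 1) * q m ^ h = u m" unfolding qh using Kc by simp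
      finally show ?thesis .
    qed
    ultimately show ?thesis using Kc by simp
  qed
  \<comment> \<open>A slightly enlarged \<open>\<sigma>\<close>, so that \<open>p m\<close> is
    bounded by a constant times \<open>(m + 1) powr (s - 1)\<close>; \<open>e\<close> below is the
    resulting exponent for \<open>h - 1\<close> variables. Expanding gives
    \<open>e = \<kappa> - \<kappa> / h - 1 / (2 * h) - 1 / (2 * h^2)\<close>, which lies strictly
    below \<open>g\<close>.\<close>
  define s where "s = \<sigma> + 1 / (2 * (real h)\<^sup>2)"
  define e where "e = (real h - 1) * s - 1"
  define g where "g = max 0 (\<kappa> - 1 / (2 * real h))"
  have s: "s > 0" unfolding s_def using \<sigma> by (simp add: add_pos_nonneg)
  have g: "0 \<le> g" "e < g"
  proof -
    have "e = \<kappa> - 1 / (2 * real h) - (\<kappa> / real h + 1 / (2 * (real h)\<^sup>2))"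
      unfolding e_def s_def \<sigma>_def using hpos by (simp add: field_simps power2_eq_square)
    moreover have "\<kappa> / real h + 1 / (2 * (real h)\<^sup>2) > 0" using \<kappa>0 hpos by (intro add_nonneg_pos) auto
    ultimately show "e < g" unfolding g_def by linarith
  qed (simp add: g_def)
  obtain Cp where Cp: "Cp > 0" "\<And>m. p m \<le> Cp * real (Suc m) powr (\<sigma> - 1 + 1 / (2 * (real h)\<^sup>2))"
    using rv_seq_upper[OF rvp, of "1 / (2 * (real h)\<^sup>2)"] hpos by auto
  have W: "\<exists>C>0. \<forall>m. wsum p c J m \<le> C * real (Suc m) powr e"
    if J: "finite J" "J \<noteq> {}" "card J \<le> h - 1" "\<forall>i\<in>J. c i > 0" for c J
  proof -
    define l where "l = card J"
    have l: "l \<ge> 1" "l \<le> h - 1" unfolding l_def using J by (auto simp: Suc_leI card_gt_0_iff)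
    obtain C where C: "C > 0" "\<And>m. wsum p c J m \<le> C * (real (Suc m) ^ (l - 1) * p m ^ l)"
      using wsum_upper[OF rvp \<sigma> J(1,2,4)] unfolding l_def by blast
    have "wsum p c J m \<le> C * Cp ^ l * real (Suc m) powr e" for m
    proof -
      have "p m ^ l \<le> (Cp * real (Suc m) powr (s - 1)) ^ l"
        using Cp(2)[of m] p01(1)[of m] unfolding s_def by (intro power_mono) (auto simp: algebra_simps)
      also have "\<dots> = Cp ^ l * real (Suc m) powr ((s - 1) * real l)"
        by (simp add: power_mult_distrib powr_realpow[symmetric] powr_powr)
      finally have "real (Suc m) powr (real l - 1) * p m ^ l \<le> real (Suc m) powr (real l - 1) * (Cp ^ l * real (Suc m) powr ((s - 1) * real l))"
        by (intro mult_left_mono) auto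
      also have "real (Suc m) powr (real l - 1) * (Cp ^ l * real (Suc m) powr ((s - 1) * real l)) = Cp ^ l * real (Suc m) powr (real l - 1 + (s - 1) * real l)"
        by (simp only: powr_add mult_ac)
      also have "\<dots> \<le> Cp ^ l * real (Suc m) powr e"
      proof (intro mult_left_mono powr_mono)
        have "real l \<le> real h - 1" using l assms(1) by linarith
        \<comment> \<open>The exponent for \<open>l\<close> variables is \<open>l * s - 1\<close>,
          increasing in \<open>l\<close>, so \<open>l = h - 1\<close> is the worst case.\<close>
        then have "real l * s \<le> (real h - 1) * s" using s by (intro mult_right_mono) auto
        then show "real l - 1 + (s - 1) * real l \<le> e" unfolding e_def by (simp add: algebra_simps)
      qed (use Cp(1) in auto)
      also have "real (Suc m) powr (real l - 1) = real (Suc m) ^ (l - 1)" using l by (simp add: powr_realpow[symmetric] of_nat_diff)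
      finally have "C * (real (Suc m) ^ (l - 1) * p m ^ l) \<le> C * (Cp ^ l * real (Suc m) powr e)" using C(1) by (intro mult_left_mono) auto
      then show ?thesis using C(2)[of m] by (simp add: mult.assoc)
    qed
    then show ?thesis using C(1) Cp(1) by (intro exI[of _ "C * Cp ^ l"]) auto
  qed
  \<comment> \<open>If the index is at most \<open>1 / (2 * h)\<close> then \<open>g = 0\<close> and
    the assumption on \<open>F / ln\<close> is used in full strength; otherwise \<open>u\<close>
    exceeds \<open>n powr g\<close> by a positive power, which beats the logarithm.\<close>
  have uG: "filterlim (\<lambda>n. u n / (real (Suc n) powr g * ln (real (Suc n)))) at_top sequentially"
  proof (cases "\<kappa> \<le> 1 / (2 * real h)")
    case True
    then have "g = 0" by (simp add: g_def)
    have "filterlim (\<lambda>n. F (real n) / ln (real n)) at_top sequentially"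
      by (rule filterlim_compose[OF assms(5) filterlim_real_sequentially])
    moreover have "(\<lambda>n. ln (real n) / ln (real (Suc n))) \<longlonglongrightarrow> 1" by real_asymp
    ultimately have "filterlim (\<lambda>n. ln (real n) / ln (real (Suc n)) * (F (real n) / ln (real n))) at_top sequentially"
      by (intro filterlim_tendsto_pos_mult_at_top[where c = 1]) auto
    moreover have "\<forall>\<^sub>F n in sequentially. ln (real n) / ln (real (Suc n)) * (F (real n) / ln (real n)) = u n / (real (Suc n) powr g * ln (real (Suc n)))"
      using eventually_gt_at_top[of 1] by eventually_elim (simp add: u_def \<open>g = 0\<close>)
    ultimately show ?thesis by (simp only: filterlim_cong[OF refl refl])
  next
    case False
    define \<delta> where "\<delta> = 1 / (4 * real h)"
    have \<delta>: "\<delta> > 0" using hpos by (simp add: \<delta>_def)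
    obtain c where c: "c > 0" "\<And>m. c * real (Suc m) powr (\<kappa> - \<delta>) \<le> u m" using rv_seq_lower[OF u \<delta>] by blast
    have g\<delta>: "\<kappa> - \<delta> = g + \<delta>" using False hpos by (simp add: g_def \<delta>_def field_simps)
    have "filterlim (\<lambda>n. c * real (Suc n) powr \<delta> / ln (real (Suc n))) at_top sequentially" using \<delta> c(1) by real_asymp
    then show ?thesis
    proof (rule filterlim_at_top_mono)
      show "\<forall>\<^sub>F n in sequentially. c * real (Suc n) powr \<delta> / ln (real (Suc n)) \<le> u n / (real (Suc n) powr g * ln (real (Suc n)))"
        using eventually_gt_at_top[of 0]
      proof eventually_elim
        case (elim n)
        have "c * real (Suc n) powr \<delta> / ln (real (Suc n)) = c * real (Suc n) powr (\<kappa> - \<delta>) / (real (Suc n) powr g * ln (real (Suc n)))"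
          unfolding g\<delta> powr_add by simp
        also have "\<dots> \<le> u n / (real (Suc n) powr g * ln (real (Suc n)))"
          using c(2)[of n] elim by (intro divide_right_mono) auto
        finally show ?case .
      qed
    qed
  qed
  have Gu: "(\<lambda>n. real (Suc n) powr g / u n) \<longlonglongrightarrow> 0"
  proof (rule Lim_null_comparison)
    have "(\<lambda>n. 1 / (u n / (real (Suc n) powr g * ln (real (Suc n))))) \<longlonglongrightarrow> 0"
      using tendsto_inverse_0_at_top[OF uG] by (simp add: inverse_eq_divide)
    then have "(\<lambda>n. 2 * (1 / (u n / (real (Suc n) powr g * ln (real (Suc n)))))) \<longlonglongrightarrow> 2 * 0" by (intro tendsto_intros)
    then show "(\<lambda>n. 2 * (1 / (u n / (real (Suc n) powr g * ln (real (Suc n)))))) \<longlonglongrightarrow> 0" by simp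
    show "\<forall>\<^sub>F n in sequentially. norm (real (Suc n) powr g / u n) \<le> 2 * (1 / (u n / (real (Suc n) powr g * ln (real (Suc n)))))"
      using eventually_ge_at_top[of 1]
    proof eventually_elim
      case (elim n)
      have "1 \<le> 2 * ln (real (Suc n))" using half_le_ln_Suc[OF elim] by linarith
      then have "real (Suc n) powr g / u n * 1 \<le> real (Suc n) powr g / u n * (2 * ln (real (Suc n)))"
        using upos[of n] by (intro mult_left_mono) auto
      then show ?case using upos[of n] by (simp add: mult_ac)
    qed
  qed
  \<comment> \<open>Tuples with repeated entries contribute at most a constant times
    \<open>n powr g\<close>, which is negligible against \<open>u n\<close>, so restricting to
    injective solutions does not change the mean asymptotically.\<close>
  have iwu: "(\<lambda>n. iwsum p b I n / u n) \<longlonglongrightarrow> 1"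
  proof -
    define P where "P = distinct_pairs I"
    have "\<exists>C>0. \<forall>m. wsum p (merge_coeff b r) (I - {snd r}) m \<le> C * real (Suc m) powr e" if "r \<in> P" for r
    proof (rule W)
      have r: "fst r \<in> I - {snd r}" "snd r \<in> I" using that by (auto simp: P_def distinct_pairs_def)
      then show "I - {snd r} \<noteq> {}" by blast
      show "card (I - {snd r}) \<le> h - 1" using r I cI by simp
    qed (use I in auto)
    then obtain C where C: "\<And>r. r \<in> P \<Longrightarrow> C r > 0" "\<And>r m. r \<in> P \<Longrightarrow> wsum p (merge_coeff b r) (I - {snd r}) m \<le> C r * real (Suc m) powr e" by metis
    define CP where "CP = (\<Sum>r\<in>P. C r)"
    have low: "wsum p b I n \<le> iwsum p b I n + CP * real (Suc n) powr g" for n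
    proof -
      have "wsum p b I n \<le> iwsum p b I n + (\<Sum>r\<in>P. wsum p (merge_coeff b r) (I - {snd r}) n)"
        using wsum_le_iwsum[OF I(1,2) p01, where n = n] by (simp only: P_def distinct_pairs_def case_prod_unfold)
      also have "(\<Sum>r\<in>P. wsum p (merge_coeff b r) (I - {snd r}) n) \<le> (\<Sum>r\<in>P. C r * real (Suc n) powr g)"
      proof (rule sum_mono)
        fix r assume r: "r \<in> P"
        have "C r * real (Suc n) powr e \<le> C r * real (Suc n) powr g"
          using C(1)[OF r] g by (intro mult_left_mono powr_mono) auto
        then show "wsum p (merge_coeff b r) (I - {snd r}) n \<le> C r * real (Suc n) powr g" using C(2)[OF r, of n] by linarith
      qed
      finally show ?thesis by (simp add: CP_def sum_distrib_right)
    qed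
    show ?thesis
    proof (rule tendsto_sandwich)
      show "(\<lambda>n. wsum p b I n / u n - CP * (real (Suc n) powr g / u n)) \<longlonglongrightarrow> 1"
        using tendsto_diff[OF wu tendsto_mult[OF tendsto_const[of CP] Gu]] by simp
      show "\<forall>\<^sub>F n in sequentially. wsum p b I n / u n - CP * (real (Suc n) powr g / u n) \<le> iwsum p b I n / u n"
      proof (intro always_eventually allI)
        fix n
        have "wsum p b I n / u n \<le> (iwsum p b I n + CP * real (Suc n) powr g) / u n"
          using low[of n] upos[of n] by (intro divide_right_mono) auto
        then show "wsum p b I n / u n - CP * (real (Suc n) powr g / u n) \<le> iwsum p b I n / u n" by (simp add: add_divide_distrib)
      qed
      show "\<forall>\<^sub>F n in sequentially. iwsum p b I n / u n \<le> wsum p b I n / u n"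
        using iwsum_le_wsum[OF I(1,2) p01(1)] upos by (intro always_eventually allI divide_right_mono) (auto simp: less_imp_le)
    qed (rule wu)
  qed
  have big: "filterlim (\<lambda>n. iwsum p b I n / (real (Suc n) powr g * ln (real (Suc n)))) at_top sequentially"
  proof -
    have "filterlim (\<lambda>n. iwsum p b I n / u n * (u n / (real (Suc n) powr g * ln (real (Suc n))))) at_top sequentially"
      by (rule filterlim_tendsto_pos_mult_at_top[OF iwu _ uG]) simp
    then show ?thesis using upos by (simp add: less_imp_neq[symmetric])
  qed
  have "\<exists>A. (\<lambda>n. real (card (reps b I A n)) / iwsum p b I n) \<longlonglongrightarrow> 1"
    by (rule exists_concentrated_set[OF p01 g W I(1,2) _ big]) (use cI assms(1) in auto)
  then obtain A where A: "(\<lambda>n. real (card (reps b I A n)) / iwsum p b I n) \<longlonglongrightarrow> 1" by blast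
  have "(\<lambda>n. real (card (reps b I A n)) / iwsum p b I n * (iwsum p b I n / u n)) \<longlonglongrightarrow> 1 * 1"
    by (rule tendsto_mult[OF A iwu])
  moreover have "\<forall>\<^sub>F n in sequentially. 1 / 2 < iwsum p b I n / u n" by (rule order_tendstoD(1)[OF iwu]) simp
  then have "\<forall>\<^sub>F n in sequentially. real (card (reps b I A n)) / iwsum p b I n * (iwsum p b I n / u n) = real (rep b A h n) / F (real n)"
    using eventually_gt_at_top[of 0]
  proof eventually_elim
    case (elim n)
    then have "iwsum p b I n \<noteq> 0" by auto
    then show ?case using elim by (simp add: rep_eq_card_reps I_def u_def)
  qed
  ultimately have "(\<lambda>n. real (rep b A h n) / F (real n)) \<longlonglongrightarrow> 1 * 1" by (rule Lim_transform_eventually)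
  then have "(\<lambda>n. real (rep b A h n)) \<sim>[at_top] (\<lambda>n. F (real n))"
    by (intro asymp_equivI') simp
  then show ?thesis by blast
qed

end
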